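(* Let $c=(c_1,c_2,c_3,c_4)$ with $c_1>c_2>c_3>c_4>0$, and put $$d_1=c_1+c_2+c_3+c_4,\quad d_2=c_1+c_2-c_3-c_4,\quad d_3=c_1-c_2+c_3-c_4,\quad d_4=c_1-c_2-c_3+c_4 .$$ Then the common limit $m^\infty_*(c)$ of the components of Borchardt's mean iteration $\{m^n(c)\}_{n\in\mathbb N}$ is $$m^\infty_*(c)=\frac{4\sqrt{c_2c_3(c_1c_2-c_3c_4)(c_1c_3-c_2c_4)}}{(\sqrt{d_1d_2}-\sqrt{d_3d_4})(\sqrt{d_1d_3}-\sqrt{d_2d_4})}\,\frac1{F_S(z)}=\frac{4\sqrt{c_2c_3(c_1c_2-c_3c_4)(c_1c_3-c_2c_4)}}{(\sqrt{d_1d_2}+\sqrt{d_3d_4})(\sqrt{d_1d_3}+\sqrt{d_2d_4})}\,\frac1{F_S(w)},$$ where $$z=\begin{pmatrix}z_1&z_3\\ z_2&z_4\end{pmatrix}=\begin{pmatrix}1-\dfrac{c_4}{c_2}\dfrac{\sqrt{d_1d_3}-\sqrt{d_2d_4}}{\sqrt{d_1d_3}+\sqrt{d_2d_4}}&1-\dfrac{c_1}{c_3}\dfrac{\sqrt{d_1d_3}-\sqrt{d_2d_4}}{\sqrt{d_1d_3}+\sqrt{d_2d_4}}\\[4mm]1-\dfrac{c_1}{c_2}\dfrac{\sqrt{d_1d_2}-\sqrt{d_3d_4}}{\sqrt{d_1d_2}+\sqrt{d_3d_4}}&1-\dfrac{c_4}{c_3}\dfrac{\sqrt{d_1d_2}-\sqrt{d_3d_4}}{\sqrt{d_1d_2}+\sqrt{d_3d_4}}\end{pmatrix},$$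 $$w=\begin{pmatrix}w_1&w_3\\ w_2&w_4\end{pmatrix}=\begin{pmatrix}1-\dfrac{c_4}{c_2}\dfrac{\sqrt{d_1d_3}+\sqrt{d_2d_4}}{\sqrt{d_1d_3}-\sqrt{d_2d_4}}&1-\dfrac{c_1}{c_3}\dfrac{\sqrt{d_1d_3}+\sqrt{d_2d_4}}{\sqrt{d_1d_3}-\sqrt{d_2d_4}}\\[4mm]1-\dfrac{c_1}{c_2}\dfrac{\sqrt{d_1d_2}+\sqrt{d_3d_4}}{\sqrt{d_1d_2}-\sqrt{d_3d_4}}&1-\dfrac{c_4}{c_3}\dfrac{\sqrt{d_1d_2}+\sqrt{d_3d_4}}{\sqrt{d_1d_2}-\sqrt{d_3d_4}}\end{pmatrix}.$$
   Context: Borchardt's map $m=(m_1,\dots,m_4):(\mathbb R_{>0})^4\to(\mathbb R_{>0})^4$ is $$m_1(u)=\frac{u_1+u_2+u_3+u_4}{4},\quad m_2(u)=\frac{\sqrt{u_1u_2}+\sqrt{u_3u_4}}{2},\quad m_3(u)=\frac{\sqrt{u_1u_3}+\sqrt{u_2u_4}}{2},\quad m_4(u)=\frac{\sqrt{u_1u_4}+\sqrt{u_2u_3}}{2},$$ and $m^n(c)$ is its $n$-fold iterate applied to $c$. The four components of $m^n(c)$ converge as $n\to\infty$ to a common limit, denoted $m^\infty_*(c)$. One has $d_1,d_2,d_3>0$. Square roots of nonnegative reals are nonnegative; if $d_4<0$, then $\sqrt{d_2d_4}$ and $\sqrt{d_3d_4}$ mean $\sqrt{-1}\sqrt{|d_2d_4|}$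 and $\sqrt{-1}\sqrt{|d_3d_4|}$. The hypergeometric function $F_S$ of $z=\begin{pmatrix}z_1&z_3\\ z_2&z_4\end{pmatrix}$ is $$F_S(z)=\sum_{n\in\mathbb N^4}\frac{(\frac12)_{n_1+n_3}(\frac12)_{n_2+n_4}(\frac12)_{n_1+n_2}(\frac12)_{n_3+n_4}}{(1)_{n_1+n_3}(1)_{n_2+n_4}\,n_1!\,n_2!\,n_3!\,n_4!}\,z_1^{n_1}z_2^{n_2}z_3^{n_3}z_4^{n_4},$$ $\mathbb N=\{0,1,2,\dots\}$, $(a)_k=a(a+1)\cdots(a+k-1)$, convergent for $|z_1|+|z_2|<1$, $|z_3|+|z_4|<1$. Outside this domain $F_S(z)$ is understood through the Euler integral $$F_S(z)=\frac1{\pi^2}\int_0^1\!\!\int_0^1\frac{ds_1\,ds_2}{\sqrt{s_1(1-s_1)s_2(1-s_2)}\,(1-z_1s_1-z_2s_2)^{1/2}(1-z_3s_1-z_4s_2)^{1/2}}$$ (which equals the series on its domain of convergence), where the two linear factors are nonvanishing on $[0,1]^2$ with arguments continuous and equal to $0$ at $(s_1,s_2)=(0,0)$. *)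

theory Defs
  imports "HOL-Analysis.Analysis"
begin

definition borchardt :: "real^4 \<Rightarrow> real^4" where
  "borchardt u = vector
    [ (u$1 + u$2 + u$3 + u$4) / 4,
      (sqrt (u$1 * u$2) + sqrt (u$3 * u$4)) / 2,
      (sqrt (u$1 * u$3) + sqrt (u$2 * u$4)) / 2,
      (sqrt (u$1 * u$4) + sqrt (u$2 * u$3)) / 2 ]"

definition borchardt_mean :: "real^4 \<Rightarrow> real" where
  "borchardt_mean c = (THE L. \<forall>i. (\<lambda>n. (borchardt ^^ n) c $ i) \<longlonglongrightarrow> L)"

definition unit_square :: "(real \<times> real) set" where
  "unit_square = {0..1} \<times> {0..1}"

definition lin_factor :: "complex \<Rightarrow> complex \<Rightarrow> real \<times> real \<Rightarrow> complex" where
  "lin_factor a b s = 1 - a * of_real (fst s) - b * of_real (snd s)"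

(* A continuous argument of the linear factor on the square, normalised to 0 at the origin.
   If the factor has no zero on the square, it exists and is unique there. *)
definition lin_factor_arg :: "complex \<Rightarrow> complex \<Rightarrow> real \<times> real \<Rightarrow> real" where
  "lin_factor_arg a b = (SOME \<theta>. continuous_on unit_square \<theta> \<and> \<theta> (0, 0) = 0 \<and>
     (\<forall>s\<in>unit_square. lin_factor a b s = of_real (cmod (lin_factor a b s)) * cis (\<theta> s)))"

definition lin_factor_sqrt :: "complex \<Rightarrow> complex \<Rightarrow> real \<times> real \<Rightarrow> complex" where
  "lin_factor_sqrt a b s =
     of_real (sqrt (cmod (lin_factor a b s))) * cis (lin_factor_arg a b s / 2)"

definition FS_series :: "complex \<Rightarrow> complex \<Rightarrow> complex \<Rightarrow> complex \<Rightarrow> complex" where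
  "FS_series z1 z2 z3 z4 =
     (\<Sum>\<^sub>\<infinity>(n1, n2, n3, n4)\<in>(UNIV :: (nat \<times> nat \<times> nat \<times> nat) set).
        pochhammer (1/2) (n1 + n3) * pochhammer (1/2) (n2 + n4) *
        pochhammer (1/2) (n1 + n2) * pochhammer (1/2) (n3 + n4) /
        (pochhammer 1 (n1 + n3) * pochhammer 1 (n2 + n4) *
         fact n1 * fact n2 * fact n3 * fact n4) *
        z1 ^ n1 * z2 ^ n2 * z3 ^ n3 * z4 ^ n4)"

definition FS_integral :: "complex \<Rightarrow> complex \<Rightarrow> complex \<Rightarrow> complex \<Rightarrow> complex" where
  "FS_integral z1 z2 z3 z4 = 1 / of_real (pi\<^sup>2) *
     (LINT s:unit_square|lborel.
        1 / (of_real (sqrt (fst s * (1 - fst s) * snd s * (1 - snd s))) *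
             lin_factor_sqrt z1 z2 s * lin_factor_sqrt z3 z4 s))"

(* The arguments are the entries of the matrix (z1 z3; z2 z4), column by column.
   The last branch is a dummy value for arguments where neither representation is available.
   Since 1 / 0 = 0, an identity of the form m = k / FS z1 z2 z3 z4 with m > 0
   can only hold outside this branch. *)
definition FS :: "complex \<Rightarrow> complex \<Rightarrow> complex \<Rightarrow> complex \<Rightarrow> complex" where
  "FS z1 z2 z3 z4 =
     (if cmod z1 + cmod z2 < 1 \<and> cmod z3 + cmod z4 < 1 then FS_series z1 z2 z3 z4
      else if \<forall>s\<in>unit_square. lin_factor z1 z2 s \<noteq> 0 \<and> lin_factor z3 z4 s \<noteq> 0
        then FS_integral z1 z2 z3 z4
      else 0)"

end

theory Submission
  imports Defs "HOL-Complex_Analysis.Cauchy_Integral_Theorem" "HOL-Real_Asymp.Real_Asymp"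
begin

text \<open>To positive numbers \<open>c1, c2, c3, c4\<close> attach the integral \<open>J c\<close>, written \<open>borchardt_integral\<close>, of
\<open>1 / sqrt (x * y * (c2 + c3 * x + c1 * y + c4 * x * y) * (c4 + c1 * x + c3 * y + c2 * x * y))\<close>
over the quadrant \<open>x, y > 0\<close>. It plays the part that the complete elliptic integral plays for the
arithmetic-geometric mean. Both bilinear factors lie between \<open>min c * (1 + x) * (1 + y)\<close> and
\<open>max c * (1 + x) * (1 + y)\<close>, so \<open>J c\<close> lies between \<open>pi\<^sup>2 / max c\<close> and \<open>pi\<^sup>2 / min c\<close>
(\<open>borchardt_integral_bounds\<close>). A step of the iteration does not change \<open>J\<close>
(\<open>borchardt_integral_step\<close>), and all entries of the iterates tend to one limit \<open>L\<close>; hence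
\<open>J c = pi\<^sup>2 / L\<close> (\<open>borchardt_limit\<close>).

The invariance comes from two ways of seeing \<open>J\<close> as a one-dimensional integral of complete elliptic
integrals: integrate over \<open>y\<close> first, or over \<open>x\<close> first. In the first form the fibre depends, up to
a scalar, on a single modulus \<open>m\<close>, and Landen's substitution \<open>e = v + m / v\<close> in the fibre turns
\<open>J c\<close> into an integral over a region of the \<open>(m, e)\<close>-plane (\<open>borchardt_integral_eq_landen\<close>).
This region is swept not only by the lines of constant \<open>m\<close> but also by a pencil of conics, each
of which has a rational parametrisation. Integrating along the conics first gives again a family of
complete elliptic integrals (\<open>nn_integral_landen_conic\<close>), and this family is the second form of
\<open>J\<close> at the next iterate of \<open>c\<close>.

On the hypergeometric side, the substitution \<open>s = x / (1 + x)\<close>, \<open>t = y / (1 + y)\<close> takes the Euler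
integral to the quadrant. The two fractions of square roots that occur in the matrix are squares
\<open>u1\<^sup>2\<close> and \<open>u2\<^sup>2\<close>, and they satisfy two relations that make the linear factors, up to positive
factors, equal to the bilinear factors of \<open>J\<close> at \<open>(u1\<^sup>2 * x, u2\<^sup>2 * y)\<close>, with \<open>c3\<close> and \<open>c4\<close> exchanged
(\<open>FS_euler_eq_Q\<close>); \<open>J\<close> is symmetric in \<open>c3\<close> and \<open>c4\<close>. Turning the two contours back to the
positive half-line by Cauchy's theorem costs the factor \<open>u1 * u2\<close> (\<open>Q_rotation\<close>), so that
\<open>F\<^sub>S = sqrt (c2 * c3) / (u1 * u2 * L)\<close> (\<open>FS_value\<close>). The two formulas of the theorem are the two
choices of sign \<open>s\<close> in \<open>borchardt_mean_FS\<close>. If \<open>d4 < 0\<close> then \<open>u1\<close> and \<open>u2\<close> are not real,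
and the rotation is possible because \<open>e = cnj (u1 * u2)\<close> brings the four numbers
\<open>1, u1\<^sup>2, u2\<^sup>2, u1\<^sup>2 * u2\<^sup>2\<close> into the right half-plane at once. Inside the domain of convergence
the series is compared with the Euler integral term by term (\<open>FS_series_eq_euler\<close>).\<close>

section \<open>Substitution in nonnegative integrals\<close>

text \<open>On a Borel set \<open>A\<close> the equality is the substitution rule for the constant \<open>1\<close> on the part of \<open>S\<close>
that \<open>g\<close> sends to \<open>A\<close>. Integrability of \<open>g'\<close> there is equivalent to finite measure of the image,
so that the two sides are infinite together.\<close>

lemma distr_density_change_of_variables:
  fixes g g' :: "real \<Rightarrow> real"
  assumes S [measurable]: "S \<in> sets borel" and im [measurable]: "g ` S \<in> sets borel"
    and der: "\<And>x. x \<in> S \<Longrightarrow> (g has_real_derivative g' x) (at x)"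
    and inj: "inj_on g S"
    and meas [measurable]: "g \<in> borel_measurable borel" "g' \<in> borel_measurable borel"
  shows "distr (density lborel (\<lambda>x. ennreal \<bar>g' x\<bar> * indicator S x)) borel g
       = density lborel (indicator (g ` S))"
proof (rule measure_eqI)
  fix A assume "A \<in> sets (distr (density lborel (\<lambda>x. ennreal \<bar>g' x\<bar> * indicator S x)) borel g)"
  then have A [measurable]: "A \<in> sets borel" by simp
  let ?T = "S \<inter> g -` A"
  have T [measurable]: "?T \<in> sets borel"
    using measurable_sets[OF meas(1) A] by auto
  have gT: "g ` ?T = g ` S \<inter> A" by auto
  have cov: "(\<lambda>x. \<bar>g' x\<bar> *\<^sub>R (1::real)) absolutely_integrable_on ?T
      \<and> integral ?T (\<lambda>x. \<bar>g' x\<bar> *\<^sub>R (1::real)) = b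
      \<longleftrightarrow> (\<lambda>_. 1::real) absolutely_integrable_on (g ` ?T) \<and> integral (g ` ?T) (\<lambda>_. 1::real) = b" for b
    by (rule has_absolute_integral_change_of_variables_real[where f = "\<lambda>_. 1::real"])
       (use der inj T in \<open>auto intro: DERIV_subset inj_on_subset\<close>)
  have eqn: "emeasure lborel (g ` ?T) = (\<integral>\<^sup>+x. ennreal \<bar>g' x\<bar> * indicator ?T x \<partial>lborel)"
  proof (cases "(\<lambda>x. \<bar>g' x\<bar>) absolutely_integrable_on ?T")
    case True
    then have *: "(\<lambda>_. 1::real) absolutely_integrable_on (g ` ?T)"
      "integral (g ` ?T) (\<lambda>_. 1::real) = integral ?T (\<lambda>x. \<bar>g' x\<bar>)"
      using cov[of "integral ?T (\<lambda>x. \<bar>g' x\<bar>)"] by auto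
    have 1: "((\<lambda>x. \<bar>g' x\<bar> * indicator ?T x) has_integral integral ?T (\<lambda>x. \<bar>g' x\<bar>)) UNIV"
      using has_integral_restrict_UNIV[THEN iffD2, OF integrable_integral[OF set_lebesgue_integral_eq_integral(1)[OF True]]]
      by (rule has_integral_eq[rotated]) (auto simp: indicator_def)
    have 2: "((\<lambda>x. indicat_real (g ` ?T) x) has_integral integral (g ` ?T) (\<lambda>x. 1)) UNIV"
      using has_integral_restrict_UNIV[THEN iffD2, OF integrable_integral[OF set_lebesgue_integral_eq_integral(1)[OF *(1)]]]
      by (rule has_integral_eq[rotated]) (simp add: indicator_def)
    have "(\<integral>\<^sup>+x. ennreal \<bar>g' x\<bar> * indicator ?T x \<partial>lborel) = (\<integral>\<^sup>+x. ennreal (\<bar>g' x\<bar> * indicator ?T x) \<partial>lborel)"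
      by (intro nn_integral_cong) (simp add: indicator_def)
    also have "\<dots> = ennreal (integral ?T (\<lambda>x. \<bar>g' x\<bar>))"
      by (rule nn_integral_has_integral_lborel[OF _ _ 1]) simp_all
    also have "\<dots> = ennreal (integral (g ` ?T) (\<lambda>_. 1::real))" using * by simp
    also have "\<dots> = (\<integral>\<^sup>+x. ennreal (indicator (g ` ?T) x) \<partial>lborel)"
      by (rule nn_integral_has_integral_lborel[OF _ _ 2, symmetric]) (simp_all add: gT)
    also have "\<dots> = emeasure lborel (g ` ?T)" unfolding gT by (simp add: ennreal_indicator)
    finally show ?thesis by simp
  next
    case False
    then have n: "\<not> (\<lambda>_. 1::real) absolutely_integrable_on (g ` ?T)"
      using cov by auto
    have "emeasure lborel (g ` ?T) = \<infinity>"
    proof (rule ccontr)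
      assume "emeasure lborel (g ` ?T) \<noteq> \<infinity>"
      then have "set_integrable lborel (g ` ?T) (\<lambda>_. 1::real)"
        unfolding set_integrable_def gT by (simp add: less_top)
      then have "(\<lambda>_. 1::real) absolutely_integrable_on (g ` ?T)"
        unfolding set_integrable_def by (rule integrable_completion[THEN iffD2, rotated]) (auto simp: gT)
      with n show False by simp
    qed
    moreover have "(\<integral>\<^sup>+x. ennreal \<bar>g' x\<bar> * indicator ?T x \<partial>lborel) = \<infinity>"
    proof (rule ccontr)
      assume fin: "(\<integral>\<^sup>+x. ennreal \<bar>g' x\<bar> * indicator ?T x \<partial>lborel) \<noteq> \<infinity>"
      have "(\<integral>\<^sup>+x. ennreal (norm (indicat_real ?T x *\<^sub>R \<bar>g' x\<bar>)) \<partial>lborel) = (\<integral>\<^sup>+x. ennreal \<bar>g' x\<bar> * indicator ?T x \<partial>lborel)"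
        by (intro nn_integral_cong) (auto simp: indicator_def)
      with fin have "set_integrable lborel ?T (\<lambda>x. \<bar>g' x\<bar>)"
        unfolding set_integrable_def by (intro integrableI_bounded) (auto simp: less_top)
      then have "(\<lambda>x. \<bar>g' x\<bar>) absolutely_integrable_on ?T"
        unfolding set_integrable_def by (rule integrable_completion[THEN iffD2, rotated]) auto
      with False show False by simp
    qed
    ultimately show ?thesis by simp
  qed
  have "emeasure (distr (density lborel (\<lambda>x. ennreal \<bar>g' x\<bar> * indicator S x)) borel g) A
     = (\<integral>\<^sup>+x. ennreal \<bar>g' x\<bar> * indicator S x * indicator (g -` A) x \<partial>lborel)"
    using measurable_sets[OF meas(1) A] by (simp add: emeasure_distr emeasure_density)
  also have "\<dots> = (\<integral>\<^sup>+x. ennreal \<bar>g' x\<bar> * indicator ?T x \<partial>lborel)"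
    by (intro nn_integral_cong) (auto simp: indicator_def)
  also have "\<dots> = emeasure lborel (g ` S \<inter> A)" using eqn gT by simp
  also have "\<dots> = (\<integral>\<^sup>+x. indicator (g ` S) x * indicator A x \<partial>lborel)"
    by (simp flip: indicator_inter_arith)
  also have "\<dots> = emeasure (density lborel (indicator (g ` S))) A"
    by (simp add: emeasure_density)
  finally show "emeasure (distr (density lborel (\<lambda>x. ennreal \<bar>g' x\<bar> * indicator S x)) borel g) A
    = emeasure (density lborel (indicator (g ` S))) A" .
qed simp

text \<open>With values in \<open>ennreal\<close>, integrals can be transformed before they are known to be finite; that the double
integral below is finite follows from \<open>borchardt_integral_bounds\<close>.\<close>

lemma nn_integral_change_of_variables:
  fixes g g' :: "real \<Rightarrow> real" and f :: "real \<Rightarrow> ennreal"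
  assumes bij: "bij_betw g S T" and S [measurable]: "S \<in> sets borel" and T [measurable]: "T \<in> sets borel"
    and der: "\<And>x. x \<in> S \<Longrightarrow> (g has_real_derivative g' x) (at x)"
    and meas [measurable]: "g \<in> borel_measurable borel" "g' \<in> borel_measurable borel"
      "f \<in> borel_measurable borel"
  shows "(\<integral>\<^sup>+y\<in>T. f y \<partial>lborel) = (\<integral>\<^sup>+x\<in>S. ennreal \<bar>g' x\<bar> * f (g x) \<partial>lborel)"
proof -
  have im: "g ` S = T" and inj: "inj_on g S"
    using bij by (auto simp: bij_betw_def)
  have "(\<integral>\<^sup>+y\<in>T. f y \<partial>lborel) = (\<integral>\<^sup>+y. f y \<partial>density lborel (indicator (g ` S)))"
    unfolding im by (subst nn_integral_density) (auto simp: mult.commute)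
  also have "\<dots> = (\<integral>\<^sup>+y. f y \<partial>distr (density lborel (\<lambda>x. ennreal \<bar>g' x\<bar> * indicator S x)) borel g)"
    using distr_density_change_of_variables[OF S _ der inj meas(1,2)] T im by simp
  also have "\<dots> = (\<integral>\<^sup>+x\<in>S. ennreal \<bar>g' x\<bar> * f (g x) \<partial>lborel)"
    by (subst nn_integral_distr, simp, simp, subst nn_integral_density) (auto simp: mult_ac)
  finally show ?thesis .
qed

section \<open>Complete elliptic integrals and Landen's substitution\<close>

text \<open>With \<open>v = (tan \<theta>)\<^sup>2\<close> this is twice the integral of \<open>1 / sqrt (E * (cos \<theta>)\<^sup>2 + F * (sin \<theta>)\<^sup>2)\<close>
from \<open>0\<close> to \<open>pi / 2\<close>: a complete elliptic integral of the first kind. The algebraic form is the one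
in which fibres of two-dimensional integrals appear.\<close>

definition legendre :: "real \<Rightarrow> real \<Rightarrow> ennreal" where
  "legendre E F = (\<integral>\<^sup>+v\<in>{0<..}. ennreal (1 / sqrt (v * (1 + v) * (E + F * v))) \<partial>lborel)"

text \<open>The integral \<open>legendre m 1\<close> folded along the involution \<open>v \<mapsto> m / v\<close>, in the invariant coordinate
\<open>e = v + m / v\<close>; see \<open>legendre_eq_landen\<close>.\<close>

definition landen :: "real \<Rightarrow> ennreal" where
  "landen m = (\<integral>\<^sup>+e\<in>{2 * sqrt m<..}. ennreal (1 / sqrt ((e\<^sup>2 - 4 * m) * (1 + e + m))) \<partial>lborel)"

lemma measurable_legendre [measurable]:
  assumes [measurable]: "f \<in> borel_measurable M" "g \<in> borel_measurable M"
  shows "(\<lambda>x. legendre (f x) (g x)) \<in> borel_measurable M"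
  unfolding legendre_def by measurable

lemma measurable_landen [measurable]:
  assumes [measurable]: "f \<in> borel_measurable M"
  shows "(\<lambda>x. landen (f x)) \<in> borel_measurable M"
  unfolding landen_def indicator_def of_bool_def greaterThan_iff by measurable

lemma sqrt_power2_mult: "k \<ge> 0 \<Longrightarrow> sqrt (k\<^sup>2 * x) = k * sqrt x"
  by (simp add: real_sqrt_mult)

lemma set_nn_integral_cmult:
  assumes "f \<in> borel_measurable M" "A \<in> sets M"
  shows "(\<integral>\<^sup>+x\<in>A. c * f x \<partial>M) = c * (\<integral>\<^sup>+x\<in>A. f x \<partial>M)"
  using assms by (subst nn_integral_cmult[symmetric]) (auto simp: mult_ac)

lemma bij_betw_scale: "k > 0 \<Longrightarrow> bij_betw (\<lambda>v::real. k * v) {0<..} {0<..}"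
  by (rule bij_betwI[where g = "\<lambda>x. x / k"]) auto

lemma legendre_cubic:
  assumes "A > 0" "B > 0" "C > 0" "D > 0"
  shows "(\<integral>\<^sup>+x\<in>{0<..}. ennreal (1 / sqrt (x * (A + B * x) * (C + D * x))) \<partial>lborel)
       = legendre (B * C) (A * D)"
proof -
  have "(\<integral>\<^sup>+x\<in>{0<..}. ennreal (1 / sqrt (x * (A + B * x) * (C + D * x))) \<partial>lborel)
      = (\<integral>\<^sup>+v\<in>{0<..}. ennreal \<bar>A / B\<bar> * ennreal (1 / sqrt (A / B * v * (A + B * (A / B * v)) * (C + D * (A / B * v)))) \<partial>lborel)"
    by (rule nn_integral_change_of_variables[OF bij_betw_scale])
       (use assms in \<open>auto intro!: derivative_eq_intros\<close>)
  also have "\<dots> = legendre (B * C) (A * D)"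
    unfolding legendre_def
  proof (rule set_nn_integral_cong[OF refl refl])
    fix v :: real assume "v \<in> space lborel \<inter> {0<..}"
    then have v: "v > 0" by simp
    show "ennreal \<bar>A / B\<bar> * ennreal (1 / sqrt (A / B * v * (A + B * (A / B * v)) * (C + D * (A / B * v))))
        = ennreal (1 / sqrt (v * (1 + v) * (B * C + A * D * v)))"
    proof -
      have "A / B * v * (A + B * (A / B * v)) * (C + D * (A / B * v))
          = (A / B)\<^sup>2 * (v * (1 + v) * (B * C + A * D * v))"
        using assms by (simp add: field_simps power2_eq_square)
      then have "sqrt (A / B * v * (A + B * (A / B * v)) * (C + D * (A / B * v)))
          = A / B * sqrt (v * (1 + v) * (B * C + A * D * v))"
        using assms by (simp add: real_sqrt_mult)
      then show ?thesis using assms v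
        by (simp add: ennreal_mult[symmetric] field_simps)
    qed
  qed
  finally show ?thesis .
qed

lemma legendre_scale:
  assumes "k > 0"
  shows "legendre (k\<^sup>2 * E) (k\<^sup>2 * F) = ennreal (1 / k) * legendre E F"
proof -
  have *: "sqrt (v * (1 + v) * (k\<^sup>2 * E + k\<^sup>2 * F * v)) = k * sqrt (v * (1 + v) * (E + F * v))" for v
  proof -
    have "v * (1 + v) * (k\<^sup>2 * E + k\<^sup>2 * F * v) = k\<^sup>2 * (v * (1 + v) * (E + F * v))"
      by (simp add: algebra_simps)
    then show ?thesis using assms by (simp only: sqrt_power2_mult[of k] less_imp_le)
  qed
  have "legendre (k\<^sup>2 * E) (k\<^sup>2 * F)
      = (\<integral>\<^sup>+v\<in>{0<..}. ennreal (1 / k) * ennreal (1 / sqrt (v * (1 + v) * (E + F * v))) \<partial>lborel)"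
    unfolding legendre_def *
    by (intro nn_integral_cong) (use assms in \<open>simp add: ennreal_mult'[symmetric]\<close>)
  also have "\<dots> = ennreal (1 / k) * legendre E F"
    unfolding legendre_def by (rule set_nn_integral_cmult) auto
  finally show ?thesis .
qed

text \<open>The involution \<open>v \<mapsto> m / v\<close> exchanges the two sides of its fixed point \<open>sqrt m\<close>.\<close>

lemma nn_integral_fold_reciprocal:
  fixes f :: "real \<Rightarrow> ennreal"
  assumes m: "m > 0" and f [measurable]: "f \<in> borel_measurable borel"
    and sym: "\<And>v. v > 0 \<Longrightarrow> ennreal (m / v\<^sup>2) * f (m / v) = f v"
  shows "(\<integral>\<^sup>+v\<in>{0<..}. f v \<partial>lborel) = 2 * (\<integral>\<^sup>+v\<in>{sqrt m<..}. f v \<partial>lborel)"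
proof -
  have s: "sqrt m > 0" "sqrt m * sqrt m = m" using m by auto
  have bij: "bij_betw (\<lambda>v. m / v) {sqrt m<..} {0<..<sqrt m}"
  proof (rule bij_betwI[where g = "\<lambda>x. m / x"])
    show "(\<lambda>v. m / v) \<in> {sqrt m<..} \<rightarrow> {0<..<sqrt m}"
    proof
      fix v assume v: "v \<in> {sqrt m<..}"
      then have "v > 0" using order_less_trans[OF s(1), of v] by simp
      have "m < sqrt m * v" using v s by (metis greaterThan_iff mult_strict_left_mono)
      with \<open>v > 0\<close> m show "m / v \<in> {0<..<sqrt m}" by (simp add: field_simps)
    qed
    show "(\<lambda>v. m / v) \<in> {0<..<sqrt m} \<rightarrow> {sqrt m<..}"
    proof
      fix v assume v: "v \<in> {0<..<sqrt m}"
      have "sqrt m * v < m" using v s by (metis greaterThanLessThan_iff mult_strict_left_mono)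
      with v m show "m / v \<in> {sqrt m<..}" by (simp add: field_simps)
    qed
  qed (use m s in \<open>auto simp: field_simps\<close>)
  have "(\<integral>\<^sup>+v\<in>{0<..}. f v \<partial>lborel)
      = (\<integral>\<^sup>+v. f v * indicator {0<..<sqrt m} v + f v * indicator {sqrt m<..} v \<partial>lborel)"
    by (rule nn_integral_cong_AE, rule eventually_mono[OF AE_lborel_singleton[of "sqrt m"]])
       (auto simp: indicator_def dest: order_less_trans[OF s(1)])
  also have "\<dots> = (\<integral>\<^sup>+v\<in>{0<..<sqrt m}. f v \<partial>lborel) + (\<integral>\<^sup>+v\<in>{sqrt m<..}. f v \<partial>lborel)"
    by (rule nn_integral_add) auto
  also have "(\<integral>\<^sup>+v\<in>{0<..<sqrt m}. f v \<partial>lborel)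
      = (\<integral>\<^sup>+v\<in>{sqrt m<..}. ennreal \<bar>- m / v\<^sup>2\<bar> * f (m / v) \<partial>lborel)"
    by (rule nn_integral_change_of_variables[OF bij])
       (auto intro!: derivative_eq_intros dest: order_less_trans[OF s(1)] simp: power2_eq_square)
  also have "\<dots> = (\<integral>\<^sup>+v\<in>{sqrt m<..}. f v \<partial>lborel)"
  proof (intro nn_integral_cong)
    fix v
    show "ennreal \<bar>- m / v\<^sup>2\<bar> * f (m / v) * indicator {sqrt m<..} v = f v * indicator {sqrt m<..} v"
      using sym[of v] m s(1) order_less_trans[of 0 "sqrt m" v] by (cases "v > sqrt m") auto
  qed
  finally show ?thesis by (simp add: mult_2)
qed

text \<open>The inverse takes \<open>e\<close> to the larger root of \<open>v\<^sup>2 - e * v + m\<close>.\<close>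

lemma bij_betw_add_reciprocal:
  assumes m: "(m::real) > 0"
  shows "bij_betw (\<lambda>v. v + m / v) {sqrt m<..} {2 * sqrt m<..}"
proof -
  have s: "sqrt m > 0" "sqrt m * sqrt m = m" using m by auto
  have big: "v > 0" "m < v * v" if "v > sqrt m" for v
    using order_less_trans[OF s(1) that] mult_strict_mono[OF that that] s by auto
  show ?thesis
  proof (rule bij_betwI[where g = "\<lambda>e. (e + sqrt (e\<^sup>2 - 4 * m)) / 2"])
    show "(\<lambda>v. v + m / v) \<in> {sqrt m<..} \<rightarrow> {2 * sqrt m<..}"
    proof
      fix v assume v: "v \<in> {sqrt m<..}"
      have "v + m / v - 2 * sqrt m = (v - sqrt m)\<^sup>2 / v"
        using big[of v] v s(2) by (simp add: divide_simps) (simp add: algebra_simps power2_eq_square)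
      also have "\<dots> > 0" using big[of v] v by simp
      finally show "v + m / v \<in> {2 * sqrt m<..}" by simp
    qed
    have dpos: "e\<^sup>2 - 4 * m > 0" if "e > 2 * sqrt m" for e
      using power_strict_mono[OF that, of 2] s m by (simp add: power_mult_distrib)
    show "(\<lambda>e. (e + sqrt (e\<^sup>2 - 4 * m)) / 2) \<in> {2 * sqrt m<..} \<rightarrow> {sqrt m<..}"
    proof
      fix e assume e: "e \<in> {2 * sqrt m<..}"
      define r where "r = sqrt (e\<^sup>2 - 4 * m)"
        have "0 \<le> r" using dpos[of e] e by (simp add: r_def)
        with e have "(e + r) / 2 \<in> {sqrt m<..}" by simp
        then show "(e + sqrt (e\<^sup>2 - 4 * m)) / 2 \<in> {sqrt m<..}" by (simp add: r_def)
    qed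
    show "(v + m / v + sqrt ((v + m / v)\<^sup>2 - 4 * m)) / 2 = v" if "v \<in> {sqrt m<..}" for v
    proof -
      have "(v + m / v)\<^sup>2 - 4 * m = (v - m / v)\<^sup>2"
        using big[of v] that by (simp add: field_simps power2_eq_square)
      moreover have "v - m / v \<ge> 0" using big[of v] that by (simp add: field_simps)
      ultimately show ?thesis by simp
    qed
    show "(e + sqrt (e\<^sup>2 - 4 * m)) / 2 + m / ((e + sqrt (e\<^sup>2 - 4 * m)) / 2) = e" if "e \<in> {2 * sqrt m<..}" for e
    proof -
      define r where "r = sqrt (e\<^sup>2 - 4 * m)"
      have r: "r \<ge> 0" "r\<^sup>2 = e\<^sup>2 - 4 * m" using dpos[of e] that by (auto simp: r_def)
      have "e > 0" using order_less_trans[of 0 "2 * sqrt m" e] that m by simp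
      then have "e + r > 0" using r by auto
      then have "(e + r) / 2 + m / ((e + r) / 2) = ((e + r)\<^sup>2 + 4 * m) / (2 * (e + r))"
        by (simp add: field_simps power2_eq_square)
      also have "\<dots> = (2 * e * (e + r)) / (2 * (e + r))"
        using r(2) by (simp add: power2_eq_square algebra_simps)
      also have "\<dots> = e" using \<open>e + r > 0\<close> by (simp add: field_simps)
      finally show ?thesis by (simp add: r_def)
    qed
  qed
qed

text \<open>With \<open>m = E / F\<close> the form under the integral is invariant under \<open>v \<mapsto> m / v\<close>, so the integral is twice
the one over \<open>v > sqrt m\<close>, where \<open>e = v + m / v\<close> is a coordinate. The relations used are
\<open>(1 + v) * (v + m) = v * (1 + e + m)\<close> and \<open>(v - m / v)\<^sup>2 = e\<^sup>2 - 4 * m\<close>.\<close>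

lemma legendre_eq_landen:
  assumes E: "E > 0" and F: "F > 0"
  shows "legendre E F = ennreal (2 / sqrt F) * landen (E / F)"
proof -
  define m where "m = E / F"
  have m: "m > 0" and EF: "E = F * m" using assms by (auto simp: m_def)
  have s: "sqrt m > 0" "sqrt m * sqrt m = m" using m by auto
  define f where "f = (\<lambda>v. 1 / sqrt (v * (1 + v) * (E + F * v)))"
  have "legendre E F = (\<integral>\<^sup>+v\<in>{0<..}. ennreal (f v) \<partial>lborel)"
    by (simp add: legendre_def f_def)
  also have "\<dots> = 2 * (\<integral>\<^sup>+v\<in>{sqrt m<..}. ennreal (f v) \<partial>lborel)"
  proof (rule nn_integral_fold_reciprocal[OF m])
    fix v :: real assume v: "v > 0"
    have "m / v * (1 + m / v) * (E + F * (m / v)) = (m / v\<^sup>2)\<^sup>2 * (v * (1 + v) * (E + F * v))"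
      using v unfolding EF by (simp add: divide_simps) (simp add: algebra_simps power2_eq_square power4_eq_xxxx)
    then have "sqrt (m / v * (1 + m / v) * (E + F * (m / v))) = m / v\<^sup>2 * sqrt (v * (1 + v) * (E + F * v))"
      using m by (simp add: real_sqrt_mult)
    then have "m / v\<^sup>2 * f (m / v) = f v"
      unfolding f_def using m v by simp
    moreover have "f (m / v) \<ge> 0" using v m assms by (simp add: f_def)
    ultimately show "ennreal (m / v\<^sup>2) * ennreal (f (m / v)) = ennreal (f v)"
      using m by (simp add: ennreal_mult[symmetric])
  qed (simp add: f_def)
  also have "(\<integral>\<^sup>+v\<in>{sqrt m<..}. ennreal (f v) \<partial>lborel) = ennreal (1 / sqrt F) * landen m"
  proof -
    have big: "v > 0" "m < v * v" if "v > sqrt m" for v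
      using order_less_trans[OF s(1) that] mult_strict_mono[OF that that] s by auto
    note bij = bij_betw_add_reciprocal[OF m]
    have "landen m = (\<integral>\<^sup>+v\<in>{sqrt m<..}. ennreal \<bar>1 - m / v\<^sup>2\<bar> *
        ennreal (1 / sqrt (((v + m / v)\<^sup>2 - 4 * m) * (1 + (v + m / v) + m))) \<partial>lborel)"
      unfolding landen_def
      by (rule nn_integral_change_of_variables[OF bij])
         (auto intro!: derivative_eq_intros dest: order_less_trans[OF s(1)] simp: power2_eq_square)
    also have "\<dots> = (\<integral>\<^sup>+v\<in>{sqrt m<..}. ennreal (sqrt F) * ennreal (f v) \<partial>lborel)"
    proof (intro nn_integral_cong)
      fix v
      have "\<bar>1 - m / v\<^sup>2\<bar> * (1 / sqrt (((v + m / v)\<^sup>2 - 4 * m) * (1 + (v + m / v) + m))) = sqrt F * f v"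
        if v: "v > sqrt m"
      proof -
        note b = big[OF v]
        have 1: "((v + m / v)\<^sup>2 - 4 * m) * (1 + (v + m / v) + m)
            = ((1 - m / v\<^sup>2))\<^sup>2 * (v * (1 + v) * (v + m))"
          using b by (simp add: divide_simps) (simp add: algebra_simps power2_eq_square power4_eq_xxxx)
        have 2: "v * (1 + v) * (E + F * v) = F * (v * (1 + v) * (v + m))"
          by (simp add: EF algebra_simps)
        have 3: "1 - m / v\<^sup>2 > 0" using b by (simp add: power2_eq_square)
        show ?thesis unfolding f_def 1 2 using 3 F b by (simp add: real_sqrt_mult)
      qed
      moreover have "f v \<ge> 0" if "v > sqrt m" using big[OF that] assms by (simp add: f_def)
      ultimately show "ennreal \<bar>1 - m / v\<^sup>2\<bar> *
        ennreal (1 / sqrt (((v + m / v)\<^sup>2 - 4 * m) * (1 + (v + m / v) + m))) * indicator {sqrt m<..} v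
        = ennreal (sqrt F) * ennreal (f v) * indicator {sqrt m<..} v"
        using F by (auto simp: indicator_def ennreal_mult'[symmetric])
    qed
    also have "\<dots> = ennreal (sqrt F) * (\<integral>\<^sup>+v\<in>{sqrt m<..}. ennreal (f v) \<partial>lborel)"
      by (rule set_nn_integral_cmult) (auto simp: f_def)
    finally show ?thesis
      using F by (simp add: mult.assoc[symmetric] ennreal_mult[symmetric])
  qed
  finally show ?thesis
    using F by (simp add: m_def mult.assoc[symmetric] ennreal_mult'[symmetric] flip: ennreal_numeral)
qed

section \<open>The double integral and its two families of elliptic integrals\<close>

definition borchardt_integral :: "real \<Rightarrow> real \<Rightarrow> real \<Rightarrow> real \<Rightarrow> ennreal" where
  "borchardt_integral c1 c2 c3 c4 = (\<integral>\<^sup>+x\<in>{0<..}. (\<integral>\<^sup>+y\<in>{0<..}.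
     ennreal (1 / sqrt (x * y * (c2 + c3 * x + c1 * y + c4 * x * y) * (c4 + c1 * x + c3 * y + c2 * x * y)))
     \<partial>lborel) \<partial>lborel)"

lemma nn_integral_fibre:
  assumes "A > 0" "B > 0" "C > 0" "D > 0" "x > 0"
  shows "(\<integral>\<^sup>+y\<in>{0<..}. ennreal (1 / sqrt (x * y * (A + B * y) * (C + D * y))) \<partial>lborel)
       = ennreal (1 / sqrt x) * legendre (B * C) (A * D)"
proof -
  have "(\<integral>\<^sup>+y\<in>{0<..}. ennreal (1 / sqrt (x * y * (A + B * y) * (C + D * y))) \<partial>lborel)
      = (\<integral>\<^sup>+y\<in>{0<..}. ennreal (1 / sqrt x) * ennreal (1 / sqrt (y * (A + B * y) * (C + D * y))) \<partial>lborel)"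
    by (intro nn_integral_cong)
       (use assms in \<open>simp add: ennreal_mult'[symmetric] real_sqrt_mult mult_ac\<close>)
  also have "\<dots> = ennreal (1 / sqrt x) * legendre (B * C) (A * D)"
    using assms by (subst set_nn_integral_cmult) (auto simp: legendre_cubic)
  finally show ?thesis .
qed

text \<open>For fixed \<open>x\<close> both bilinear factors are affine in \<open>y\<close>, so \<open>legendre_cubic\<close> applies to the fibre.\<close>

lemma borchardt_integral_y_fibre:
  assumes "c1 > 0" "c2 > 0" "c3 > 0" "c4 > 0"
  shows "borchardt_integral c1 c2 c3 c4 = (\<integral>\<^sup>+x\<in>{0<..}. ennreal (1 / sqrt x) *
     legendre ((c1 + c4 * x) * (c4 + c1 * x)) ((c2 + c3 * x) * (c3 + c2 * x)) \<partial>lborel)"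
  unfolding borchardt_integral_def
proof (rule set_nn_integral_cong[OF refl refl])
  fix x :: real assume "x \<in> space lborel \<inter> {0<..}"
  then have x: "x > 0" by simp
  show "(\<integral>\<^sup>+y\<in>{0<..}. ennreal (1 / sqrt (x * y * (c2 + c3 * x + c1 * y + c4 * x * y) * (c4 + c1 * x + c3 * y + c2 * x * y))) \<partial>lborel)
     = ennreal (1 / sqrt x) * legendre ((c1 + c4 * x) * (c4 + c1 * x)) ((c2 + c3 * x) * (c3 + c2 * x))"
  proof -
    have "c2 + c3 * x + c1 * y + c4 * x * y = (c2 + c3 * x) + (c1 + c4 * x) * y"
      "c4 + c1 * x + c3 * y + c2 * x * y = (c4 + c1 * x) + (c3 + c2 * x) * y" for y
      by (auto simp: algebra_simps)
    then show ?thesis using assms x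
      by (simp only:) (rule nn_integral_fibre; simp add: add_pos_pos)
  qed
qed

lemma set_nn_integral_swap:
  fixes f :: "real \<Rightarrow> real \<Rightarrow> ennreal"
  assumes [measurable]: "(\<lambda>(x, y). f x y) \<in> borel_measurable (borel \<Otimes>\<^sub>M borel)" "A \<in> sets borel" "B \<in> sets borel"
  shows "(\<integral>\<^sup>+x\<in>A. (\<integral>\<^sup>+y\<in>B. f x y \<partial>lborel) \<partial>lborel) = (\<integral>\<^sup>+y\<in>B. (\<integral>\<^sup>+x\<in>A. f x y \<partial>lborel) \<partial>lborel)"
proof -
  have [measurable]: "(\<lambda>x. f x y) \<in> borel_measurable borel" "f x \<in> borel_measurable borel" for x y
    using measurable_Pair1'[of x borel borel, THEN measurable_compose, OF _ assms(1)]
      measurable_Pair2'[of y borel borel, THEN measurable_compose, OF _ assms(1)]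
    by auto
  have "(\<integral>\<^sup>+x\<in>A. (\<integral>\<^sup>+y\<in>B. f x y \<partial>lborel) \<partial>lborel)
      = (\<integral>\<^sup>+x. (\<integral>\<^sup>+y. f x y * indicator A x * indicator B y \<partial>lborel) \<partial>lborel)"
    by (subst nn_integral_multc[symmetric]) (auto simp: mult_ac)
  also have "\<dots> = (\<integral>\<^sup>+y. (\<integral>\<^sup>+x. f x y * indicator A x * indicator B y \<partial>lborel) \<partial>lborel)"
    by (rule lborel_pair.Fubini'[symmetric]) measurable
  also have "\<dots> = (\<integral>\<^sup>+y\<in>B. (\<integral>\<^sup>+x\<in>A. f x y \<partial>lborel) \<partial>lborel)"
    by (subst nn_integral_multc[symmetric]) (auto simp: mult_ac)
  finally show ?thesis .
qed

text \<open>Exchanging \<open>x\<close> and \<open>y\<close> has the same effect as exchanging \<open>c1\<close> and \<open>c3\<close>.\<close>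

lemma borchardt_integral_x_fibre:
  assumes "c1 > 0" "c2 > 0" "c3 > 0" "c4 > 0"
  shows "borchardt_integral c1 c2 c3 c4 = (\<integral>\<^sup>+y\<in>{0<..}. ennreal (1 / sqrt y) *
     legendre ((c3 + c4 * y) * (c4 + c3 * y)) ((c2 + c1 * y) * (c1 + c2 * y)) \<partial>lborel)"
proof -
  have "borchardt_integral c1 c2 c3 c4 = (\<integral>\<^sup>+y\<in>{0<..}. (\<integral>\<^sup>+x\<in>{0<..}.
     ennreal (1 / sqrt (x * y * (c2 + c3 * x + c1 * y + c4 * x * y) * (c4 + c1 * x + c3 * y + c2 * x * y)))
     \<partial>lborel) \<partial>lborel)"
    unfolding borchardt_integral_def by (rule set_nn_integral_swap) measurable
  also have "\<dots> = borchardt_integral c3 c2 c1 c4"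
    unfolding borchardt_integral_def by (simp add: algebra_simps)
  also have "\<dots> = (\<integral>\<^sup>+y\<in>{0<..}. ennreal (1 / sqrt y) *
     legendre ((c3 + c4 * y) * (c4 + c3 * y)) ((c2 + c1 * y) * (c1 + c2 * y)) \<partial>lborel)"
    by (intro borchardt_integral_y_fibre assms)
  finally show ?thesis .
qed

text \<open>This symmetry is not visible in the integrand; it appears after \<open>x\<close> has been integrated out, since
\<open>c3\<close> and \<open>c4\<close> then enter only through \<open>(c3 + c4 * y) * (c4 + c3 * y)\<close>.\<close>

lemma borchardt_integral_swap_34:
  assumes "c1 > 0" "c2 > 0" "c3 > 0" "c4 > 0"
  shows "borchardt_integral c1 c2 c4 c3 = borchardt_integral c1 c2 c3 c4"
  using assms by (simp add: borchardt_integral_x_fibre mult.commute)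

text \<open>The map decreases from its value at \<open>t0\<close> towards its limit \<open>a / b\<close> at infinity.\<close>

lemma bij_betw_mobius:
  fixes a b g h t0 :: real
  assumes "a > 0" "b > 0" "g > 0" "h > 0" "t0 \<ge> 0" and det: "b * g > a * h"
  shows "bij_betw (\<lambda>t. (a * t + g) / (b * t + h)) {t0<..} {a / b<..<(a * t0 + g) / (b * t0 + h)}"
proof (rule bij_betwI[where g = "\<lambda>m. (g - h * m) / (b * m - a)"])
  have pos: "b * t + h > 0" if "t \<ge> t0" for t
    using that assms by (intro add_nonneg_pos mult_nonneg_nonneg) auto
  show "(\<lambda>t. (a * t + g) / (b * t + h)) \<in> {t0<..} \<rightarrow> {a / b<..<(a * t0 + g) / (b * t0 + h)}"
  proof
    fix t assume t: "t \<in> {t0<..}"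
    have 1: "(a * t + g) / (b * t + h) - a / b = (b * g - a * h) / (b * (b * t + h))"
      using pos[of t] t assms by (simp add: divide_simps) (simp add: algebra_simps)
    have 2: "(a * t0 + g) / (b * t0 + h) - (a * t + g) / (b * t + h)
       = (b * g - a * h) * (t - t0) / ((b * t0 + h) * (b * t + h))"
      using pos[of t] pos[of t0] t by (simp add: divide_simps) (simp add: algebra_simps)
    have "(b * g - a * h) / (b * (b * t + h)) > 0"
      "(b * g - a * h) * (t - t0) / ((b * t0 + h) * (b * t + h)) > 0"
      using pos[of t] pos[of t0] t assms by auto
    then show "(a * t + g) / (b * t + h) \<in> {a / b<..<(a * t0 + g) / (b * t0 + h)}"
      unfolding 1[symmetric] 2[symmetric] by simp
  qed
  show "(\<lambda>m. (g - h * m) / (b * m - a)) \<in> {a / b<..<(a * t0 + g) / (b * t0 + h)} \<rightarrow> {t0<..}"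
  proof
    fix m assume m: "m \<in> {a / b<..<(a * t0 + g) / (b * t0 + h)}"
    have 1: "b * m - a > 0" using m assms by (simp add: field_simps)
    have "m * (b * t0 + h) < a * t0 + g" using m pos[of t0] by (simp add: field_simps)
    then show "(g - h * m) / (b * m - a) \<in> {t0<..}" using 1 by (simp add: field_simps)
  qed
  show "(g - h * ((a * t + g) / (b * t + h))) / (b * ((a * t + g) / (b * t + h)) - a) = t" if "t \<in> {t0<..}" for t
  proof -
    have p: "b * t + h > 0" using pos[of t] that by auto
    have 1: "g - h * ((a * t + g) / (b * t + h)) = (b * g - a * h) * t / (b * t + h)"
      "b * ((a * t + g) / (b * t + h)) - a = (b * g - a * h) / (b * t + h)"
      using p by (simp_all add: divide_simps) (simp_all add: algebra_simps)
    show ?thesis unfolding 1 using p det by simp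
  qed
  show "(a * ((g - h * m) / (b * m - a)) + g) / (b * ((g - h * m) / (b * m - a)) + h) = m"
    if "m \<in> {a / b<..<(a * t0 + g) / (b * t0 + h)}" for m
  proof -
    have p: "b * m - a > 0" using that assms by (simp add: field_simps)
    have 1: "a * ((g - h * m) / (b * m - a)) + g = (b * g - a * h) * m / (b * m - a)"
      "b * ((g - h * m) / (b * m - a)) + h = (b * g - a * h) / (b * m - a)"
      using p by (simp_all add: divide_simps) (simp_all add: algebra_simps)
    show ?thesis unfolding 1 using p det by simp
  qed
qed

lemma ennreal_collect:
  "p \<ge> 0 \<Longrightarrow> a \<ge> 0 \<Longrightarrow> b \<ge> 0 \<Longrightarrow> ennreal p * (ennreal a * (ennreal b * L)) = ennreal (p * a * b) * L"
  by (simp add: ennreal_mult mult_ac)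

text \<open>Replacing \<open>x\<close> by \<open>1 / x\<close> divides both arguments by \<open>x\<^sup>2\<close>, and \<open>legendre\<close> is homogeneous of degree
\<open>- 1 / 2\<close>.\<close>

lemma nn_integral_legendre_fold:
  assumes "c1 > 0" "c2 > 0" "c3 > 0" "c4 > 0"
  shows "(\<integral>\<^sup>+x\<in>{0<..}. ennreal (1 / sqrt x) *
           legendre ((c1 + c4 * x) * (c4 + c1 * x)) ((c2 + c3 * x) * (c3 + c2 * x)) \<partial>lborel)
       = 2 * (\<integral>\<^sup>+x\<in>{1<..}. ennreal (1 / sqrt x) *
           legendre ((c1 + c4 * x) * (c4 + c1 * x)) ((c2 + c3 * x) * (c3 + c2 * x)) \<partial>lborel)"
proof -
  let ?f = "\<lambda>x. ennreal (1 / sqrt x) * legendre ((c1 + c4 * x) * (c4 + c1 * x)) ((c2 + c3 * x) * (c3 + c2 * x))"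
  have "(\<integral>\<^sup>+x\<in>{0<..}. ?f x \<partial>lborel) = 2 * (\<integral>\<^sup>+x\<in>{sqrt 1<..}. ?f x \<partial>lborel)"
  proof (rule nn_integral_fold_reciprocal)
    fix v :: real assume v: "v > 0"
    have 1: "(c1 + c4 * (1 / v)) * (c4 + c1 * (1 / v)) = (1 / v)\<^sup>2 * ((c1 + c4 * v) * (c4 + c1 * v))"
      "(c2 + c3 * (1 / v)) * (c3 + c2 * (1 / v)) = (1 / v)\<^sup>2 * ((c2 + c3 * v) * (c3 + c2 * v))"
      using v by (simp_all add: divide_simps) (simp_all add: algebra_simps power2_eq_square)
    have 2: "1 / v\<^sup>2 * (1 / sqrt (1 / v)) * (1 / (1 / v)) = 1 / sqrt v"
      using v by (simp add: real_sqrt_divide field_simps power2_eq_square)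
    have "ennreal (1 / v\<^sup>2) * ?f (1 / v) = ennreal (1 / v\<^sup>2 * (1 / sqrt (1 / v)) * (1 / (1 / v))) *
        legendre ((c1 + c4 * v) * (c4 + c1 * v)) ((c2 + c3 * v) * (c3 + c2 * v))"
      unfolding 1 using v by (subst legendre_scale, simp, intro ennreal_collect) simp_all
    then show "ennreal (1 / v\<^sup>2) * ?f (1 / v) = ?f v" unfolding 2 .
  qed auto
  then show ?thesis by simp
qed

text \<open>By homogeneity the fibre over \<open>x\<close> depends, up to a scalar, only on the quotient \<open>m\<close> of the two
arguments, a Moebius function of \<open>x + 1 / x\<close>. The numbers \<open>a1\<^sup>2\<close>, \<open>a2\<^sup>2\<close>, \<open>a3\<^sup>2\<close> are the values of
\<open>m\<close> at \<open>x = 1\<close>, \<open>x = \<infinity>\<close> and \<open>x = - 1\<close>, the branch points of the quotient by \<open>x \<mapsto> 1 / x\<close> and by the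
square root of \<open>x\<close>; they become the roots of the cubic in the weight.\<close>

lemma borchardt_integral_eq_landen:
  assumes c: "c1 > c2" "c2 > c3" "c3 > c4" "c4 > 0"
  defines "a1 \<equiv> (c1 + c4) / (c2 + c3)" and "a2 \<equiv> sqrt (c1 * c4 / (c2 * c3))"
    and "a3 \<equiv> (c1 - c4) / (c2 - c3)" and "k \<equiv> (c1 * c2 - c3 * c4) * (c1 * c3 - c2 * c4)"
  shows "borchardt_integral c1 c2 c3 c4
    = ennreal (4 * sqrt k / (sqrt (c2 * c3) * (c2 + c3) * (c2 - c3))) *
      (\<integral>\<^sup>+m\<in>{a2\<^sup>2<..<a1\<^sup>2}. ennreal (1 / sqrt ((m - a2\<^sup>2) * (a1\<^sup>2 - m) * (a3\<^sup>2 - m))) * landen m \<partial>lborel)"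
proof -
  have pos: "c1 > 0" "c2 > 0" "c3 > 0" using c by auto
  have k1: "c1 * c2 - c3 * c4 > 0" "c1 * c3 - c2 * c4 > 0"
    using c mult_strict_mono[of c3 c1 c4 c2] mult_strict_mono[of c2 c1 c4 c3] by auto
  then have k: "k > 0" by (simp add: k_def)
  define e where "e = (\<lambda>x. (c1 + c4 * x) * (c4 + c1 * x))"
  define f where "f = (\<lambda>x. (c2 + c3 * x) * (c3 + c2 * x))"
  have ef: "e x > 0" "f x > 0" if "x > 0" for x
    using that pos c by (auto simp: e_def f_def intro!: mult_pos_pos add_pos_pos)
  define C where "C = 4 * sqrt k / (sqrt (c2 * c3) * (c2 + c3) * (c2 - c3))"
  have C: "C > 0" using k pos c by (simp add: C_def)
  define W where "W = (\<lambda>m. 1 / sqrt ((m - a2\<^sup>2) * (a1\<^sup>2 - m) * (a3\<^sup>2 - m)))"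
  define g where "g = (\<lambda>x. e x / f x)"
  define g' where "g' = (\<lambda>x. - k * (x\<^sup>2 - 1) / (f x)\<^sup>2)"
  have a2: "a2\<^sup>2 = c1 * c4 / (c2 * c3)" using pos c by (simp add: a2_def)
  have "borchardt_integral c1 c2 c3 c4 = 2 * (\<integral>\<^sup>+x\<in>{1<..}. ennreal (1 / sqrt x) * legendre (e x) (f x) \<partial>lborel)"
    using pos c by (simp add: borchardt_integral_y_fibre nn_integral_legendre_fold e_def f_def)
  also have "\<dots> = (\<integral>\<^sup>+x\<in>{1<..}. 2 * (ennreal (1 / sqrt x) * legendre (e x) (f x)) \<partial>lborel)"
    by (rule set_nn_integral_cmult[symmetric]) (auto simp: e_def f_def)
  also have "\<dots> = (\<integral>\<^sup>+x\<in>{1<..}. ennreal \<bar>g' x\<bar> * (ennreal (C * W (g x)) * landen (g x)) \<partial>lborel)"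
  proof (rule set_nn_integral_cong[OF refl refl])
    fix x :: real assume "x \<in> space lborel \<inter> {1<..}"
    then have x: "x > 1" by simp
    show "2 * (ennreal (1 / sqrt x) * legendre (e x) (f x))
        = ennreal \<bar>g' x\<bar> * (ennreal (C * W (g x)) * landen (g x))"
    proof -
      have F: "f x > 0" "x\<^sup>2 - 1 > 0" using ef[of x] x by (auto simp: one_less_power)
      \<comment> \<open>The three differences below are constant multiples of \<open>x\<close>, \<open>(x - 1)\<^sup>2\<close> and \<open>(x + 1)\<^sup>2\<close>, divided by \<open>f x\<close>.\<close>
      have kk: "k = c2 * c3 * (c1\<^sup>2 + c4\<^sup>2) - c1 * c4 * (c2\<^sup>2 + c3\<^sup>2)"
        by (simp add: k_def algebra_simps power2_eq_square)
      have 1: "g x - a2\<^sup>2 = x * k / (c2 * c3 * f x)"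
      proof -
        have "c2 * c3 * e x - c1 * c4 * f x = x * k"
          unfolding e_def f_def kk by (simp add: algebra_simps power2_eq_square)
        moreover have "g x - a2\<^sup>2 = (c2 * c3 * e x - c1 * c4 * f x) / (c2 * c3 * f x)"
          unfolding g_def a2 using F pos by (simp add: divide_simps)
        ultimately show ?thesis by simp
      qed
      have 2: "a1\<^sup>2 - g x = (x - 1)\<^sup>2 * k / ((c2 + c3)\<^sup>2 * f x)"
      proof -
        have "(c1 + c4)\<^sup>2 * f x - (c2 + c3)\<^sup>2 * e x = (x - 1)\<^sup>2 * k"
          unfolding e_def f_def kk by (simp add: algebra_simps power2_eq_square)
        moreover have "a1\<^sup>2 - g x = ((c1 + c4)\<^sup>2 * f x - (c2 + c3)\<^sup>2 * e x) / ((c2 + c3)\<^sup>2 * f x)"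
          unfolding g_def a1_def power_divide using F pos by (simp add: divide_simps)
        ultimately show ?thesis by simp
      qed
      have 3: "a3\<^sup>2 - g x = (x + 1)\<^sup>2 * k / ((c2 - c3)\<^sup>2 * f x)"
      proof -
        have "(c1 - c4)\<^sup>2 * f x - (c2 - c3)\<^sup>2 * e x = (x + 1)\<^sup>2 * k"
          unfolding e_def f_def kk by (simp add: algebra_simps power2_eq_square)
        moreover have "a3\<^sup>2 - g x = ((c1 - c4)\<^sup>2 * f x - (c2 - c3)\<^sup>2 * e x) / ((c2 - c3)\<^sup>2 * f x)"
          unfolding g_def a3_def power_divide using F pos c by (simp add: divide_simps)
        ultimately show ?thesis by simp
      qed
      have 4: "(g x - a2\<^sup>2) * (a1\<^sup>2 - g x) * (a3\<^sup>2 - g x)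
          = (k * (x\<^sup>2 - 1) / (sqrt (c2 * c3) * (c2 + c3) * (c2 - c3) * (f x)\<^sup>2))\<^sup>2 * (k * (x * f x))"
      proof -
        have "(g x - a2\<^sup>2) * (a1\<^sup>2 - g x) * (a3\<^sup>2 - g x)
            = ((x - 1)\<^sup>2 * (x + 1)\<^sup>2) * (x * k ^ 3 / (c2 * c3 * (c2 + c3)\<^sup>2 * (c2 - c3)\<^sup>2 * f x ^ 3))"
          unfolding 1 2 3 by (simp add: power3_eq_cube mult_ac)
        also have "(x - 1)\<^sup>2 * (x + 1)\<^sup>2 = (x\<^sup>2 - 1)\<^sup>2" by (simp add: algebra_simps power2_eq_square)
        also have "(x\<^sup>2 - 1)\<^sup>2 * (x * k ^ 3 / (c2 * c3 * (c2 + c3)\<^sup>2 * (c2 - c3)\<^sup>2 * f x ^ 3))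
            = (k * (x\<^sup>2 - 1) / (sqrt (c2 * c3) * (c2 + c3) * (c2 - c3) * (f x)\<^sup>2))\<^sup>2 * (k * (x * f x))"
          unfolding power_divide power_mult_distrib using F pos
          by (simp add: power3_eq_cube power4_eq_xxxx power2_eq_square mult_ac)
        finally show ?thesis .
      qed
      have 5: "W (g x) = sqrt (c2 * c3) * (c2 + c3) * (c2 - c3) * (f x)\<^sup>2 / (k * (x\<^sup>2 - 1) * (sqrt k * sqrt (x * f x)))"
        unfolding W_def 4 using F pos c k
        by (subst sqrt_power2_mult) (auto simp: real_sqrt_mult)
      have 6: "\<bar>g' x\<bar> = k * (x\<^sup>2 - 1) / (f x)\<^sup>2"
        unfolding g'_def using F k by (simp add: abs_mult)
      have 7: "\<bar>g' x\<bar> * (C * W (g x)) = 4 / sqrt (x * f x)"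
      proof -
        have gen: "p / q * (4 * r / g * (g * q / (p * (r * t)))) = 4 / t"
          if "p \<noteq> 0" "q \<noteq> 0" "r \<noteq> 0" "g \<noteq> 0" for p q r g t :: real
          using that by simp
        show ?thesis unfolding 5 6 C_def by (rule gen) (use F pos c k in auto)
      qed
      have "2 * (ennreal (1 / sqrt x) * legendre (e x) (f x))
         = ennreal (2 * (1 / sqrt x) * (2 / sqrt (f x))) * landen (g x)"
        using ef[of x] x by (subst ennreal_collect[symmetric]) (simp_all add: g_def legendre_eq_landen)
      also have "2 * (1 / sqrt x) * (2 / sqrt (f x)) = \<bar>g' x\<bar> * (C * W (g x))"
        unfolding 7 by (simp add: real_sqrt_mult)
      finally show ?thesis by (simp only: ennreal_mult'[OF abs_ge_zero] mult.assoc)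
    qed
  qed
  also have "\<dots> = (\<integral>\<^sup>+m\<in>{a2\<^sup>2<..<a1\<^sup>2}. ennreal (C * W m) * landen m \<partial>lborel)"
  proof (rule nn_integral_change_of_variables[symmetric])
    have "bij_betw (\<lambda>t. (c1 * c4 * t + (c1\<^sup>2 + c4\<^sup>2)) / (c2 * c3 * t + (c2\<^sup>2 + c3\<^sup>2))) {2<..}
      {c1 * c4 / (c2 * c3)<..<(c1 * c4 * 2 + (c1\<^sup>2 + c4\<^sup>2)) / (c2 * c3 * 2 + (c2\<^sup>2 + c3\<^sup>2))}"
    proof (rule bij_betw_mobius)
      have "c2 * c3 * (c1\<^sup>2 + c4\<^sup>2) - c1 * c4 * (c2\<^sup>2 + c3\<^sup>2) = k"
        by (simp add: k_def algebra_simps power2_eq_square)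
      then show "c2 * c3 * (c1\<^sup>2 + c4\<^sup>2) > c1 * c4 * (c2\<^sup>2 + c3\<^sup>2)" using k by simp
    qed (use pos c in \<open>auto intro!: add_pos_pos\<close>)
    moreover have "(c1 * c4 * 2 + (c1\<^sup>2 + c4\<^sup>2)) / (c2 * c3 * 2 + (c2\<^sup>2 + c3\<^sup>2)) = a1\<^sup>2"
      by (simp add: a1_def power_divide power2_sum algebra_simps)
    ultimately have "bij_betw ((\<lambda>t. (c1 * c4 * t + (c1\<^sup>2 + c4\<^sup>2)) / (c2 * c3 * t + (c2\<^sup>2 + c3\<^sup>2))) \<circ> (\<lambda>x. x + 1 / x))
        {1<..} {a2\<^sup>2<..<a1\<^sup>2}"
      using bij_betw_add_reciprocal[of 1] by (intro bij_betw_trans[of _ _ "{2<..}"]) (auto simp: a2)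
    then show "bij_betw g {1<..} {a2\<^sup>2<..<a1\<^sup>2}"
    proof (rule bij_betw_cong[THEN iffD1, rotated])
      fix x :: real assume "x \<in> {1<..}"
      then have x: "x > 0" by auto
      have "e x = x * (c1 * c4 * (x + 1 / x) + (c1\<^sup>2 + c4\<^sup>2))" "f x = x * (c2 * c3 * (x + 1 / x) + (c2\<^sup>2 + c3\<^sup>2))"
        using x by (simp_all add: e_def f_def field_simps power2_eq_square)
      then show "((\<lambda>t. (c1 * c4 * t + (c1\<^sup>2 + c4\<^sup>2)) / (c2 * c3 * t + (c2\<^sup>2 + c3\<^sup>2))) \<circ> (\<lambda>x. x + 1 / x)) x = g x"
        using x by (simp add: g_def)
    qed
    fix x :: real assume "x \<in> {1<..}"
    then have x: "f x > 0" using ef[of x] by auto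
    have "(g has_real_derivative ((c4 * (c4 + c1 * x) + (c1 + c4 * x) * c1) * f x
        - e x * (c3 * (c3 + c2 * x) + (c2 + c3 * x) * c2)) / (f x * f x)) (at x)"
      unfolding g_def using x unfolding e_def f_def
      by (auto intro!: derivative_eq_intros simp: algebra_simps)
    also have "(c4 * (c4 + c1 * x) + (c1 + c4 * x) * c1) * f x
        - e x * (c3 * (c3 + c2 * x) + (c2 + c3 * x) * c2) = - k * (x\<^sup>2 - 1)"
      by (simp add: e_def f_def k_def algebra_simps power2_eq_square)
    finally show "(g has_real_derivative g' x) (at x)"
      by (simp add: g'_def power2_eq_square)
  qed (auto simp: g_def g'_def e_def f_def W_def)
  also have "\<dots> = (\<integral>\<^sup>+m\<in>{a2\<^sup>2<..<a1\<^sup>2}. ennreal C * (ennreal (W m) * landen m) \<partial>lborel)"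
    using C by (intro nn_integral_cong) (simp add: ennreal_mult' mult_ac)
  also have "\<dots> = ennreal C * (\<integral>\<^sup>+m\<in>{a2\<^sup>2<..<a1\<^sup>2}. ennreal (W m) * landen m \<partial>lborel)"
    by (rule set_nn_integral_cmult) (auto simp: W_def)
  finally show ?thesis unfolding C_def W_def .
qed

section \<open>A pencil of conics\<close>

lemma bij_betw_DERIV_pos:
  fixes g g' :: "real \<Rightarrow> real"
  assumes "a < b" and der: "\<And>x. a \<le> x \<Longrightarrow> x \<le> b \<Longrightarrow> (g has_real_derivative g' x) (at x)"
    and pos: "\<And>x. a \<le> x \<Longrightarrow> x \<le> b \<Longrightarrow> g' x > 0"
  shows "bij_betw g {a<..<b} {g a<..<g b}"
proof -
  have mono: "g x < g y" if "a \<le> x" "x < y" "y \<le> b" for x y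
  proof (rule DERIV_pos_imp_increasing[OF \<open>x < y\<close>])
    fix z assume "x \<le> z" "z \<le> y"
    with that have "a \<le> z" "z \<le> b" by auto
    from der[OF this] pos[OF this] show "\<exists>d. (g has_real_derivative d) (at z) \<and> 0 < d" by blast
  qed
  have cont: "continuous_on {a..b} g"
    using der by (intro continuous_at_imp_continuous_on) (meson DERIV_isCont atLeastAtMost_iff)
  have "inj_on g {a<..<b}"
  proof (rule inj_onI)
    fix x y assume xy: "x \<in> {a<..<b}" "y \<in> {a<..<b}" and eq: "g x = g y"
    show "x = y"
    proof (rule ccontr)
      assume "x \<noteq> y"
      then show False using mono[of x y] mono[of y x] xy eq by (cases x y rule: linorder_cases) auto
    qed
  qed
  moreover have "g ` {a<..<b} = {g a<..<g b}"
  proof (intro equalityI subsetI)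
    fix y assume "y \<in> {g a<..<g b}"
    then obtain x where x: "a \<le> x" "x \<le> b" "g x = y"
      using IVT'[of g a y b] cont \<open>a < b\<close> by auto
    with \<open>y \<in> _\<close> have "x \<noteq> a" "x \<noteq> b" by auto
    with x show "y \<in> g ` {a<..<b}" by auto
  qed (auto intro: mono)
  ultimately show ?thesis by (simp add: bij_betw_def)
qed

text \<open>The Moebius substitution \<open>n = (u2 * w + u1) / (v2 * w + v1)\<close> sends two of the four roots to \<open>0\<close> and
\<open>\<infinity>\<close> and so reduces the quartic to a cubic.\<close>

lemma nn_integral_quartic:
  fixes u1 u2 u3 v1 v2 v3 :: real
  assumes "u1 > 0" "u2 > 0" "v1 > 0" "v2 > 0"
    and r: "u1 * v2 > u2 * v1" "u3 * v1 > u1 * v3" "u3 * v2 > u2 * v3"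
  shows "(\<integral>\<^sup>+n\<in>{u2 / v2<..<u1 / v1}. ennreal (1 / sqrt ((1 + n) * (u1 - v1 * n) * (v2 * n - u2) * (u3 - v3 * n))) \<partial>lborel)
       = legendre ((u2 + v2) * (u3 * v1 - u1 * v3)) ((u1 + v1) * (u3 * v2 - u2 * v3))"
proof -
  define d where "d = u1 * v2 - u2 * v1"
  have d: "d > 0" using r by (simp add: d_def)
  have "(\<integral>\<^sup>+n\<in>{u2 / v2<..<u1 / v1}. ennreal (1 / sqrt ((1 + n) * (u1 - v1 * n) * (v2 * n - u2) * (u3 - v3 * n))) \<partial>lborel)
    = (\<integral>\<^sup>+w\<in>{0<..}. ennreal \<bar>- d / (v2 * w + v1)\<^sup>2\<bar> *
        ennreal (1 / sqrt ((1 + (u2 * w + u1) / (v2 * w + v1)) * (u1 - v1 * ((u2 * w + u1) / (v2 * w + v1))) *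
          (v2 * ((u2 * w + u1) / (v2 * w + v1)) - u2) * (u3 - v3 * ((u2 * w + u1) / (v2 * w + v1))))) \<partial>lborel)"
  proof (rule nn_integral_change_of_variables)
    show "bij_betw (\<lambda>w. (u2 * w + u1) / (v2 * w + v1)) {0<..} {u2 / v2<..<u1 / v1}"
      using bij_betw_mobius[of u2 v2 u1 v1 0] assms by (simp add: mult.commute)
    fix w :: real assume "w \<in> {0<..}"
    then have p: "v2 * w + v1 > 0" using assms by (auto intro!: add_pos_pos)
    then show "((\<lambda>w. (u2 * w + u1) / (v2 * w + v1)) has_real_derivative - d / (v2 * w + v1)\<^sup>2) (at w)"
      by (auto intro!: derivative_eq_intros simp: d_def power2_eq_square algebra_simps diff_divide_distrib)
  qed auto
  also have "\<dots> = (\<integral>\<^sup>+w\<in>{0<..}. ennreal (1 / sqrt (w * ((u1 + v1) + (u2 + v2) * w) *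
      ((u3 * v1 - u1 * v3) + (u3 * v2 - u2 * v3) * w))) \<partial>lborel)"
  proof (intro nn_integral_cong)
    fix w :: real
    let ?n = "(u2 * w + u1) / (v2 * w + v1)"
    have "\<bar>- d / (v2 * w + v1)\<^sup>2\<bar> * (1 / sqrt ((1 + ?n) * (u1 - v1 * ?n) * (v2 * ?n - u2) * (u3 - v3 * ?n)))
      = 1 / sqrt (w * ((u1 + v1) + (u2 + v2) * w) * ((u3 * v1 - u1 * v3) + (u3 * v2 - u2 * v3) * w))" if w: "w > 0"
    proof -
      define q where "q = v2 * w + v1"
      have q: "q > 0" using w assms by (auto simp: q_def intro!: add_pos_pos)
      have 1: "1 + ?n = ((u1 + v1) + (u2 + v2) * w) / q" "u1 - v1 * ?n = d * w / q" "v2 * ?n - u2 = d / q"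
        "u3 - v3 * ?n = ((u3 * v1 - u1 * v3) + (u3 * v2 - u2 * v3) * w) / q"
        using q unfolding q_def by (simp_all add: d_def divide_simps) (simp_all add: algebra_simps)
      have 2: "(1 + ?n) * (u1 - v1 * ?n) * (v2 * ?n - u2) * (u3 - v3 * ?n)
        = (d / q\<^sup>2)\<^sup>2 * (w * ((u1 + v1) + (u2 + v2) * w) * ((u3 * v1 - u1 * v3) + (u3 * v2 - u2 * v3) * w))"
        unfolding 1 using q by (simp add: power2_eq_square mult_ac)
      show ?thesis unfolding 2 unfolding q_def[symmetric] using d q
        by (subst sqrt_power2_mult) auto
    qed
    then show "ennreal \<bar>- d / (v2 * w + v1)\<^sup>2\<bar> * ennreal (1 / sqrt ((1 + ?n) * (u1 - v1 * ?n) * (v2 * ?n - u2) * (u3 - v3 * ?n)))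
        * indicator {0<..} w = ennreal (1 / sqrt (w * ((u1 + v1) + (u2 + v2) * w) *
      ((u3 * v1 - u1 * v3) + (u3 * v2 - u2 * v3) * w))) * indicator {0<..} w"
      by (cases "w > 0") (simp_all add: ennreal_mult'[symmetric])
  qed
  also have "\<dots> = legendre ((u2 + v2) * (u3 * v1 - u1 * v3)) ((u1 + v1) * (u3 * v2 - u2 * v3))"
    using assms by (intro legendre_cubic) auto
  finally show ?thesis .
qed

text \<open>The conics \<open>e\<^sup>2 - 4 * m = Y * (\<alpha> m + \<beta> m * e)\<close>, \<open>Y > 0\<close>, form the pencil spanned by the parabola
\<open>e\<^sup>2 = 4 * m\<close>, which bounds the domain of Landen's integral, and by \<open>\<alpha> m + \<beta> m * e = 0\<close>, which is a
conic because \<open>\<alpha>\<close> is quadratic and \<open>\<beta>\<close> linear. The point on the line of given \<open>m\<close> with \<open>e > 0\<close> is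
\<open>e = \<epsilon> Y m\<close>, and \<open>\<Delta>\<close> is the discriminant of the equation for \<open>e\<close>.

The coefficients, built from the elementary symmetric functions of \<open>a1, a2, a3\<close>, are chosen such that
the conic with parameter \<open>Y\<close> has a rational parametrisation \<open>n \<mapsto> (\<mu> Y n, E Y n)\<close> along which
\<open>1 + e + m\<close> and all three differences \<open>m - a\<^sup>2\<close>, \<open>a\<close> among \<open>a1, a2, a3\<close>, split into linear factors
in \<open>n\<close> over the common denominator \<open>D Y n\<close>; see \<open>conic_identities\<close>. The factor of \<open>a\<^sup>2 - m\<close> that
depends on \<open>Y\<close> is \<open>u Y a - v Y a * n\<close>.\<close>

locale conic_pencil =
  fixes a1 a2 a3 :: real
  assumes ord: "0 < a2" "a2 < a1" "a1 < a3"
begin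

definition "s1 = a1 + a2 + a3"
definition "s2 = a1 * a2 + a1 * a3 + a2 * a3"
definition "s3 = a1 * a2 * a3"

definition \<alpha> :: "real \<Rightarrow> real" where "\<alpha> m = m\<^sup>2 + (s1 + s2) * m + s3"
definition \<beta> :: "real \<Rightarrow> real" where "\<beta> m = ((1 + s1) * m + (s2 + s3)) / 2"
definition \<Delta> :: "real \<Rightarrow> real \<Rightarrow> real" where "\<Delta> Y m = (Y * \<beta> m)\<^sup>2 + 16 * m + 4 * Y * \<alpha> m"
definition \<epsilon> :: "real \<Rightarrow> real \<Rightarrow> real" where "\<epsilon> Y m = (Y * \<beta> m + sqrt (\<Delta> Y m)) / 2"

definition D :: "real \<Rightarrow> real \<Rightarrow> real" where "D Y n = 4 - Y * (n - 1) * (n + s1)"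
definition \<mu> :: "real \<Rightarrow> real \<Rightarrow> real" where "\<mu> Y n = (4 * n\<^sup>2 + Y * (n - 1) * (s2 * n + s3)) / D Y n"
definition E :: "real \<Rightarrow> real \<Rightarrow> real" where "E Y n = 2 * (4 * n + Y * (n\<^sup>2 + (s1 + s2) * n + s3)) / D Y n"
definition N :: "real \<Rightarrow> real \<Rightarrow> real" where "N Y n = 4 * (n + 1) + Y * ((s2 + 1) * n + s3 + s1)"

definition u :: "real \<Rightarrow> real \<Rightarrow> real" where "u Y a = 4 * a + Y * (a\<^sup>2 + s2)"
definition v :: "real \<Rightarrow> real \<Rightarrow> real" where "v Y a = 4 + Y * (a\<^sup>2 + s2)"

lemma a_pos: "a1 > 0" "a2 > 0" "a3 > 0" using ord by auto

lemma s_pos: "s1 > 0" "s2 > 0" "s3 > 0"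
  using a_pos by (auto simp: s1_def s2_def s3_def intro!: add_pos_pos)

lemma \<alpha>_\<beta>_pos: "m > 0 \<Longrightarrow> \<alpha> m > 0" "m > 0 \<Longrightarrow> \<beta> m > 0"
  using s_pos by (auto simp: \<alpha>_def \<beta>_def intro!: add_pos_pos)

lemma \<epsilon>_unique:
  assumes "m > 0" "Y > 0" "e > 0" and eq: "e\<^sup>2 - 4 * m = Y * (\<alpha> m + \<beta> m * e)"
  shows "\<epsilon> Y m = e" "sqrt (\<Delta> Y m) = 2 * e - Y * \<beta> m" "2 * e - Y * \<beta> m > 0"
proof -
  have "e * (e - Y * \<beta> m) = 4 * m + Y * \<alpha> m"
    using eq by (simp add: algebra_simps power2_eq_square)
  also have "\<dots> > 0" using \<alpha>_\<beta>_pos(1)[OF assms(1)] assms(1,2) by (simp add: add_pos_pos)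
  finally have "e - Y * \<beta> m > 0" using assms(3) by (simp add: zero_less_mult_iff)
  then show pos: "2 * e - Y * \<beta> m > 0" using assms(3) by simp
  have "\<Delta> Y m = (2 * e - Y * \<beta> m)\<^sup>2"
    using eq by (simp add: \<Delta>_def algebra_simps power2_eq_square)
  then show 1: "sqrt (\<Delta> Y m) = 2 * e - Y * \<beta> m" using pos by simp
  show "\<epsilon> Y m = e" by (simp add: \<epsilon>_def 1)
qed

lemma \<epsilon>_pos:
  assumes "m > 0" "Y > 0"
  shows "\<epsilon> Y m > 0" "(\<epsilon> Y m)\<^sup>2 - 4 * m = Y * (\<alpha> m + \<beta> m * \<epsilon> Y m)" "\<Delta> Y m > 0"
proof -
  note ab = \<alpha>_\<beta>_pos[OF assms(1)]
  have "4 * Y * \<alpha> m > 0" "(Y * \<beta> m)\<^sup>2 \<ge> 0" using ab assms by simp_all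
  then show d: "\<Delta> Y m > 0" unfolding \<Delta>_def using assms(1) by linarith
  have "Y * \<beta> m > 0" "sqrt (\<Delta> Y m) > 0" using ab assms d by simp_all
  then show "\<epsilon> Y m > 0" unfolding \<epsilon>_def by (intro divide_pos_pos add_pos_pos) simp_all
  define r where "r = sqrt (\<Delta> Y m)"
  have r: "r\<^sup>2 = (Y * \<beta> m)\<^sup>2 + 16 * m + 4 * Y * \<alpha> m"
    using d by (simp add: r_def \<Delta>_def)
  have "((Y * \<beta> m + r) / 2)\<^sup>2 - 4 * m = Y * (\<alpha> m + \<beta> m * ((Y * \<beta> m + r) / 2))"
    using r by (simp add: power2_eq_square algebra_simps)
  then show "(\<epsilon> Y m)\<^sup>2 - 4 * m = Y * (\<alpha> m + \<beta> m * \<epsilon> Y m)"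
    unfolding \<epsilon>_def r_def .
qed

text \<open>For fixed \<open>m\<close> the equation of the pencil gives \<open>Y\<close> as a rational function of \<open>e\<close>, and \<open>Y\<close> runs through
the positive numbers once as \<open>e\<close> runs from \<open>2 * sqrt m\<close> to infinity. So \<open>Y\<close> can replace \<open>e\<close> in
Landen's integral.\<close>

lemma landen_eq:
  assumes m: "m > 0"
  shows "landen m = (\<integral>\<^sup>+Y\<in>{0<..}. ennreal (1 / sqrt Y *
     sqrt ((\<alpha> m + \<beta> m * \<epsilon> Y m) / ((1 + \<epsilon> Y m + m) * \<Delta> Y m))) \<partial>lborel)"
proof -
  have "landen m = (\<integral>\<^sup>+Y\<in>{0<..}. ennreal \<bar>(\<alpha> m + \<beta> m * \<epsilon> Y m) / sqrt (\<Delta> Y m)\<bar> *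
      ennreal (1 / sqrt (((\<epsilon> Y m)\<^sup>2 - 4 * m) * (1 + \<epsilon> Y m + m))) \<partial>lborel)"
    unfolding landen_def
  proof (rule nn_integral_change_of_variables)
    show "bij_betw (\<lambda>Y. \<epsilon> Y m) {0<..} {2 * sqrt m<..}"
    proof (rule bij_betwI[where g = "\<lambda>e. (e\<^sup>2 - 4 * m) / (\<alpha> m + \<beta> m * e)"])
      show "(\<lambda>Y. \<epsilon> Y m) \<in> {0<..} \<rightarrow> {2 * sqrt m<..}"
      proof
        fix Y :: real assume "Y \<in> {0<..}"
        then have Y: "Y > 0" by simp
        have "(\<epsilon> Y m)\<^sup>2 - 4 * m > 0"
          unfolding \<epsilon>_pos(2)[OF m Y] using \<epsilon>_pos(1)[OF m Y] \<alpha>_\<beta>_pos[OF m] Y by (simp add: add_pos_pos)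
        then have "(2 * sqrt m)\<^sup>2 < (\<epsilon> Y m)\<^sup>2" using m by (simp add: power_mult_distrib)
        then show "\<epsilon> Y m \<in> {2 * sqrt m<..}"
          using \<epsilon>_pos(1)[OF m Y] power_less_imp_less_base[of "2 * sqrt m" 2 "\<epsilon> Y m"] by simp
      qed
      have e: "e > 0" "e\<^sup>2 - 4 * m > 0" "\<alpha> m + \<beta> m * e > 0" if "e > 2 * sqrt m" for e
      proof -
        show "e > 0" using order_less_trans[of 0 "2 * sqrt m" e] that m by simp
        then show "\<alpha> m + \<beta> m * e > 0" using \<alpha>_\<beta>_pos[OF m] by (simp add: add_pos_pos)
        show "e\<^sup>2 - 4 * m > 0" using power_strict_mono[OF that, of 2] m by (simp add: power_mult_distrib)
      qed
      then show "(\<lambda>e. (e\<^sup>2 - 4 * m) / (\<alpha> m + \<beta> m * e)) \<in> {2 * sqrt m<..} \<rightarrow> {0<..}" by auto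
      show "((\<epsilon> Y m)\<^sup>2 - 4 * m) / (\<alpha> m + \<beta> m * \<epsilon> Y m) = Y" if "Y \<in> {0<..}" for Y
      proof -
        have "\<alpha> m + \<beta> m * \<epsilon> Y m > 0" using \<epsilon>_pos(1)[OF m, of Y] \<alpha>_\<beta>_pos[OF m] that by (simp add: add_pos_pos)
        then show ?thesis using \<epsilon>_pos(2)[OF m, of Y] that by simp
      qed
      show "\<epsilon> ((e\<^sup>2 - 4 * m) / (\<alpha> m + \<beta> m * e)) m = e" if "e \<in> {2 * sqrt m<..}" for e
        using e[of e] that m by (intro \<epsilon>_unique(1)) simp_all
    qed
    fix Y :: real assume "Y \<in> {0<..}"
    then have Y: "Y > 0" by simp
    note d = \<epsilon>_pos(3)[OF m Y]
    have "((\<lambda>Y. \<epsilon> Y m) has_real_derivative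
        (\<beta> m + (2 * (Y * \<beta> m) * \<beta> m + 4 * \<alpha> m) / (2 * sqrt (\<Delta> Y m))) / 2) (at Y)"
    proof -
      have "((\<lambda>Y. \<Delta> Y m) has_real_derivative 2 * (Y * \<beta> m) * \<beta> m + 4 * \<alpha> m) (at Y)"
        unfolding \<Delta>_def by (auto intro!: derivative_eq_intros)
      from DERIV_chain2[OF DERIV_real_sqrt[OF d] this]
      have "((\<lambda>Y. sqrt (\<Delta> Y m)) has_real_derivative
        (2 * (Y * \<beta> m) * \<beta> m + 4 * \<alpha> m) / (2 * sqrt (\<Delta> Y m))) (at Y)"
        by (simp add: field_simps)
      from DERIV_cdivide[OF DERIV_add[OF DERIV_cmult_right[OF DERIV_ident, of "\<beta> m"] this], of 2]
      show ?thesis by (simp add: \<epsilon>_def)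
    qed
    also have "(\<beta> m + (2 * (Y * \<beta> m) * \<beta> m + 4 * \<alpha> m) / (2 * sqrt (\<Delta> Y m))) / 2
      = (\<alpha> m + \<beta> m * \<epsilon> Y m) / sqrt (\<Delta> Y m)"
    proof -
      have gen: "(b + (2 * (Y * b) * b + 4 * a) / (2 * r)) / 2 = (a + b * ((Y * b + r) / 2)) / r" if "r > 0" for a b r :: real
        using that by (simp add: divide_simps) (simp add: algebra_simps)
      show ?thesis unfolding \<epsilon>_def by (rule gen) (use d in simp)
    qed
    finally show "((\<lambda>Y. \<epsilon> Y m) has_real_derivative (\<alpha> m + \<beta> m * \<epsilon> Y m) / sqrt (\<Delta> Y m)) (at Y)" .
  qed (auto simp: \<epsilon>_def \<Delta>_def)
  also have "\<dots> = (\<integral>\<^sup>+Y\<in>{0<..}. ennreal (1 / sqrt Y *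
     sqrt ((\<alpha> m + \<beta> m * \<epsilon> Y m) / ((1 + \<epsilon> Y m + m) * \<Delta> Y m))) \<partial>lborel)"
  proof (intro nn_integral_cong)
    fix Y :: real
    have "\<bar>(\<alpha> m + \<beta> m * \<epsilon> Y m) / sqrt (\<Delta> Y m)\<bar> * (1 / sqrt (((\<epsilon> Y m)\<^sup>2 - 4 * m) * (1 + \<epsilon> Y m + m)))
      = 1 / sqrt Y * sqrt ((\<alpha> m + \<beta> m * \<epsilon> Y m) / ((1 + \<epsilon> Y m + m) * \<Delta> Y m))" if Y: "Y > 0"
    proof -
      define p where "p = \<alpha> m + \<beta> m * \<epsilon> Y m"
      have p: "p > 0" using \<epsilon>_pos(1)[OF m Y] \<alpha>_\<beta>_pos[OF m] by (simp add: p_def add_pos_pos)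
      have gen: "\<bar>p / sqrt d\<bar> * (1 / sqrt (Y * p * t)) = 1 / sqrt Y * sqrt (p / (t * d))" if "d > 0" for d t
      proof -
        have "p / sqrt p = sqrt p" using p by (simp add: real_div_sqrt)
        then show ?thesis using that p
          by (simp add: real_sqrt_mult real_sqrt_divide) (metis (no_types, lifting) mult.commute mult.left_commute divide_divide_eq_left)
      qed
      show ?thesis
        unfolding \<epsilon>_pos(2)[OF m Y] p_def[symmetric] by (rule gen) (rule \<epsilon>_pos(3)[OF m Y])
    qed
    then show "ennreal \<bar>(\<alpha> m + \<beta> m * \<epsilon> Y m) / sqrt (\<Delta> Y m)\<bar> *
        ennreal (1 / sqrt (((\<epsilon> Y m)\<^sup>2 - 4 * m) * (1 + \<epsilon> Y m + m))) * indicator {0<..} Y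
      = ennreal (1 / sqrt Y * sqrt ((\<alpha> m + \<beta> m * \<epsilon> Y m) / ((1 + \<epsilon> Y m + m) * \<Delta> Y m))) * indicator {0<..} Y"
      by (cases "Y > 0") (simp_all add: ennreal_mult'[symmetric])
  qed
  finally show ?thesis .
qed

end

lemma (in conic_pencil) uv_eq: "u Y a - v Y a * n = 4 * (a - n) - Y * (n - 1) * (a\<^sup>2 + s2)"
  by (simp add: u_def v_def algebra_simps)

lemma (in conic_pencil) uv_pos:
  assumes "a > 0" "Y > 0"
  shows "u Y a > 0" "v Y a > 0"
  using assms s_pos by (auto simp: u_def v_def intro!: add_pos_pos mult_pos_pos)

lemma (in conic_pencil) det_uv:
  "u Y a3 * v Y a1 - u Y a1 * v Y a3 = 4 * (a3 - a1) * (4 + Y * (a1 + a3) * (1 + a2))"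
  "u Y a3 * v Y a2 - u Y a2 * v Y a3 = 4 * (a3 - a2) * (4 + Y * (a2 + a3) * (1 + a1))"
  "u Y a1 * v Y a2 - u Y a2 * v Y a1 = 4 * (a1 - a2) * (4 + Y * (a1 + a2) * (1 + a3))"
  by (simp_all add: u_def v_def s2_def algebra_simps power2_eq_square)

text \<open>The zeros \<open>u / v\<close> of the three linear factors are in the same order as \<open>a2 < a1 < a3\<close>.\<close>

lemma (in conic_pencil) det_uv_pos:
  assumes "Y > 0"
  shows "u Y a3 * v Y a1 > u Y a1 * v Y a3" "u Y a3 * v Y a2 > u Y a2 * v Y a3" "u Y a1 * v Y a2 > u Y a2 * v Y a1"
proof -
  have "0 < 4 * (a3 - a1) * (4 + Y * (a1 + a3) * (1 + a2))" "0 < 4 * (a3 - a2) * (4 + Y * (a2 + a3) * (1 + a1))"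
    "0 < 4 * (a1 - a2) * (4 + Y * (a1 + a2) * (1 + a3))"
    using assms ord by (auto intro!: mult_pos_pos add_pos_pos)
  then show "u Y a3 * v Y a1 > u Y a1 * v Y a3" "u Y a3 * v Y a2 > u Y a2 * v Y a3" "u Y a1 * v Y a2 > u Y a2 * v Y a1"
    unfolding det_uv[symmetric] by simp_all
qed

text \<open>This is the value of \<open>D\<close> at a zero \<open>u / v\<close>; cleared of denominators it becomes a polynomial in \<open>Y\<close> with
positive coefficients.\<close>

lemma conic_denominator_pos:
  fixes a b c Y :: real
  assumes "a > 0" "b > 0" "c > 0" "Y > 0"
  defines "s \<equiv> a + b + c" and "B \<equiv> a\<^sup>2 + (a * b + a * c + b * c)"
  shows "4 - Y * ((4 * a + Y * B) / (4 + Y * B) - 1) * ((4 * a + Y * B) / (4 + Y * B) + s) > 0"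
proof -
  define q where "q = 4 + Y * B"
  have B: "B > 0" using assms by (auto simp: B_def intro!: add_pos_pos)
  then have q: "q > 0" using assms by (auto simp: q_def intro!: add_pos_pos)
  have 1: "(4 * a + Y * B) / q - 1 = 4 * (a - 1) / q" "(4 * a + Y * B) / q + s = (4 * a + Y * B + q * s) / q"
    using q by (simp_all add: field_simps) (simp add: q_def algebra_simps)
  have "4 - Y * ((4 * a + Y * B) / q - 1) * ((4 * a + Y * B) / q + s)
      = (4 * q\<^sup>2 - Y * (4 * (a - 1)) * (4 * a + Y * B + q * s)) / q\<^sup>2"
    unfolding 1 using q by (simp add: field_simps power2_eq_square)
  also have "4 * q\<^sup>2 - Y * (4 * (a - 1)) * (4 * a + Y * B + q * s)
      = 64 + 16 * Y * (a * (b + c) + 2 * (b * c) + a + s) + 4 * Y\<^sup>2 * B * (b * c + 1 + b + c)"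
    by (simp add: q_def B_def s_def algebra_simps power2_eq_square)
  also have "\<dots> / q\<^sup>2 > 0"
    using assms(1-4) B q by (auto simp: s_def intro!: divide_pos_pos add_pos_pos mult_pos_pos)
  finally show ?thesis unfolding q_def .
qed

context conic_pencil
begin

lemma D_pos_ends:
  assumes "Y > 0"
  shows "D Y (u Y a1 / v Y a1) > 0" "D Y (u Y a2 / v Y a2) > 0"
proof -
  show "D Y (u Y a1 / v Y a1) > 0"
    using conic_denominator_pos[of a1 a2 a3 Y] a_pos assms
    by (simp add: D_def u_def v_def s1_def s2_def algebra_simps)
  show "D Y (u Y a2 / v Y a2) > 0"
    using conic_denominator_pos[of a2 a1 a3 Y] a_pos assms
    by (simp add: D_def u_def v_def s1_def s2_def algebra_simps)
qed

text \<open>\<open>D Y\<close> is a concave quadratic polynomial, hence positive between two points where it is positive.\<close>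

lemma D_pos:
  assumes Y: "Y > 0" and n: "u Y a2 / v Y a2 \<le> n" "n \<le> u Y a1 / v Y a1"
  shows "D Y n > 0"
proof -
  define l r where "l = u Y a2 / v Y a2" and "r = u Y a1 / v Y a1"
  have lr: "l < r"
    using det_uv_pos(3)[OF Y] uv_pos(2)[OF a_pos(1) Y] uv_pos(2)[OF a_pos(2) Y]
    by (simp add: l_def r_def field_simps)
  have DD: "D Y l > 0" "D Y r > 0" using D_pos_ends[OF Y] by (auto simp: l_def r_def)
  \<comment> \<open>Quadratic interpolation of \<open>D Y\<close> at the end points; the leading coefficient is \<open>- Y\<close>.\<close>
  have "(r - l) * D Y n = (r - n) * D Y l + (n - l) * D Y r + Y * (n - l) * (r - n) * (r - l)"
    by (simp add: D_def algebra_simps power2_eq_square)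
  also have "\<dots> > 0"
  proof (cases "n = l")
    case True
    then show ?thesis using DD lr by simp
  next
    case False
    then have "n > l" "n \<le> r" using n by (auto simp: l_def r_def)
    then show ?thesis using DD lr Y by (intro add_nonneg_pos add_pos_nonneg mult_pos_pos mult_nonneg_nonneg add_nonneg_nonneg) auto
  qed
  finally show ?thesis using lr by (simp add: zero_less_mult_iff)
qed

text \<open>Polynomial identities in \<open>n\<close> and \<open>Y\<close> after multiplication by powers of \<open>D\<close>. The first two together say
that \<open>(\<mu> Y n, E Y n)\<close> lies on the conic with parameter \<open>Y\<close>.\<close>

lemma conic_identities:
  assumes "D Y n \<noteq> 0"
  shows "(E Y n)\<^sup>2 - 4 * \<mu> Y n = 4 * Y * ((n + a1) * (n + a2) * (n + a3)) * N Y n / (D Y n)\<^sup>2"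
    and "\<alpha> (\<mu> Y n) + \<beta> (\<mu> Y n) * E Y n = 4 * ((n + a1) * (n + a2) * (n + a3)) * N Y n / (D Y n)\<^sup>2"
    and "1 + E Y n + \<mu> Y n = (1 + n) * N Y n / D Y n"
    and "a1\<^sup>2 - \<mu> Y n = (n + a1) * (u Y a1 - v Y a1 * n) / D Y n"
    and "\<mu> Y n - a2\<^sup>2 = (n + a2) * (v Y a2 * n - u Y a2) / D Y n"
    and "a3\<^sup>2 - \<mu> Y n = (n + a3) * (u Y a3 - v Y a3 * n) / D Y n"
proof -
  define d p q where "d = D Y n" and "p = 4 * n\<^sup>2 + Y * (n - 1) * (s2 * n + s3)"
    and "q = 2 * (4 * n + Y * (n\<^sup>2 + (s1 + s2) * n + s3))"
  have d: "d \<noteq> 0" using assms by (simp add: d_def)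
  have mE: "\<mu> Y n = p / d" "E Y n = q / d" by (auto simp: \<mu>_def E_def p_def q_def d_def)
  have P: "(n + a1) * (n + a2) * (n + a3) = n ^ 3 + s1 * n\<^sup>2 + s2 * n + s3"
    by (simp add: s1_def s2_def s3_def algebra_simps power2_eq_square power3_eq_cube)
  have 1: "q\<^sup>2 - 4 * p * d = 4 * Y * (n ^ 3 + s1 * n\<^sup>2 + s2 * n + s3) * N Y n"
    by (simp add: p_def q_def d_def D_def N_def algebra_simps power2_eq_square power3_eq_cube)
  have 2: "2 * (p\<^sup>2 + (s1 + s2) * p * d + s3 * d\<^sup>2) + ((1 + s1) * p + (s2 + s3) * d) * q
      = 8 * (n ^ 3 + s1 * n\<^sup>2 + s2 * n + s3) * N Y n"
    by (simp add: p_def q_def d_def D_def N_def algebra_simps power2_eq_square power3_eq_cube)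
  show "(E Y n)\<^sup>2 - 4 * \<mu> Y n = 4 * Y * ((n + a1) * (n + a2) * (n + a3)) * N Y n / (D Y n)\<^sup>2"
    unfolding mE P 1[symmetric] d_def[symmetric] using d by (simp add: field_simps power2_eq_square)
  show "\<alpha> (\<mu> Y n) + \<beta> (\<mu> Y n) * E Y n = 4 * ((n + a1) * (n + a2) * (n + a3)) * N Y n / (D Y n)\<^sup>2"
  proof -
    have "\<alpha> (p / d) + \<beta> (p / d) * (q / d)
        = (2 * (p\<^sup>2 + (s1 + s2) * p * d + s3 * d\<^sup>2) + ((1 + s1) * p + (s2 + s3) * d) * q) / (2 * d\<^sup>2)"
      unfolding \<alpha>_def \<beta>_def using d by (simp add: divide_simps) (simp add: algebra_simps power2_eq_square)
    then show ?thesis unfolding mE P 2 d_def[symmetric] using d by (simp add: field_simps)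
  qed
  have 3: "d + q + p = (1 + n) * N Y n"
    by (simp add: p_def q_def d_def D_def N_def algebra_simps power2_eq_square)
  show "1 + E Y n + \<mu> Y n = (1 + n) * N Y n / D Y n"
    unfolding mE 3[symmetric] d_def[symmetric] using d by (simp add: field_simps)
  have 4: "a\<^sup>2 * d - p = (n + a) * (u Y a - v Y a * n)" if "a = a1 \<or> a = a2 \<or> a = a3" for a
    unfolding uv_eq using that
    by (auto simp: p_def d_def D_def s1_def s2_def s3_def algebra_simps power2_eq_square)
  have 5: "a\<^sup>2 - p / d = (a\<^sup>2 * d - p) / d" for a using d by (simp add: field_simps)
  show "a1\<^sup>2 - \<mu> Y n = (n + a1) * (u Y a1 - v Y a1 * n) / D Y n"
    "a3\<^sup>2 - \<mu> Y n = (n + a3) * (u Y a3 - v Y a3 * n) / D Y n"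
    unfolding mE 5 d_def[symmetric] by (simp_all add: 4)
  have "\<mu> Y n - a2\<^sup>2 = - ((a2\<^sup>2 * d - p) / d)" unfolding mE 5[symmetric] by simp
  also have "\<dots> = (n + a2) * (v Y a2 * n - u Y a2) / d"
    unfolding 4[of a2, simplified] using d by (simp add: field_simps)
  finally show "\<mu> Y n - a2\<^sup>2 = (n + a2) * (v Y a2 * n - u Y a2) / D Y n" by (simp add: d_def)
qed

text \<open>The factor \<open>2 * E Y n - Y * \<beta> (\<mu> Y n)\<close> is the square root of \<open>\<Delta>\<close>, by \<open>\<mu>_facts\<close>, and cancels the one in
\<open>landen_eq\<close>.\<close>

lemma \<mu>_deriv:
  assumes "D Y n \<noteq> 0"
  shows "(\<mu> Y has_real_derivative 2 * (2 * E Y n - Y * \<beta> (\<mu> Y n)) / D Y n) (at n)"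
proof -
  define d p q where "d = D Y n" and "p = 4 * n\<^sup>2 + Y * (n - 1) * (s2 * n + s3)"
    and "q = 2 * (4 * n + Y * (n\<^sup>2 + (s1 + s2) * n + s3))"
  have d: "d \<noteq> 0" using assms by (simp add: d_def)
  have mE: "\<mu> Y n = p / d" "E Y n = q / d" by (auto simp: \<mu>_def E_def p_def q_def d_def)
  have "((\<lambda>n. 4 * n\<^sup>2 + Y * (n - 1) * (s2 * n + s3)) has_real_derivative
      8 * n + Y * ((s2 * n + s3) + (n - 1) * s2)) (at n)"
    by (auto intro!: derivative_eq_intros simp: algebra_simps)
  moreover have "(D Y has_real_derivative - (Y * ((n + s1) + (n - 1)))) (at n)"
    unfolding D_def by (auto intro!: derivative_eq_intros simp: algebra_simps)
  ultimately have "(\<mu> Y has_real_derivative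
      ((8 * n + Y * ((s2 * n + s3) + (n - 1) * s2)) * d - p * - (Y * ((n + s1) + (n - 1)))) / (d * d)) (at n)"
    unfolding \<mu>_def p_def d_def using assms by (rule DERIV_divide)
  also have "(8 * n + Y * ((s2 * n + s3) + (n - 1) * s2)) * d - p * - (Y * ((n + s1) + (n - 1)))
      = 4 * q - Y * ((1 + s1) * p + (s2 + s3) * d)"
    by (simp add: p_def q_def d_def D_def algebra_simps power2_eq_square)
  also have "\<dots> / (d * d) = 2 * (2 * E Y n - Y * \<beta> (\<mu> Y n)) / D Y n"
    unfolding mE \<beta>_def d_def[symmetric] using d by (simp add: field_simps)
  finally show ?thesis .
qed

lemma \<mu>_facts:
  assumes Y: "Y > 0" and n: "u Y a2 / v Y a2 \<le> n" "n \<le> u Y a1 / v Y a1"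
  shows "n > 0" "\<mu> Y n > 0" "E Y n > 0" "N Y n > 0"
    and "\<epsilon> Y (\<mu> Y n) = E Y n" "sqrt (\<Delta> Y (\<mu> Y n)) = 2 * E Y n - Y * \<beta> (\<mu> Y n)"
      "2 * E Y n - Y * \<beta> (\<mu> Y n) > 0"
proof -
  note uv = uv_pos[OF a_pos(2) Y]
  note d = D_pos[OF assms]
  then have d0: "D Y n \<noteq> 0" by simp
  have "u Y a2 / v Y a2 > 0" using uv by simp
  then show n0: "n > 0" using n by linarith
  show "N Y n > 0" using n0 s_pos Y by (auto simp: N_def intro!: add_pos_pos mult_pos_pos)
  show E: "E Y n > 0" using n0 s_pos Y d
    by (auto simp: E_def intro!: divide_pos_pos add_pos_pos mult_pos_pos)
  have "v Y a2 * n - u Y a2 \<ge> 0" using n(1) uv by (simp add: field_simps)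
  then have "\<mu> Y n - a2\<^sup>2 \<ge> 0"
    unfolding conic_identities(5)[OF d0] using n0 a_pos d by simp
  then show m: "\<mu> Y n > 0" using zero_less_power[OF a_pos(2), of 2] by linarith
  have eq: "(E Y n)\<^sup>2 - 4 * \<mu> Y n = Y * (\<alpha> (\<mu> Y n) + \<beta> (\<mu> Y n) * E Y n)"
    unfolding conic_identities(1,2)[OF d0] by simp
  show "\<epsilon> Y (\<mu> Y n) = E Y n" "sqrt (\<Delta> Y (\<mu> Y n)) = 2 * E Y n - Y * \<beta> (\<mu> Y n)"
      "2 * E Y n - Y * \<beta> (\<mu> Y n) > 0"
    using \<epsilon>_unique[OF m Y E eq] by auto
qed

lemma bij_betw_\<mu>:
  assumes Y: "Y > 0"
  shows "bij_betw (\<mu> Y) {u Y a2 / v Y a2<..<u Y a1 / v Y a1} {a2\<^sup>2<..<a1\<^sup>2}"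
proof -
  let ?l = "u Y a2 / v Y a2" and ?r = "u Y a1 / v Y a1"
  have lr: "?l < ?r"
    using det_uv_pos(3)[OF Y] uv_pos(2)[OF a_pos(1) Y] uv_pos(2)[OF a_pos(2) Y]
    by (simp add: field_simps)
  have "bij_betw (\<mu> Y) {?l<..<?r} {\<mu> Y ?l<..<\<mu> Y ?r}"
  proof (rule bij_betw_DERIV_pos[OF lr])
    fix n assume n: "?l \<le> n" "n \<le> ?r"
    show "(\<mu> Y has_real_derivative 2 * (2 * E Y n - Y * \<beta> (\<mu> Y n)) / D Y n) (at n)"
      using D_pos[OF Y n] by (intro \<mu>_deriv) simp
    show "2 * (2 * E Y n - Y * \<beta> (\<mu> Y n)) / D Y n > 0"
      using D_pos[OF Y n] \<mu>_facts(7)[OF Y n] by simp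
  qed
  moreover have "\<mu> Y ?r = a1\<^sup>2"
    using conic_identities(4)[of Y ?r] D_pos[OF Y _ order_refl] lr uv_pos(2)[OF a_pos(1) Y] by simp
  moreover have "\<mu> Y ?l = a2\<^sup>2"
    using conic_identities(5)[of Y ?l] D_pos[OF Y order_refl] lr uv_pos(2)[OF a_pos(2) Y] by simp
  ultimately show ?thesis by simp
qed

text \<open>In the parameter \<open>n\<close> the factors \<open>n + a1\<close>, \<open>n + a2\<close>, \<open>n + a3\<close> and the polynomial \<open>N\<close> all cancel, and the
square root of a quartic with the roots \<open>- 1\<close> and \<open>u / v\<close> remains.\<close>

lemma nn_integral_fixed_Y:
  assumes Y: "Y > 0"
  shows "(\<integral>\<^sup>+m\<in>{a2\<^sup>2<..<a1\<^sup>2}. ennreal (1 / sqrt ((m - a2\<^sup>2) * (a1\<^sup>2 - m) * (a3\<^sup>2 - m)) *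
            sqrt ((\<alpha> m + \<beta> m * \<epsilon> Y m) / ((1 + \<epsilon> Y m + m) * \<Delta> Y m))) \<partial>lborel)
       = 4 * legendre ((u Y a2 + v Y a2) * (u Y a3 * v Y a1 - u Y a1 * v Y a3))
                      ((u Y a1 + v Y a1) * (u Y a3 * v Y a2 - u Y a2 * v Y a3))"
proof -
  let ?h = "\<lambda>m. 1 / sqrt ((m - a2\<^sup>2) * (a1\<^sup>2 - m) * (a3\<^sup>2 - m)) *
            sqrt ((\<alpha> m + \<beta> m * \<epsilon> Y m) / ((1 + \<epsilon> Y m + m) * \<Delta> Y m))"
  let ?I = "{u Y a2 / v Y a2<..<u Y a1 / v Y a1}"
  let ?k = "\<lambda>n. 1 / sqrt ((1 + n) * (u Y a1 - v Y a1 * n) * (v Y a2 * n - u Y a2) * (u Y a3 - v Y a3 * n))"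
  have [measurable]: "\<mu> Y \<in> borel_measurable borel"
    unfolding \<mu>_def[abs_def] D_def by measurable
  have "(\<integral>\<^sup>+m\<in>{a2\<^sup>2<..<a1\<^sup>2}. ennreal (?h m) \<partial>lborel)
    = (\<integral>\<^sup>+n\<in>?I. ennreal \<bar>2 * (2 * E Y n - Y * \<beta> (\<mu> Y n)) / D Y n\<bar> * ennreal (?h (\<mu> Y n)) \<partial>lborel)"
  proof (rule nn_integral_change_of_variables[OF bij_betw_\<mu>[OF Y]])
    fix n assume "n \<in> ?I"
    then have "D Y n > 0" by (intro D_pos[OF Y]) auto
    then show "(\<mu> Y has_real_derivative 2 * (2 * E Y n - Y * \<beta> (\<mu> Y n)) / D Y n) (at n)"
      by (intro \<mu>_deriv) simp
  qed (auto simp: E_def \<beta>_def \<mu>_def D_def \<alpha>_def \<epsilon>_def \<Delta>_def)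
  also have "\<dots> = (\<integral>\<^sup>+n\<in>?I. 4 * ennreal (?k n) \<partial>lborel)"
  proof (intro nn_integral_cong)
    fix n
    have "\<bar>2 * (2 * E Y n - Y * \<beta> (\<mu> Y n)) / D Y n\<bar> * ?h (\<mu> Y n) = 4 * ?k n" if n: "n \<in> ?I"
    proof -
      have n': "u Y a2 / v Y a2 \<le> n" "n \<le> u Y a1 / v Y a1" using n by auto
      note F = \<mu>_facts[OF Y n']
      define d where "d = D Y n"
      have d: "d > 0" using D_pos[OF Y n'] by (simp add: d_def)
      then have d0: "D Y n \<noteq> 0" by (simp add: d_def)
      note I = conic_identities[OF d0, folded d_def]
      define r where "r = 2 * E Y n - Y * \<beta> (\<mu> Y n)"
      have r: "r > 0" using F(7) by (simp add: r_def)
      have \<Delta>: "\<Delta> Y (\<mu> Y n) = r\<^sup>2"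
      proof -
        have "\<Delta> Y (\<mu> Y n) > 0" by (rule \<epsilon>_pos(3)[OF F(2) Y])
        then have "\<Delta> Y (\<mu> Y n) = (sqrt (\<Delta> Y (\<mu> Y n)))\<^sup>2" by simp
        then show ?thesis unfolding F(6) r_def .
      qed
      define X1 X2 X3 where "X1 = u Y a1 - v Y a1 * n" and "X2 = v Y a2 * n - u Y a2" and "X3 = u Y a3 - v Y a3 * n"
      note v = uv_pos(2)[OF a_pos(1) Y] uv_pos(2)[OF a_pos(2) Y] uv_pos(2)[OF a_pos(3) Y]
      have X12: "X1 > 0" "X2 > 0" using n v by (auto simp: X1_def X2_def field_simps)
      have "u Y a1 / v Y a1 < u Y a3 / v Y a3"
        using det_uv_pos(1)[OF Y] v by (simp add: field_simps)
      with n have "n < u Y a3 / v Y a3" by auto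
      then have X3: "X3 > 0" using v by (simp add: X3_def field_simps)
      define X where "X = (1 + n) * X1 * X2 * X3"
      have X: "X > 0" using X12 X3 F(1) by (simp add: X_def)
      define P where "P = (n + a1) * (n + a2) * (n + a3)"
      have P: "P > 0" using F(1) a_pos by (simp add: P_def)
      define Z where "Z = (\<mu> Y n - a2\<^sup>2) * (a1\<^sup>2 - \<mu> Y n) * (a3\<^sup>2 - \<mu> Y n)"
      have Z: "Z = P * (X1 * X2 * X3) / d ^ 3"
        unfolding Z_def I X1_def[symmetric] X2_def[symmetric] X3_def[symmetric] P_def
        by (simp add: power3_eq_cube mult_ac)
      then have Z0: "Z > 0" using P X12 X3 d by simp
      have R: "(\<alpha> (\<mu> Y n) + \<beta> (\<mu> Y n) * E Y n) / ((1 + E Y n + \<mu> Y n) * r\<^sup>2) = (2 * d / r)\<^sup>2 * (Z / X)"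
        unfolding I Z X_def P_def[symmetric] using d r F(1,4) X12 X3
        by (simp add: divide_simps) (simp add: power2_eq_square power3_eq_cube power4_eq_xxxx mult_ac)
      have "?h (\<mu> Y n) = 1 / sqrt Z * (2 * d / r * sqrt (Z / X))"
        unfolding F(5) \<Delta> R Z_def[symmetric] using d r by (subst sqrt_power2_mult) simp_all
      also have "\<dots> = 2 * d / r / sqrt X"
        using Z0 by (simp add: real_sqrt_divide)
      finally have "\<bar>2 * r / d\<bar> * ?h (\<mu> Y n) = 4 / sqrt X"
        using d r by simp
      then show ?thesis
        unfolding r_def d_def X_def X1_def X2_def X3_def by simp
    qed
    then show "ennreal \<bar>2 * (2 * E Y n - Y * \<beta> (\<mu> Y n)) / D Y n\<bar> * ennreal (?h (\<mu> Y n)) * indicator ?I n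
      = 4 * ennreal (?k n) * indicator ?I n"
      by (cases "n \<in> ?I") (simp_all add: ennreal_mult'[symmetric] flip: ennreal_numeral)
  qed
  also have "\<dots> = 4 * (\<integral>\<^sup>+n\<in>?I. ennreal (?k n) \<partial>lborel)"
    by (rule set_nn_integral_cmult) auto
  also have "(\<integral>\<^sup>+n\<in>?I. ennreal (?k n) \<partial>lborel)
     = legendre ((u Y a2 + v Y a2) * (u Y a3 * v Y a1 - u Y a1 * v Y a3))
                ((u Y a1 + v Y a1) * (u Y a3 * v Y a2 - u Y a2 * v Y a3))"
    by (rule nn_integral_quartic) (use Y a_pos uv_pos det_uv_pos in auto)
  finally show ?thesis .
qed

text \<open>Tonelli: the region is covered by the lines of constant \<open>m\<close> and by the conics of constant \<open>Y\<close>.\<close>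

theorem nn_integral_landen_conic:
  "(\<integral>\<^sup>+m\<in>{a2\<^sup>2<..<a1\<^sup>2}. ennreal (1 / sqrt ((m - a2\<^sup>2) * (a1\<^sup>2 - m) * (a3\<^sup>2 - m))) * landen m \<partial>lborel)
   = (\<integral>\<^sup>+Y\<in>{0<..}. ennreal (4 / sqrt Y) *
        legendre ((u Y a2 + v Y a2) * (u Y a3 * v Y a1 - u Y a1 * v Y a3))
                 ((u Y a1 + v Y a1) * (u Y a3 * v Y a2 - u Y a2 * v Y a3)) \<partial>lborel)"
proof -
  define W where "W = (\<lambda>m. 1 / sqrt ((m - a2\<^sup>2) * (a1\<^sup>2 - m) * (a3\<^sup>2 - m)))"
  define P where "P = (\<lambda>Y m. sqrt ((\<alpha> m + \<beta> m * \<epsilon> Y m) / ((1 + \<epsilon> Y m + m) * \<Delta> Y m)))"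
  have [measurable]: "W \<in> borel_measurable borel" "(\<lambda>(Y, m). P Y m) \<in> borel_measurable (borel \<Otimes>\<^sub>M borel)"
    "(\<lambda>(m, Y). P Y m) \<in> borel_measurable (borel \<Otimes>\<^sub>M borel)"
    "\<And>Y. P Y \<in> borel_measurable borel" "\<And>m. (\<lambda>Y. P Y m) \<in> borel_measurable borel"
    unfolding W_def P_def \<alpha>_def \<beta>_def \<epsilon>_def \<Delta>_def by measurable
  have "(\<integral>\<^sup>+m\<in>{a2\<^sup>2<..<a1\<^sup>2}. ennreal (W m) * landen m \<partial>lborel)
    = (\<integral>\<^sup>+m\<in>{a2\<^sup>2<..<a1\<^sup>2}. (\<integral>\<^sup>+Y\<in>{0<..}. ennreal (W m) * ennreal (1 / sqrt Y * P Y m) \<partial>lborel) \<partial>lborel)"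
  proof (rule set_nn_integral_cong[OF refl refl])
    fix m :: real assume "m \<in> space lborel \<inter> {a2\<^sup>2<..<a1\<^sup>2}"
    then have m: "m \<in> {a2\<^sup>2<..<a1\<^sup>2}" by simp
    show "ennreal (W m) * landen m = (\<integral>\<^sup>+Y\<in>{0<..}. ennreal (W m) * ennreal (1 / sqrt Y * P Y m) \<partial>lborel)"
    proof -
      have "m > 0" using m order_less_trans[OF zero_less_power[OF a_pos(2), of 2], of m] by simp
      then have L: "landen m = (\<integral>\<^sup>+Y\<in>{0<..}. ennreal (1 / sqrt Y * P Y m) \<partial>lborel)"
        unfolding P_def by (rule landen_eq)
      show ?thesis unfolding L by (rule set_nn_integral_cmult[symmetric]) auto
    qed
  qed
  also have "\<dots> = (\<integral>\<^sup>+Y\<in>{0<..}. (\<integral>\<^sup>+m\<in>{a2\<^sup>2<..<a1\<^sup>2}. ennreal (W m) * ennreal (1 / sqrt Y * P Y m) \<partial>lborel) \<partial>lborel)"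
    by (rule set_nn_integral_swap) measurable
  also have "\<dots> = (\<integral>\<^sup>+Y\<in>{0<..}. ennreal (4 / sqrt Y) *
        legendre ((u Y a2 + v Y a2) * (u Y a3 * v Y a1 - u Y a1 * v Y a3))
                 ((u Y a1 + v Y a1) * (u Y a3 * v Y a2 - u Y a2 * v Y a3)) \<partial>lborel)"
  proof (rule set_nn_integral_cong[OF refl refl])
    fix Y :: real assume "Y \<in> space lborel \<inter> {0<..}"
    then have Y: "Y > 0" by simp
    let ?L = "legendre ((u Y a2 + v Y a2) * (u Y a3 * v Y a1 - u Y a1 * v Y a3))
                 ((u Y a1 + v Y a1) * (u Y a3 * v Y a2 - u Y a2 * v Y a3))"
    show "(\<integral>\<^sup>+m\<in>{a2\<^sup>2<..<a1\<^sup>2}. ennreal (W m) * ennreal (1 / sqrt Y * P Y m) \<partial>lborel) = ennreal (4 / sqrt Y) * ?L"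
    proof -
      have "(\<integral>\<^sup>+m\<in>{a2\<^sup>2<..<a1\<^sup>2}. ennreal (W m) * ennreal (1 / sqrt Y * P Y m) \<partial>lborel)
        = (\<integral>\<^sup>+m\<in>{a2\<^sup>2<..<a1\<^sup>2}. ennreal (1 / sqrt Y) * ennreal (W m * P Y m) \<partial>lborel)"
      proof (rule set_nn_integral_cong[OF refl refl])
        fix m :: real assume "m \<in> space lborel \<inter> {a2\<^sup>2<..<a1\<^sup>2}"
        then have m: "m \<in> {a2\<^sup>2<..<a1\<^sup>2}" by simp
        show "ennreal (W m) * ennreal (1 / sqrt Y * P Y m) = ennreal (1 / sqrt Y) * ennreal (W m * P Y m)"
        proof -
          have "a1\<^sup>2 < a3\<^sup>2" using ord by (intro power_strict_mono) auto
          with m have "W m \<ge> 0" by (auto simp: W_def)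
          then show ?thesis using Y by (simp add: ennreal_mult'[symmetric] mult_ac)
        qed
      qed
      also have "\<dots> = ennreal (1 / sqrt Y) * (4 * ?L)"
      proof -
        have "(\<integral>\<^sup>+m\<in>{a2\<^sup>2<..<a1\<^sup>2}. ennreal (W m * P Y m) \<partial>lborel) = 4 * ?L"
          unfolding W_def P_def by (rule nn_integral_fixed_Y[OF Y])
        then show ?thesis by (subst set_nn_integral_cmult) auto
      qed
      also have "ennreal (1 / sqrt Y) * (4 * ?L) = ennreal (1 / sqrt Y * 4) * ?L"
        using Y by (subst ennreal_mult) (simp_all add: mult.assoc)
      finally show ?thesis by simp
    qed
  qed
  finally show ?thesis unfolding W_def .
qed

end

section \<open>Invariance under a step of the iteration\<close>

text \<open>Written for squares, so that the next iterate is a polynomial in \<open>A, B, C, D\<close>. The left side is the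
integral over \<open>m\<close> that \<open>nn_integral_landen_conic\<close> rewrites; after the scaling \<open>Y = K * y\<close> of the pencil
parameter, the outcome is the second form, \<open>borchardt_integral_x_fibre\<close>, of the right side.\<close>

lemma borchardt_integral_step_squares:
  fixes A B C D :: real
  assumes dec: "A > B" "B > C" "C > D" "D > 0"
  shows "borchardt_integral (A\<^sup>2) (B\<^sup>2) (C\<^sup>2) (D\<^sup>2)
    = borchardt_integral ((A\<^sup>2 + B\<^sup>2 + C\<^sup>2 + D\<^sup>2) / 4) ((A * B + C * D) / 2) ((A * C + B * D) / 2) ((A * D + B * C) / 2)"
proof -
  define q1 q2 q3 q4 where "q1 = (A\<^sup>2 + B\<^sup>2 + C\<^sup>2 + D\<^sup>2) / 4" and "q2 = (A * B + C * D) / 2"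
    and "q3 = (A * C + B * D) / 2" and "q4 = (A * D + B * C) / 2"
  define p S T F G where "p = B * C" and "S = B\<^sup>2 + C\<^sup>2" and "T = B\<^sup>2 - C\<^sup>2"
    and "F = A * B - C * D" and "G = A * C - B * D"
  have pos: "A > 0" "B > 0" "C > 0" using dec by auto
  have sq: "A\<^sup>2 > B\<^sup>2" "B\<^sup>2 > C\<^sup>2" "C\<^sup>2 > D\<^sup>2" "D\<^sup>2 > 0"
    using dec pos by (auto intro!: power_strict_mono)
  have q: "q1 > 0" "q2 > 0" "q3 > 0" "q4 > 0"
    using pos dec by (auto simp: q1_def q2_def q3_def q4_def intro!: add_pos_pos)
  have F: "p > 0" "S > 0" "T > 0" "F > 0" "G > 0"
    using pos dec sq mult_strict_mono[of C A D B] mult_strict_mono[of B A D C]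
    by (auto simp: p_def S_def T_def F_def G_def mult.commute add_pos_pos)
  define a1 a2 a3 where "a1 = (A\<^sup>2 + D\<^sup>2) / S" and "a2 = A * D / p" and "a3 = (A\<^sup>2 - D\<^sup>2) / T"
  have a: "1 + a1 = 4 * q1 / S" "1 + a2 = 2 * q4 / p"
    "a1 + a2 = 4 * q2 * q3 / (p * S)" "a1 - a2 = F * G / (p * S)"
    "a1 + a3 = 4 * q2 * F / (S * T)" "a3 - a1 = 4 * q3 * G / (S * T)"
    "a2 + a3 = 2 * q3 * F / (p * T)" "a3 - a2 = 2 * q2 * G / (p * T)"
    unfolding a1_def a2_def a3_def using F
    by (simp_all add: field_simps,
        simp_all add: p_def S_def T_def F_def G_def q1_def q2_def q3_def q4_def algebra_simps power2_eq_square,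
        simp_all add: field_simps)
  interpret conic_pencil a1 a2 a3
  proof
    show "0 < a2" using pos dec F by (simp add: a2_def)
    have "a1 - a2 > 0" "a3 - a1 > 0" unfolding a using F q by simp_all
    then show "a2 < a1" "a1 < a3" by simp_all
  qed
  \<comment> \<open>\<open>K\<close> makes the affine functions of \<open>Y\<close> in the result proportional to \<open>q4 + q3 * y\<close> and its companions; \<open>g\<^sup>2\<close> is the common factor of the two arguments of \<open>legendre\<close>.\<close>
  define K where "K = p * S * T / (2 * q2 * q3 * F)"
  define g where "g = sqrt (512 * G / (p * S * T))"
  have K: "K > 0" and g: "g > 0" "g\<^sup>2 = 512 * G / (p * S * T)" using F q by (auto simp: K_def g_def)
  have B2: "a2\<^sup>2 + s2 = (a1 + a2) * (a2 + a3)" "a1\<^sup>2 + s2 = (a1 + a2) * (a1 + a3)"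
    by (simp_all add: s2_def algebra_simps power2_eq_square)
  define k where "k = (A\<^sup>2 * B\<^sup>2 - C\<^sup>2 * D\<^sup>2) * (A\<^sup>2 * C\<^sup>2 - B\<^sup>2 * D\<^sup>2)"
  have k: "k = 4 * q2 * q3 * F * G"
    by (simp add: k_def q2_def q3_def F_def G_def algebra_simps power2_eq_square, simp add: field_simps)
  have k0: "k > 0" unfolding k using F q by simp
  define c where "c = 4 * sqrt k / (p * S * T)"
  have c0: "c > 0" using k0 F by (simp add: c_def)
  let ?L = "\<lambda>Y. legendre ((u Y a2 + v Y a2) * (u Y a3 * v Y a1 - u Y a1 * v Y a3))
                 ((u Y a1 + v Y a1) * (u Y a3 * v Y a2 - u Y a2 * v Y a3))"
  have "sqrt (B\<^sup>2 * C\<^sup>2) = p" using pos by (simp add: p_def real_sqrt_mult)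
  moreover have "(sqrt (A\<^sup>2 * D\<^sup>2 / (B\<^sup>2 * C\<^sup>2))) = a2"
    using pos dec(4) by (simp add: a2_def p_def real_sqrt_mult real_sqrt_divide)
  ultimately have "borchardt_integral (A\<^sup>2) (B\<^sup>2) (C\<^sup>2) (D\<^sup>2) = ennreal c *
      (\<integral>\<^sup>+m\<in>{a2\<^sup>2<..<a1\<^sup>2}. ennreal (1 / sqrt ((m - a2\<^sup>2) * (a1\<^sup>2 - m) * (a3\<^sup>2 - m))) * landen m \<partial>lborel)"
    using borchardt_integral_eq_landen[OF sq] unfolding S_def[symmetric] T_def[symmetric] a1_def[symmetric] a3_def[symmetric]
      k_def[symmetric] c_def by simp
  also have "\<dots> = ennreal c * (\<integral>\<^sup>+Y\<in>{0<..}. ennreal (4 / sqrt Y) * ?L Y \<partial>lborel)"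
    unfolding nn_integral_landen_conic ..
  also have "(\<integral>\<^sup>+Y\<in>{0<..}. ennreal (4 / sqrt Y) * ?L Y \<partial>lborel)
    = (\<integral>\<^sup>+y\<in>{0<..}. ennreal \<bar>K\<bar> * (ennreal (4 / sqrt (K * y)) * ?L (K * y)) \<partial>lborel)"
    by (rule nn_integral_change_of_variables[OF bij_betw_scale[OF K]])
       (auto intro!: derivative_eq_intros simp: u_def v_def)
  also have "ennreal c * \<dots> = (\<integral>\<^sup>+y\<in>{0<..}. ennreal c * (ennreal \<bar>K\<bar> * (ennreal (4 / sqrt (K * y)) * ?L (K * y))) \<partial>lborel)"
    by (rule set_nn_integral_cmult[symmetric]) (auto simp: u_def v_def)
  also have "\<dots> = (\<integral>\<^sup>+y\<in>{0<..}. ennreal (1 / sqrt y) * legendre ((q3 + q4 * y) * (q4 + q3 * y)) ((q2 + q1 * y) * (q1 + q2 * y)) \<partial>lborel)"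
  proof (rule set_nn_integral_cong[OF refl refl])
    fix y :: real assume "y \<in> space lborel \<inter> {0<..}"
    then have y: "y > 0" by simp
    let ?R = "legendre ((q3 + q4 * y) * (q4 + q3 * y)) ((q2 + q1 * y) * (q1 + q2 * y))"
    show "ennreal c * (ennreal \<bar>K\<bar> * (ennreal (4 / sqrt (K * y)) * ?L (K * y))) = ennreal (1 / sqrt y) * ?R"
    proof -
      have 1: "u (K * y) a2 + v (K * y) a2 = 8 * (q4 + q3 * y) / p"
      proof -
        have "u (K * y) a2 + v (K * y) a2 = 4 * (1 + a2) + 2 * K * y * ((a1 + a2) * (a2 + a3))"
          unfolding B2[symmetric] by (simp add: u_def v_def algebra_simps)
        also have "\<dots> = 8 * (q4 + q3 * y) / p"
          unfolding a K_def using F q by (simp add: field_simps)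
        finally show ?thesis .
      qed
      have 2: "u (K * y) a1 + v (K * y) a1 = 16 * (q1 + q2 * y) / S"
      proof -
        have "u (K * y) a1 + v (K * y) a1 = 4 * (1 + a1) + 2 * K * y * ((a1 + a2) * (a1 + a3))"
          unfolding B2[symmetric] by (simp add: u_def v_def algebra_simps)
        also have "\<dots> = 16 * (q1 + q2 * y) / S"
          unfolding a K_def using F q by (simp add: field_simps)
        finally show ?thesis .
      qed
      have 3: "u (K * y) a3 * v (K * y) a1 - u (K * y) a1 * v (K * y) a3 = 64 * G * (q3 + q4 * y) / (S * T)"
        unfolding det_uv a K_def using F q by (simp add: field_simps)
      have 4: "u (K * y) a3 * v (K * y) a2 - u (K * y) a2 * v (K * y) a3 = 32 * G * (q2 + q1 * y) / (p * T)"
        unfolding det_uv a K_def using F q by (simp add: field_simps)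
      have 5: "8 * (q4 + q3 * y) / p * (64 * G * (q3 + q4 * y) / (S * T)) = g\<^sup>2 * ((q3 + q4 * y) * (q4 + q3 * y))"
        "16 * (q1 + q2 * y) / S * (32 * G * (q2 + q1 * y) / (p * T)) = g\<^sup>2 * ((q2 + q1 * y) * (q1 + q2 * y))"
        unfolding g(2) using F by (simp_all add: divide_simps, simp_all add: algebra_simps)
      have 6: "?L (K * y) = ennreal (1 / g) * ?R"
        unfolding 1 2 3 4 5 by (rule legendre_scale) (rule g(1))
      have 7: "c * (K * (4 / sqrt (K * y)) * (1 / g)) = 1 / sqrt y"
      proof -
        have "(c * 4 * sqrt K / g)\<^sup>2 = 1\<^sup>2"
          unfolding c_def k power_divide power_mult_distrib g(2)
          using F q K by (simp add: K_def field_simps power2_eq_square)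
        then have one: "c * 4 * sqrt K / g = 1"
          using c0 K g(1) by (subst (asm) power2_eq_iff_nonneg) simp_all
        have root: "K / sqrt (K * y) = sqrt K / sqrt y"
          using y K by (simp add: real_sqrt_mult) (metis real_div_sqrt less_imp_le divide_divide_eq_left)
        have "c * (K * (4 / sqrt (K * y)) * (1 / g)) = c * 4 * (K / sqrt (K * y)) / g" by simp
        also have "\<dots> = (c * 4 * sqrt K / g) / sqrt y" unfolding root by simp
        finally show ?thesis unfolding one .
      qed
      have "ennreal c * (ennreal \<bar>K\<bar> * (ennreal (4 / sqrt (K * y)) * (ennreal (1 / g) * ?R)))
        = ennreal c * (ennreal (K * (4 / sqrt (K * y)) * (1 / g)) * ?R)"
        using K g y by (subst ennreal_collect) simp_all
      also have "\<dots> = ennreal (c * (K * (4 / sqrt (K * y)) * (1 / g))) * ?R"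
        using c0 by (subst ennreal_mult') (simp_all add: mult.assoc)
      finally show ?thesis unfolding 6 7 .
    qed
  qed
  also have "\<dots> = borchardt_integral q1 q2 q3 q4"
    using q by (rule borchardt_integral_x_fibre[symmetric])
  finally show ?thesis unfolding q1_def q2_def q3_def q4_def .
qed

lemma borchardt_integral_step:
  assumes "c1 > c2" "c2 > c3" "c3 > c4" "c4 > 0"
  shows "borchardt_integral ((c1 + c2 + c3 + c4) / 4) ((sqrt (c1 * c2) + sqrt (c3 * c4)) / 2)
      ((sqrt (c1 * c3) + sqrt (c2 * c4)) / 2) ((sqrt (c1 * c4) + sqrt (c2 * c3)) / 2)
    = borchardt_integral c1 c2 c3 c4"
  using borchardt_integral_step_squares[of "sqrt c2" "sqrt c1" "sqrt c3" "sqrt c4"] assms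
  by (simp add: real_sqrt_mult)

section \<open>The limit of the iteration\<close>

lemma vector_4:
  "(vector [x, y, z, w] :: ('a::zero)^4) $ 1 = x"
  "(vector [x, y, z, w] :: ('a::zero)^4) $ 2 = y"
  "(vector [x, y, z, w] :: ('a::zero)^4) $ 3 = z"
  "(vector [x, y, z, w] :: ('a::zero)^4) $ 4 = w"
  unfolding vector_def by simp_all

text \<open>The substitution \<open>x = t\<^sup>2\<close> leads to the derivative of the arctangent.\<close>

lemma nn_integral_arcsine_line:
  "(\<integral>\<^sup>+x\<in>{0<..}. ennreal (1 / (sqrt x * (1 + x))) \<partial>lborel) = ennreal pi"
proof -
  have "(\<integral>\<^sup>+x\<in>{0<..}. ennreal (1 / (sqrt x * (1 + x))) \<partial>lborel)
      = (\<integral>\<^sup>+t\<in>{0<..}. ennreal \<bar>2 * t\<bar> * ennreal (1 / (sqrt (t\<^sup>2) * (1 + t\<^sup>2))) \<partial>lborel)"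
  proof (rule nn_integral_change_of_variables)
    show "bij_betw (\<lambda>t::real. t\<^sup>2) {0<..} {0<..}"
      by (rule bij_betwI[where g = sqrt]) auto
  qed (auto intro!: derivative_eq_intros)
  also have "\<dots> = (\<integral>\<^sup>+t. ennreal (2 / (1 + t\<^sup>2)) * indicator {0..} t \<partial>lborel)"
  proof (rule nn_integral_cong_AE, rule eventually_mono[OF AE_lborel_singleton[of "0::real"]])
    fix t :: real assume "t \<noteq> 0"
    then show "ennreal \<bar>2 * t\<bar> * ennreal (1 / (sqrt (t\<^sup>2) * (1 + t\<^sup>2))) * indicator {0<..} t
        = ennreal (2 / (1 + t\<^sup>2)) * indicator {0..} t"
      by (auto simp: indicator_def ennreal_mult'[symmetric])
  qed
  also have "\<dots> = ennreal (2 * (pi / 2) - 2 * arctan 0)"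
  proof (rule nn_integral_FTC_atLeast)
    show "((\<lambda>x. 2 * arctan x) \<longlongrightarrow> 2 * (pi / 2)) at_top"
      by (intro tendsto_intros tendsto_arctan_at_top)
    fix x :: real
    show "((\<lambda>x. 2 * arctan x) has_real_derivative 2 / (1 + x\<^sup>2)) (at x)"
      by (auto intro!: derivative_eq_intros simp: divide_inverse)
  qed auto
  finally show ?thesis by simp
qed

lemma nn_integral_arcsine_quadrant:
  assumes "k > 0"
  shows "(\<integral>\<^sup>+x\<in>{0<..}. (\<integral>\<^sup>+y\<in>{0<..}. ennreal (1 / (k * (sqrt x * (1 + x)) * (sqrt y * (1 + y)))) \<partial>lborel) \<partial>lborel)
       = ennreal (pi\<^sup>2 / k)"
proof -
  let ?w = "\<lambda>x::real. ennreal (1 / (sqrt x * (1 + x)))"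
  have "(\<integral>\<^sup>+x\<in>{0<..}. (\<integral>\<^sup>+y\<in>{0<..}. ennreal (1 / (k * (sqrt x * (1 + x)) * (sqrt y * (1 + y)))) \<partial>lborel) \<partial>lborel)
    = (\<integral>\<^sup>+x\<in>{0<..}. ennreal (pi / k) * ?w x \<partial>lborel)"
  proof (rule set_nn_integral_cong[OF refl refl])
    fix x :: real assume "x \<in> space lborel \<inter> {0<..}"
    then have x: "x > 0" by simp
    show "(\<integral>\<^sup>+y\<in>{0<..}. ennreal (1 / (k * (sqrt x * (1 + x)) * (sqrt y * (1 + y)))) \<partial>lborel) = ennreal (pi / k) * ?w x"
    proof -
      have "(\<integral>\<^sup>+y\<in>{0<..}. ennreal (1 / (k * (sqrt x * (1 + x)) * (sqrt y * (1 + y)))) \<partial>lborel)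
        = (\<integral>\<^sup>+y\<in>{0<..}. ennreal (1 / (k * (sqrt x * (1 + x)))) * ?w y \<partial>lborel)"
        using x assms by (intro nn_integral_cong) (simp add: ennreal_mult'[symmetric])
      also have "\<dots> = ennreal (1 / (k * (sqrt x * (1 + x)))) * ennreal pi"
        unfolding nn_integral_arcsine_line[symmetric] by (rule set_nn_integral_cmult) auto
      also have "\<dots> = ennreal (pi / k) * ?w x"
        using x assms by (simp add: ennreal_mult'[symmetric])
      finally show ?thesis .
    qed
  qed
  also have "\<dots> = ennreal (pi / k) * ennreal pi"
    unfolding nn_integral_arcsine_line[symmetric] by (rule set_nn_integral_cmult) auto
  also have "\<dots> = ennreal (pi\<^sup>2 / k)"
    using assms by (simp add: ennreal_mult'[symmetric] power2_eq_square)
  finally show ?thesis .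
qed

text \<open>If all coefficients equal \<open>k\<close>, both bilinear factors are \<open>k * (1 + x) * (1 + y)\<close> and the integral is
\<open>pi\<^sup>2 / k\<close>; the integrand is decreasing in each coefficient.\<close>

lemma borchardt_integral_bounds:
  assumes l: "l > 0" and c: "l \<le> c1" "l \<le> c2" "l \<le> c3" "l \<le> c4" "c1 \<le> h" "c2 \<le> h" "c3 \<le> h" "c4 \<le> h"
  shows "ennreal (pi\<^sup>2 / h) \<le> borchardt_integral c1 c2 c3 c4" "borchardt_integral c1 c2 c3 c4 \<le> ennreal (pi\<^sup>2 / l)"
proof -
  have h: "h > 0" using l c by linarith
  let ?P = "\<lambda>x y. x * y * (c2 + c3 * x + c1 * y + c4 * x * y) * (c4 + c1 * x + c3 * y + c2 * x * y)"
  have sq: "k * (sqrt x * (1 + x)) * (sqrt y * (1 + y)) = sqrt (x * y * (k * ((1 + x) * (1 + y))) * (k * ((1 + x) * (1 + y))))"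
    if "k > 0" "x > 0" "y > 0" for k x y :: real
  proof -
    have "x * y * (k * ((1 + x) * (1 + y))) * (k * ((1 + x) * (1 + y))) = (k * (1 + x) * (1 + y))\<^sup>2 * (x * y)"
      by (simp add: power2_eq_square mult_ac)
    then show ?thesis using that by (simp only: sqrt_power2_mult real_sqrt_mult) (simp add: real_sqrt_mult mult_ac)
  qed
  have lin: "l * ((1 + x) * (1 + y)) \<le> a + b * x + c * y + d * x * y" "a + b * x + c * y + d * x * y \<le> h * ((1 + x) * (1 + y))"
    if "x > 0" "y > 0" "l \<le> a" "l \<le> b" "l \<le> c" "l \<le> d" "a \<le> h" "b \<le> h" "c \<le> h" "d \<le> h" for x y a b c d
  proof -
    have "0 \<le> (a - l) + (b - l) * x + (c - l) * y + (d - l) * (x * y)"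
      "0 \<le> (h - a) + (h - b) * x + (h - c) * y + (h - d) * (x * y)"
      using that by auto
    then show "l * ((1 + x) * (1 + y)) \<le> a + b * x + c * y + d * x * y" "a + b * x + c * y + d * x * y \<le> h * ((1 + x) * (1 + y))"
      by (simp_all add: algebra_simps)
  qed
  have *: "1 / (h * (sqrt x * (1 + x)) * (sqrt y * (1 + y))) \<le> 1 / sqrt (?P x y)"
    "1 / sqrt (?P x y) \<le> 1 / (l * (sqrt x * (1 + x)) * (sqrt y * (1 + y)))" if xy: "x > 0" "y > 0" for x y
  proof -
    let ?X = "c2 + c3 * x + c1 * y + c4 * x * y" and ?Y = "c4 + c1 * x + c3 * y + c2 * x * y"
    have XY: "l * ((1 + x) * (1 + y)) \<le> ?X" "?X \<le> h * ((1 + x) * (1 + y))" "l * ((1 + x) * (1 + y)) \<le> ?Y" "?Y \<le> h * ((1 + x) * (1 + y))"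
      using xy c by (intro lin; simp)+
    have l0: "0 < l * ((1 + x) * (1 + y))" using xy l by simp
    then have X0: "?X > 0" "?Y > 0" using XY by linarith+
    have lo: "x * y * (l * ((1 + x) * (1 + y))) * (l * ((1 + x) * (1 + y))) \<le> ?P x y"
      using XY l0 X0 xy by (intro mult_mono) auto
    have hi: "?P x y \<le> x * y * (h * ((1 + x) * (1 + y))) * (h * ((1 + x) * (1 + y)))"
      using XY l0 X0 xy h by (intro mult_mono) auto
    show "1 / (h * (sqrt x * (1 + x)) * (sqrt y * (1 + y))) \<le> 1 / sqrt (?P x y)"
      unfolding sq[OF h xy] using X0 xy h hi by (intro divide_left_mono real_sqrt_le_mono mult_pos_pos) auto
    show "1 / sqrt (?P x y) \<le> 1 / (l * (sqrt x * (1 + x)) * (sqrt y * (1 + y)))"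
      unfolding sq[OF l xy] using X0 xy l lo by (intro divide_left_mono real_sqrt_le_mono mult_pos_pos) auto
  qed
  show "ennreal (pi\<^sup>2 / h) \<le> borchardt_integral c1 c2 c3 c4"
    unfolding borchardt_integral_def nn_integral_arcsine_quadrant[OF h, symmetric]
    by (intro nn_integral_mono) (auto simp: indicator_def intro!: nn_integral_mono ennreal_leI *)
  show "borchardt_integral c1 c2 c3 c4 \<le> ennreal (pi\<^sup>2 / l)"
    unfolding borchardt_integral_def nn_integral_arcsine_quadrant[OF l, symmetric]
    by (intro nn_integral_mono) (auto simp: indicator_def intro!: nn_integral_mono ennreal_leI *)
qed

text \<open>Strictness of the inequalities is what gives \<open>0 < a2 < a1 < a3\<close> in the pencil of conics.\<close>

definition strictly_decreasing4 :: "real^4 \<Rightarrow> bool" where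
  "strictly_decreasing4 u \<longleftrightarrow> u$1 > u$2 \<and> u$2 > u$3 \<and> u$3 > u$4 \<and> u$4 > 0"

lemma borchardt_nth:
  "borchardt u $ 1 = (u$1 + u$2 + u$3 + u$4) / 4"
  "borchardt u $ 2 = (sqrt (u$1 * u$2) + sqrt (u$3 * u$4)) / 2"
  "borchardt u $ 3 = (sqrt (u$1 * u$3) + sqrt (u$2 * u$4)) / 2"
  "borchardt u $ 4 = (sqrt (u$1 * u$4) + sqrt (u$2 * u$3)) / 2"
  unfolding borchardt_def by (simp_all add: vector_4)

text \<open>The smallest entry grows and the largest becomes the average of all four, hence the gap between them
shrinks by the factor \<open>3 / 4\<close> at least.\<close>

lemma borchardt_step:
  assumes "strictly_decreasing4 u"
  shows "strictly_decreasing4 (borchardt u)" "borchardt u $ 1 \<le> u $ 1" "u $ 4 \<le> borchardt u $ 4"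
    "borchardt u $ 1 - borchardt u $ 4 \<le> 3 / 4 * (u $ 1 - u $ 4)"
proof -
  have u: "u$1 > u$2" "u$2 > u$3" "u$3 > u$4" "u$4 > 0" using assms by (auto simp: strictly_decreasing4_def)
  define a b c d where "a = sqrt (u$1)" and "b = sqrt (u$2)" and "c = sqrt (u$3)" and "d = sqrt (u$4)"
  have abcd: "a > b" "b > c" "c > d" "d > 0" using u by (simp_all add: a_def b_def c_def d_def)
  have sq: "u$1 = a\<^sup>2" "u$2 = b\<^sup>2" "u$3 = c\<^sup>2" "u$4 = d\<^sup>2" using u by (simp_all add: a_def b_def c_def d_def)
  have m: "borchardt u $ 1 = (a\<^sup>2 + b\<^sup>2 + c\<^sup>2 + d\<^sup>2) / 4" "borchardt u $ 2 = (a * b + c * d) / 2"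
    "borchardt u $ 3 = (a * c + b * d) / 2" "borchardt u $ 4 = (a * d + b * c) / 2"
    unfolding borchardt_nth by (simp_all add: a_def b_def c_def d_def real_sqrt_mult sq[unfolded a_def b_def c_def d_def, symmetric] sq(1)[symmetric])
  have "0 < (a - b)\<^sup>2" "0 \<le> (c - d)\<^sup>2" "0 < (a - d) * (b - c)" "0 < (a - b) * (c - d)" "0 < a * d + b * c"
    using abcd by (auto intro!: add_pos_pos)
  then show "strictly_decreasing4 (borchardt u)"
    unfolding strictly_decreasing4_def m by (auto simp: power2_eq_square algebra_simps)
  show "borchardt u $ 1 \<le> u $ 1" using u unfolding borchardt_nth by simp
  have ad: "d * d \<le> a * d" "d * d \<le> b * c" using abcd by (auto intro!: mult_mono)
  then show 4: "u $ 4 \<le> borchardt u $ 4" unfolding m sq power2_eq_square by simp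
  show "borchardt u $ 1 - borchardt u $ 4 \<le> 3 / 4 * (u $ 1 - u $ 4)"
  proof -
    have "4 * borchardt u $ 1 = u$1 + u$2 + u$3 + u$4" by (simp add: borchardt_nth)
    then show ?thesis using 4 u by simp
  qed
qed

text \<open>The integral is constant along the iterates and lies between \<open>pi\<^sup>2\<close> over the largest and \<open>pi\<^sup>2\<close> over the
smallest entry, which have the same limit.\<close>

theorem borchardt_limit:
  assumes "strictly_decreasing4 c"
  obtains L where "L > 0" "\<And>i. (\<lambda>n. (borchardt ^^ n) c $ i) \<longlonglongrightarrow> L"
    "borchardt_integral (c$1) (c$2) (c$3) (c$4) = ennreal (pi\<^sup>2 / L)"
proof -
  define x where "x = (\<lambda>n. (borchardt ^^ n) c)"
  have x0: "x 0 = c" and xS: "x (Suc n) = borchardt (x n)" for n by (auto simp: x_def)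
  have dec: "strictly_decreasing4 (x n)" for n
    by (induction n) (simp_all add: x0 xS assms borchardt_step)
  note st = borchardt_step[OF dec, folded xS]
  have "decseq (\<lambda>n. x n $ 1)" by (rule decseq_SucI) (rule st)
  have inc: "incseq (\<lambda>n. x n $ 4)" by (rule incseq_SucI) (rule st)
  have pos: "x n $ 4 > 0" "x n $ 1 \<ge> x n $ 4" for n using dec[of n] by (auto simp: strictly_decreasing4_def)
  have gap: "x n $ 1 - x n $ 4 \<le> (3 / 4) ^ n * (c $ 1 - c $ 4)" for n
  proof (induction n)
    case (Suc n)
    then show ?case using st(4)[of n] by simp
  qed (simp add: x0)
  have "x n $ 1 \<le> c $ 1" for n using decseqD[OF \<open>decseq (\<lambda>n. x n $ 1)\<close>, of 0 n] by (simp add: x0)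
  then have "x n $ 4 \<le> c $ 1" for n using pos(2)[of n] by (meson order_trans)
  then obtain L where L: "(\<lambda>n. x n $ 4) \<longlonglongrightarrow> L" "\<And>n. x n $ 4 \<le> L"
    using incseq_convergent[OF inc] by blast
  have L0: "L > 0" using L(2)[of 0] pos(1)[of 0] by linarith
  have "(\<lambda>n. (3 / 4) ^ n * (c $ 1 - c $ 4)) \<longlonglongrightarrow> 0 * (c $ 1 - c $ 4)"
    by (intro tendsto_intros LIMSEQ_power_zero) simp
  then have "(\<lambda>n. x n $ 1 - x n $ 4) \<longlonglongrightarrow> 0"
    using gap pos(2) by (intro tendsto_sandwich[of "\<lambda>_. 0" "\<lambda>n. x n $ 1 - x n $ 4" sequentially]) auto
  from tendsto_add[OF this L(1)] have L1: "(\<lambda>n. x n $ 1) \<longlonglongrightarrow> L" by simp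
  have lim: "(\<lambda>n. x n $ i) \<longlonglongrightarrow> L" for i
  proof (rule tendsto_sandwich[OF _ _ L(1) L1])
    have "x n $ 4 \<le> x n $ i \<and> x n $ i \<le> x n $ 1" for n
    proof -
      have "\<forall>i. x n $ 4 \<le> x n $ i \<and> x n $ i \<le> x n $ 1"
        unfolding forall_4 using dec[of n] by (auto simp: strictly_decreasing4_def)
      then show ?thesis by blast
    qed
    then show "\<forall>\<^sub>F n in sequentially. x n $ 4 \<le> x n $ i" "\<forall>\<^sub>F n in sequentially. x n $ i \<le> x n $ 1" by auto
  qed
  let ?J = "\<lambda>u::real^4. borchardt_integral (u$1) (u$2) (u$3) (u$4)"
  have J: "?J (x n) = ?J c" for n
  proof (induction n)
    case (Suc n)
    have "?J (x (Suc n)) = ?J (x n)"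
      unfolding xS borchardt_nth using dec[of n]
      by (intro borchardt_integral_step) (auto simp: strictly_decreasing4_def)
    with Suc show ?case by simp
  qed (simp add: x0)
  have bounds: "ennreal (pi\<^sup>2 / x n $ 1) \<le> ?J c" "?J c \<le> ennreal (pi\<^sup>2 / x n $ 4)" for n
    unfolding J[of n, symmetric] using dec[of n]
    by (auto intro!: borchardt_integral_bounds simp: strictly_decreasing4_def)
  have "(\<lambda>n. ennreal (pi\<^sup>2 / x n $ 1)) \<longlonglongrightarrow> ennreal (pi\<^sup>2 / L)" "(\<lambda>n. ennreal (pi\<^sup>2 / x n $ 4)) \<longlonglongrightarrow> ennreal (pi\<^sup>2 / L)"
    using L0 by (auto intro!: tendsto_ennrealI tendsto_intros L(1) L1)
  then have "?J c = ennreal (pi\<^sup>2 / L)"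
    using bounds by (intro antisym) (auto intro: LIMSEQ_le_const LIMSEQ_le_const2)
  then show ?thesis using that[OF L0] lim by (simp add: x_def)
qed

lemma borchardt_mean_eq:
  assumes "\<And>i. (\<lambda>n. (borchardt ^^ n) c $ i) \<longlonglongrightarrow> L"
  shows "borchardt_mean c = L"
  unfolding borchardt_mean_def using assms by (intro the_equality) (auto intro: LIMSEQ_unique)

section \<open>Rotation of a half-line contour\<close>

lemma borel_measurable_csqrt [measurable]: "csqrt \<in> borel_measurable borel"
  by (subst borel_measurable_complex_iff) simp

lemma csqrt_scale: "t \<ge> 0 \<Longrightarrow> csqrt (of_real t * z) = of_real (sqrt t) * csqrt z"
proof (cases "t = 0")
  case False
  assume "t \<ge> 0"
  show ?thesis
  proof (rule csqrt_unique)
    show "(complex_of_real (sqrt t) * csqrt z)\<^sup>2 = of_real t * z"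
      using \<open>t \<ge> 0\<close> by (simp add: power_mult_distrib flip: of_real_power)
    show "0 < Re (complex_of_real (sqrt t) * csqrt z) \<or> Re (complex_of_real (sqrt t) * csqrt z) = 0 \<and> 0 \<le> Im (complex_of_real (sqrt t) * csqrt z)"
      using csqrt_principal[of z] False \<open>t \<ge> 0\<close> by (auto simp del: csqrt.simps)
  qed
qed simp

text \<open>The principal root is holomorphic at every \<open>z\<close> that a fixed rotation \<open>e\<close> from the open right half-plane
takes into the right half-plane. Such half-planes are convex and stable under sums, which makes them more
convenient than the slit plane.\<close>

lemma half_plane_not_nonpos: "Re e > 0 \<Longrightarrow> Re (e * z) > 0 \<Longrightarrow> z \<notin> \<real>\<^sub>\<le>\<^sub>0"
  by (auto elim!: nonpos_Reals_cases simp: zero_less_mult_iff)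

lemma half_plane_norm: "\<delta> \<le> Re (e * z) \<Longrightarrow> e \<noteq> 0 \<Longrightarrow> \<delta> / norm e \<le> norm z"
  using complex_Re_le_cmod[of "e * z"] by (simp add: norm_mult field_simps)

lemma set_integrable_arcsine_line: "set_integrable lborel {0<..} (\<lambda>x. 1 / (sqrt x * (1 + x)))"
  unfolding set_integrable_def
proof (rule integrableI_bounded)
  have "(\<integral>\<^sup>+x. ennreal (norm (indicat_real {0<..} x *\<^sub>R (1 / (sqrt x * (1 + x))))) \<partial>lborel)
     = (\<integral>\<^sup>+x\<in>{0<..}. ennreal (1 / (sqrt x * (1 + x))) \<partial>lborel)"
    by (intro nn_integral_cong) (auto simp: indicator_def)
  then show "(\<integral>\<^sup>+x. ennreal (norm (indicat_real {0<..} x *\<^sub>R (1 / (sqrt x * (1 + x))))) \<partial>lborel) < \<infinity>"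
    by (simp add: nn_integral_arcsine_line)
qed simp

text \<open>Let \<open>F\<close> be a primitive of \<open>f\<close> on the convex set \<open>S\<close>. Then \<open>F x - F (\<zeta> * x)\<close> is a primitive of
\<open>f x - \<zeta> * f (\<zeta> * x)\<close> on the half-line, and it tends to \<open>0\<close> at both ends, because the integral of \<open>f\<close> along
the chord from \<open>r\<close> to \<open>\<zeta> * r\<close> is of order \<open>sqrt r / (1 + r)\<close>. The hypotheses speak of the points of
these chords.\<close>

lemma ray_rotation:
  fixes f :: "complex \<Rightarrow> complex" and \<zeta> :: complex
  assumes S: "open S" "convex S" and holo: "f holomorphic_on S"
    and mem: "\<And>r l. r > 0 \<Longrightarrow> 0 \<le> l \<Longrightarrow> l \<le> 1 \<Longrightarrow> of_real r * (of_real (1 - l) + of_real l * \<zeta>) \<in> S"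
    and bound: "\<And>r l. r > 0 \<Longrightarrow> 0 \<le> l \<Longrightarrow> l \<le> 1 \<Longrightarrow>
        norm (f (of_real r * (of_real (1 - l) + of_real l * \<zeta>))) \<le> C / (sqrt r * (1 + r))"
  shows "set_integrable lborel {0<..} (\<lambda>x. f (of_real x))"
    and "set_integrable lborel {0<..} (\<lambda>x. \<zeta> * f (\<zeta> * of_real x))"
    and "(LINT x:{0<..}|lborel. f (of_real x)) = (LINT x:{0<..}|lborel. \<zeta> * f (\<zeta> * of_real x))"
proof -
  have memr: "of_real x \<in> S" "\<zeta> * of_real x \<in> S" if "x > 0" for x :: real
    using mem[of x 0] mem[of x 1] that by (auto simp: mult.commute)
  have contf: "continuous_on S f" using holo by (rule holomorphic_on_imp_continuous_on)
  have int: "set_integrable lborel {0<..} (\<lambda>x. a * f (a * of_real x))"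
    if a: "\<And>x. x > 0 \<Longrightarrow> a * of_real x \<in> S" "\<And>x. x > 0 \<Longrightarrow> norm (f (a * of_real x)) \<le> C / (sqrt x * (1 + x))" for a
  proof (rule set_integrable_bound)
    show "set_integrable lborel {0<..} (\<lambda>x. (norm a * C) * (1 / (sqrt x * (1 + x))))"
      by (intro set_integrable_mult_right set_integrable_arcsine_line)
    have "continuous_on {0<..} (\<lambda>x. a * f (a * of_real x))"
      by (intro continuous_intros continuous_on_compose2[OF contf]) (use a in auto)
    then show "set_borel_measurable lborel {0<..} (\<lambda>x. a * f (a * of_real x))"
      unfolding set_borel_measurable_def
      by (simp add: borel_measurable_continuous_on_indicator)
    show "AE x in lborel. x \<in> {0<..} \<longrightarrow> norm (a * f (a * of_real x)) \<le> norm ((norm a * C) * (1 / (sqrt x * (1 + x))))"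
    proof (intro AE_I2 impI)
      fix x :: real assume "x \<in> {0<..}"
      then have "norm (f (a * of_real x)) \<le> C / (sqrt x * (1 + x))" using a by simp
      then have "norm (a * f (a * of_real x)) \<le> norm a * (C / (sqrt x * (1 + x)))"
        unfolding norm_mult by (rule mult_left_mono) simp
      also have "\<dots> \<le> norm ((norm a * C) * (1 / (sqrt x * (1 + x))))"
        using abs_ge_self[of "norm a * (C / (sqrt x * (1 + x)))"] by simp
      finally show "norm (a * f (a * of_real x)) \<le> norm ((norm a * C) * (1 / (sqrt x * (1 + x))))" .
    qed
  qed
  have b: "norm (f (of_real x)) \<le> C / (sqrt x * (1 + x))" "norm (f (\<zeta> * of_real x)) \<le> C / (sqrt x * (1 + x))" if "x > 0" for x
    using bound[of x 0] bound[of x 1] that by (auto simp: mult.commute)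
  show i1: "set_integrable lborel {0<..} (\<lambda>x. f (of_real x))"
    using int[of 1] memr b by simp
  show i2: "set_integrable lborel {0<..} (\<lambda>x. \<zeta> * f (\<zeta> * of_real x))"
    using int[of \<zeta>] memr b by simp
  obtain F where F: "\<And>z. z \<in> S \<Longrightarrow> (F has_field_derivative f z) (at z within S)"
    using holomorphic_convex_primitive'[OF S(2,1) holo] by blast
  define h where "h = (\<lambda>x::real. f (of_real x) - \<zeta> * f (\<zeta> * of_real x))"
  define G where "G = (\<lambda>x::real. F (of_real x) - F (\<zeta> * of_real x))"
  have derG: "(G has_vector_derivative h x) (at x)" if "x > 0" for x
  proof -
    have D: "(F has_field_derivative f z) (at z)" if "z \<in> S" for z
      using F[OF that] at_within_open[OF that S(1)] by simp
    have chain: "((\<lambda>x. F (a * of_real x)) has_vector_derivative a * f (a * of_real x)) (at x)"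
      if "a * of_real x \<in> S" for a
    proof -
      have "((\<lambda>x. a * complex_of_real x) has_vector_derivative a * of_real 1) (at x)"
        by (intro has_vector_derivative_mult_right has_vector_derivative_of_real DERIV_ident)
      from field_vector_diff_chain_at[OF this D[OF that]] show ?thesis by (simp add: o_def)
    qed
    have "((\<lambda>x. F (of_real x)) has_vector_derivative f (of_real x)) (at x)"
      using chain[of 1] memr(1)[OF that] by simp
    moreover have "((\<lambda>x. F (\<zeta> * of_real x)) has_vector_derivative \<zeta> * f (\<zeta> * of_real x)) (at x)"
      using memr(2)[OF that] by (rule chain)
    ultimately show ?thesis
      unfolding G_def h_def by (auto intro!: derivative_eq_intros)
  qed
  have conth: "continuous_on {0<..} h"
    unfolding h_def by (intro continuous_intros continuous_on_compose2[OF contf]) (use memr in auto)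
  have Gb: "norm (G r) \<le> norm (1 - \<zeta>) * \<bar>C\<bar> * (r / (sqrt r * (1 + r)))" if r: "r > 0" for r
  proof -
    let ?seg = "closed_segment (complex_of_real r) (\<zeta> * of_real r)"
    have seg: "\<exists>l. 0 \<le> l \<and> l \<le> 1 \<and> z = of_real r * (of_real (1 - l) + of_real l * \<zeta>)" if "z \<in> ?seg" for z
      using that by (auto simp: in_segment scaleR_conv_of_real algebra_simps)
    have sub: "?seg \<subseteq> S" using seg mem[OF r] by blast
    have "norm (F (of_real r) - F (\<zeta> * of_real r)) \<le> \<bar>C\<bar> / (sqrt r * (1 + r)) * norm (of_real r - \<zeta> * of_real r)"
    proof (rule field_differentiable_bound)
      show "convex ?seg" by simp
      show "(F has_field_derivative f z) (at z within ?seg)" if "z \<in> ?seg" for z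
        using F[of z] sub that by (meson DERIV_subset subsetD)
      show "norm (f z) \<le> \<bar>C\<bar> / (sqrt r * (1 + r))" if z: "z \<in> ?seg" for z
      proof -
        obtain l where "0 \<le> l" "l \<le> 1" "z = of_real r * (of_real (1 - l) + of_real l * \<zeta>)" using seg[OF z] by blast
        then have "norm (f z) \<le> C / (sqrt r * (1 + r))" using bound[OF r] by simp
        also have "\<dots> \<le> \<bar>C\<bar> / (sqrt r * (1 + r))" using r by (intro divide_right_mono) auto
        finally show ?thesis .
      qed
    qed auto
    also have "complex_of_real r - \<zeta> * of_real r = (1 - \<zeta>) * of_real r" by (simp add: algebra_simps)
    also have "norm \<dots> = norm (1 - \<zeta>) * r" using r by (simp add: norm_mult)
    finally show ?thesis by (simp add: G_def mult_ac)
  qed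
  define K where "K = norm (1 - \<zeta>) * \<bar>C\<bar>"
  have lims: "((\<lambda>r::real. r / (sqrt r * (1 + r))) \<longlongrightarrow> 0) at_top" "((\<lambda>r::real. r / (sqrt r * (1 + r))) \<longlongrightarrow> 0) (at_right 0)"
    by real_asymp+
  have top: "filterlim (\<lambda>n. real (Suc n)) at_top sequentially"
    by real_asymp
  have bot: "filterlim (\<lambda>n. 1 / real (Suc n)) (at_right 0) sequentially"
    by real_asymp
  have Glim: "(\<lambda>n. G (real (Suc n))) \<longlonglongrightarrow> 0" "(\<lambda>n. G (1 / real (Suc n))) \<longlonglongrightarrow> 0"
  proof -
    have *: "(\<lambda>n. G (t n)) \<longlonglongrightarrow> 0"
      if "\<And>n. t n > 0" "(\<lambda>n. t n / (sqrt (t n) * (1 + t n))) \<longlonglongrightarrow> 0" for t :: "nat \<Rightarrow> real"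
    proof (rule Lim_null_comparison)
      show "\<forall>\<^sub>F n in sequentially. norm (G (t n)) \<le> K * (t n / (sqrt (t n) * (1 + t n)))"
        using Gb[OF that(1)] by (simp add: K_def)
      show "(\<lambda>n. K * (t n / (sqrt (t n) * (1 + t n)))) \<longlonglongrightarrow> 0"
        using tendsto_mult_right_zero[OF that(2)] .
    qed
    show "(\<lambda>n. G (real (Suc n))) \<longlonglongrightarrow> 0"
      by (rule *) (use filterlim_compose[OF lims(1) top] in simp_all)
    show "(\<lambda>n. G (1 / real (Suc n))) \<longlonglongrightarrow> 0"
      by (rule *[OF _ filterlim_compose[OF lims(2) bot]]) simp
  qed
  let ?I = "\<lambda>n. {1 / real (Suc n)..real (Suc n)}"
  have Ipos: "x > 0" if "x \<in> ?I n" for x n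
    using that less_le_trans[of 0 "1 / real (Suc n)" x] by simp
  have FTC: "(\<integral>x. indicator (?I n) x *\<^sub>R h x \<partial>lborel) = G (real (Suc n)) - G (1 / real (Suc n))" for n
  proof (rule integral_FTC_Icc)
    show "1 / real (Suc n) \<le> real (Suc n)" by (simp add: field_simps)
    show "(G has_vector_derivative h x) (at x within ?I n)" if "1 / real (Suc n) \<le> x" "x \<le> real (Suc n)" for x
    proof -
      have "x > 0" using Ipos that by simp
      then show ?thesis by (rule has_vector_derivative_at_within[OF derG])
    qed
    have "?I n \<subseteq> {0<..}" using Ipos by blast
    then show "continuous_on (?I n) h" by (rule continuous_on_subset[OF conth])
  qed
  have ih: "set_integrable lborel {0<..} h"
    unfolding h_def using i1 i2 by (rule set_integral_diff(1))
  have "(\<lambda>n. (\<integral>x. indicator (?I n) x *\<^sub>R h x \<partial>lborel)) \<longlonglongrightarrow> (\<integral>x. indicator {0<..} x *\<^sub>R h x \<partial>lborel)"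
  proof (rule integral_dominated_convergence[where w = "\<lambda>x. norm (indicator {0<..} x *\<^sub>R h x)"])
    show meas: "(\<lambda>x. indicator {0<..} x *\<^sub>R h x) \<in> borel_measurable lborel"
      using ih unfolding set_integrable_def by (rule borel_measurable_integrable)
    show "integrable lborel (\<lambda>x. norm (indicator {0<..} x *\<^sub>R h x))"
      using ih unfolding set_integrable_def by (rule integrable_norm)
    have I: "indicator (?I n) x *\<^sub>R h x = indicator (?I n) x *\<^sub>R (indicator {0<..} x *\<^sub>R h x)" for n x
      using Ipos[of x n] by (cases "x \<in> ?I n") (simp_all add: indicator_def)
    show "(\<lambda>x. indicator (?I n) x *\<^sub>R h x) \<in> borel_measurable lborel" for n
      unfolding I using meas by measurable
    show "AE x in lborel. norm (indicator (?I n) x *\<^sub>R h x) \<le> norm (indicator {0<..} x *\<^sub>R h x)" for n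
      unfolding I by (auto simp: indicator_def)
    show "AE x in lborel. (\<lambda>n. indicator (?I n) x *\<^sub>R h x) \<longlonglongrightarrow> indicator {0<..} x *\<^sub>R h x"
    proof (intro AE_I2)
      fix x :: real
      show "(\<lambda>n. indicator (?I n) x *\<^sub>R h x) \<longlonglongrightarrow> indicator {0<..} x *\<^sub>R h x"
      proof (cases "x > 0")
        case True
        have "eventually (\<lambda>n. 1 / real (Suc n) < x) sequentially"
          using order_tendstoD(2)[OF _ True, of "\<lambda>n. 1 / real (Suc n)" sequentially] LIMSEQ_inverse_real_of_nat
          by (simp add: inverse_eq_divide)
        moreover have "eventually (\<lambda>n. x \<le> real (Suc n)) sequentially"
          using filterlim_at_top[THEN iffD1, OF top] by blast
        ultimately have "eventually (\<lambda>n. indicator (?I n) x *\<^sub>R h x = indicator {0<..} x *\<^sub>R h x) sequentially"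
          by eventually_elim (use True in \<open>auto simp: indicator_def\<close>)
        then show ?thesis by (rule tendsto_eventually)
      next
        case False
        then show ?thesis unfolding I by simp
      qed
    qed
  qed
  moreover have "(\<lambda>n. (\<integral>x. indicator (?I n) x *\<^sub>R h x \<partial>lborel)) \<longlonglongrightarrow> 0"
    unfolding FTC using tendsto_diff[OF Glim] by simp
  ultimately have "(\<integral>x. indicator {0<..} x *\<^sub>R h x \<partial>lborel) = 0"
    using LIMSEQ_unique by blast
  then have "(LINT x:{0<..}|lborel. h x) = 0" by (simp add: set_lebesgue_integral_def)
  then show "(LINT x:{0<..}|lborel. f (of_real x)) = (LINT x:{0<..}|lborel. \<zeta> * f (\<zeta> * of_real x))"
    unfolding h_def by (subst (asm) set_integral_diff(2)[OF i1 i2]) simp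
qed

lemma norm_csqrt_product_le:
  assumes "0 < a'" "a' \<le> norm a" "0 < b'" "b' \<le> norm b" "0 < c'" "c' \<le> norm c"
  shows "norm (1 / (csqrt a * csqrt b * csqrt c)) \<le> 1 / (sqrt a' * sqrt b' * sqrt c')"
proof -
  have "sqrt a' * sqrt b' * sqrt c' \<le> sqrt (norm a) * sqrt (norm b) * sqrt (norm c)"
    using assms by (intro mult_mono) auto
  moreover have "0 < sqrt a' * sqrt b' * sqrt c'" using assms by simp
  ultimately show ?thesis
    by (simp add: norm_divide norm_mult del: csqrt.simps) (rule divide_left_mono; auto intro!: mult_pos_pos dest: less_le_trans)
qed

lemma norm_csqrt_pair_le:
  assumes "0 < \<delta>" "\<delta> \<le> norm a" "\<delta> \<le> norm b"
  shows "norm (1 / (csqrt a * csqrt b)) \<le> 1 / \<delta>"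
  using norm_csqrt_product_le[of 1 1 \<delta> a \<delta> b] assms by (simp del: csqrt.simps)

lemma open_half_plane: "open {z. 0 < Re (a + b * z)}"
  by (intro open_Collect_less continuous_intros)

lemma convex_half_plane: "convex {z. 0 < Re (a + b * z)}"
proof (rule convexI)
  fix x y :: complex and s t :: real
  assume xy: "x \<in> {z. 0 < Re (a + b * z)}" "y \<in> {z. 0 < Re (a + b * z)}" and st: "0 \<le> s" "0 \<le> t" "s + t = 1"
  have "Re (a + b * (s *\<^sub>R x + t *\<^sub>R y)) = (s + t) * Re a + s * Re (b * x) + t * Re (b * y)"
    unfolding st(3) by (simp add: algebra_simps)
  also have "\<dots> = s * Re (a + b * x) + t * Re (a + b * y)" by (simp add: algebra_simps)
  also have "\<dots> > 0"
  proof (cases "s = 0")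
    case True
    then show ?thesis using xy st by simp
  next
    case False
    then have "s * Re (a + b * x) > 0" "t * Re (a + b * y) \<ge> 0" using xy st by auto
    then show ?thesis by linarith
  qed
  finally show "s *\<^sub>R x + t *\<^sub>R y \<in> {z. 0 < Re (a + b * z)}" by simp
qed

text \<open>On a chord from \<open>r\<close> to \<open>\<zeta> * r\<close> the value is a combination of \<open>A\<close>, \<open>B\<close> and \<open>B * \<zeta>\<close> with nonnegative
weights of total size \<open>1 + r\<close>.\<close>

lemma affine_half_plane_bound:
  fixes e A B \<zeta> :: complex
  assumes "m \<le> Re (e * A)" "m \<le> Re (e * B)" "m \<le> Re (e * B * \<zeta>)" "r \<ge> 0" "0 \<le> l" "l \<le> 1"
  shows "m * (1 + r) \<le> Re (e * (A + B * (of_real r * (of_real (1 - l) + of_real l * \<zeta>))))"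
proof -
  have "e * (A + B * (of_real r * (of_real (1 - l) + of_real l * \<zeta>)))
      = e * A + of_real r * (of_real (1 - l) * (e * B) + of_real l * (e * B * \<zeta>))"
    by (simp add: algebra_simps)
  then have "Re (e * (A + B * (of_real r * (of_real (1 - l) + of_real l * \<zeta>))))
      = Re (e * A) + r * ((1 - l) * Re (e * B) + l * Re (e * B * \<zeta>))"
    by (simp only: plus_complex.sel Re_complex_of_real Im_complex_of_real times_complex.sel) simp
  moreover have "m \<le> (1 - l) * Re (e * B) + l * Re (e * B * \<zeta>)"
  proof -
    have "(1 - l) * m + l * m \<le> (1 - l) * Re (e * B) + l * Re (e * B * \<zeta>)"
      using assms by (intro add_mono mult_left_mono) auto
    then show ?thesis by (simp add: algebra_simps)
  qed
  then have "r * m \<le> r * ((1 - l) * Re (e * B) + l * Re (e * B * \<zeta>))"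
    using assms by (intro mult_left_mono) auto
  ultimately show ?thesis using assms(1) by (simp add: algebra_simps)
qed

text \<open>The contour is turned from \<open>y\<close> to \<open>u\<^sup>2 * y\<close>. Along the chords the variable itself stays in the half-plane
given by \<open>cnj u\<close>, and the two affine factors stay in the one given by \<open>e\<close>. The Jacobian \<open>u\<^sup>2\<close> loses one
factor \<open>u\<close> to the root of \<open>u\<^sup>2 * y\<close>, which is \<open>u * sqrt y\<close> because \<open>Re u > 0\<close>.\<close>

lemma ray_rotation_quadratic:
  fixes e u A B C D :: complex
  assumes e: "Re e > 0" and u: "Re u > 0"
    and AB: "Re (e * A) > 0" "Re (e * B) > 0" "Re (e * B * u\<^sup>2) > 0"
    and CD: "Re (e * C) > 0" "Re (e * D) > 0" "Re (e * D * u\<^sup>2) > 0"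
  shows "(LINT y:{0<..}|lborel. 1 / (of_real (sqrt y) * csqrt (A + B * of_real y) * csqrt (C + D * of_real y)))
       = u * (LINT y:{0<..}|lborel. 1 / (of_real (sqrt y) * csqrt (A + B * u\<^sup>2 * of_real y) * csqrt (C + D * u\<^sup>2 * of_real y)))"
proof -
  have e0: "e \<noteq> 0" and u0: "u \<noteq> 0" "cnj u \<noteq> 0" using e u by auto
  define f where "f = (\<lambda>Y. 1 / (csqrt Y * csqrt (A + B * Y) * csqrt (C + D * Y)))"
  define S where "S = {Y. 0 < Re (0 + cnj u * Y)} \<inter> {Y. 0 < Re (e * A + e * B * Y)} \<inter> {Y. 0 < Re (e * C + e * D * Y)}"
  have S_iff: "Y \<in> S \<longleftrightarrow> 0 < Re (cnj u * Y) \<and> 0 < Re (e * (A + B * Y)) \<and> 0 < Re (e * (C + D * Y))" for Y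
    by (simp only: S_def Int_iff mem_Collect_eq distrib_left mult.assoc add_0 conj_assoc)
  have S: "open S" "convex S"
    unfolding S_def by (intro open_Int open_half_plane convex_Int convex_half_plane)+
  define M where "M = {Re (cnj u), Re (cnj u * u\<^sup>2), Re (e * A), Re (e * B), Re (e * B * u\<^sup>2), Re (e * C), Re (e * D), Re (e * D * u\<^sup>2)}"
  define m where "m = Min M"
  have "finite M" by (simp add: M_def)
  then have mM: "m \<le> x" if "x \<in> M" for x unfolding m_def using that by (rule Min_le)
  have cu: "cnj u * u\<^sup>2 = of_real ((cmod u)\<^sup>2) * u"
    unfolding complex_norm_square by (simp add: power2_eq_square mult_ac)
  have m: "m > 0" "m \<le> Re (cnj u)" "m \<le> Re (cnj u * u\<^sup>2)" "m \<le> Re (e * A)" "m \<le> Re (e * B)" "m \<le> Re (e * B * u\<^sup>2)"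
      "m \<le> Re (e * C)" "m \<le> Re (e * D)" "m \<le> Re (e * D * u\<^sup>2)"
  proof -
    have "Re (cnj u * u\<^sup>2) > 0" unfolding cu using u u0 by (simp add: zero_less_mult_iff)
    then have "\<forall>x\<in>M. x > 0" unfolding M_def using u AB CD by simp
    moreover have "m \<in> M" unfolding m_def using \<open>finite M\<close> by (rule Min_in) (simp add: M_def)
    ultimately show "m > 0" by blast
  qed (rule mM; simp only: M_def insert_iff simp_thms)+
  let ?z = "\<lambda>r l. complex_of_real r * (of_real (1 - l) + of_real l * u\<^sup>2)"
  have lo: "m * r \<le> Re (cnj u * ?z r l)" "m * (1 + r) \<le> Re (e * (A + B * ?z r l))" "m * (1 + r) \<le> Re (e * (C + D * ?z r l))"
    if "r > 0" "0 \<le> l" "l \<le> 1" for r l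
  proof -
    \<comment> \<open>The constant \<open>m / Re u\<close> contributes exactly \<open>m\<close>, so that a bound for the variable itself is left.\<close>
    have "m * (1 + r) \<le> Re (cnj u * (of_real (m / Re u) + 1 * ?z r l))"
      by (rule affine_half_plane_bound) (use m u that in auto)
    also have "cnj u * (of_real (m / Re u) + 1 * ?z r l) = of_real (m / Re u) * cnj u + cnj u * ?z r l"
      by (simp add: algebra_simps)
    also have "Re \<dots> = m + Re (cnj u * ?z r l)"
      using u by (simp only: plus_complex.sel times_complex.sel Re_complex_of_real Im_complex_of_real complex_cnj) simp
    finally show "m * r \<le> Re (cnj u * ?z r l)" by (simp add: algebra_simps)
  qed (rule affine_half_plane_bound; use that m in simp)+
  have memS: "?z r l \<in> S" if "r > 0" "0 \<le> l" "l \<le> 1" for r l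
  proof -
    have "0 < m * r" "0 < m * (1 + r)" using m that by auto
    then have "0 < Re (cnj u * ?z r l)" "0 < Re (e * (A + B * ?z r l))" "0 < Re (e * (C + D * ?z r l))"
      using lo[OF that] by linarith+
    then show ?thesis unfolding S_iff by blast
  qed
  have Sn: "Y \<notin> \<real>\<^sub>\<le>\<^sub>0" "A + B * Y \<notin> \<real>\<^sub>\<le>\<^sub>0" "C + D * Y \<notin> \<real>\<^sub>\<le>\<^sub>0" if "Y \<in> S" for Y
    using that[unfolded S_iff] u half_plane_not_nonpos[of "cnj u" Y] half_plane_not_nonpos[OF e, of "A + B * Y"]
      half_plane_not_nonpos[OF e, of "C + D * Y"] by (simp_all only: cnj.sel simp_thms)
  have S0: "Y \<noteq> 0" "A + B * Y \<noteq> 0" "C + D * Y \<noteq> 0" if "Y \<in> S" for Y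
    using Sn[OF that] by auto
  have holo: "f holomorphic_on S"
    unfolding f_def by (intro holomorphic_intros) (simp_all add: S0 Sn del: csqrt.simps)
  define K where "K = 1 / (sqrt (m / norm (cnj u)) * sqrt (m / norm e) * sqrt (m / norm e))"
  have bound: "norm (f (?z r l)) \<le> K / (sqrt r * (1 + r))" if r: "r > 0" and l: "0 \<le> l" "l \<le> 1" for r l
  proof -
    have "norm (f (?z r l)) \<le> 1 / (sqrt (m * r / norm (cnj u)) * sqrt (m * (1 + r) / norm e) * sqrt (m * (1 + r) / norm e))"
      unfolding f_def using m r e0 u0 lo[OF r l]
      by (intro norm_csqrt_product_le half_plane_norm divide_pos_pos mult_pos_pos) auto
    also have "\<dots> = K / (sqrt r * (1 + r))"
    proof -
      have "sqrt (m * r / norm (cnj u)) = sqrt (m / norm (cnj u)) * sqrt r" "sqrt (m * (1 + r) / norm e) = sqrt (m / norm e) * sqrt (1 + r)"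
        by (simp_all add: real_sqrt_mult real_sqrt_divide)
      moreover have "sqrt (1 + r) * sqrt (1 + r) = 1 + r" using r by simp
      ultimately show ?thesis unfolding K_def by (simp add: mult_ac)
    qed
    finally show ?thesis .
  qed
  have "(LINT y:{0<..}|lborel. f (of_real y)) = (LINT y:{0<..}|lborel. u\<^sup>2 * f (u\<^sup>2 * of_real y))"
    by (rule ray_rotation(3)[OF S holo memS bound])
  also have "(LINT y:{0<..}|lborel. f (of_real y))
     = (LINT y:{0<..}|lborel. 1 / (of_real (sqrt y) * csqrt (A + B * of_real y) * csqrt (C + D * of_real y)))"
    by (intro set_lebesgue_integral_cong) (auto simp: f_def simp del: csqrt.simps)
  also have "(LINT y:{0<..}|lborel. u\<^sup>2 * f (u\<^sup>2 * of_real y))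
     = (LINT y:{0<..}|lborel. u * (1 / (of_real (sqrt y) * csqrt (A + B * u\<^sup>2 * of_real y) * csqrt (C + D * u\<^sup>2 * of_real y))))"
  proof (intro set_lebesgue_integral_cong allI impI)
    fix y :: real assume y: "y \<in> {0<..}"
    have "csqrt (u\<^sup>2 * of_real y) = u * of_real (sqrt y)"
      using csqrt_scale[of y "u\<^sup>2"] csqrt_square[of u] u y by (simp add: mult.commute)
    then show "u\<^sup>2 * f (u\<^sup>2 * of_real y) = u * (1 / (of_real (sqrt y) * csqrt (A + B * u\<^sup>2 * of_real y) * csqrt (C + D * u\<^sup>2 * of_real y)))"
      unfolding f_def using u0 by (simp add: power2_eq_square mult.assoc del: csqrt.simps)
  qed auto
  also have "\<dots> = u * (LINT y:{0<..}|lborel. 1 / (of_real (sqrt y) * csqrt (A + B * u\<^sup>2 * of_real y) * csqrt (C + D * u\<^sup>2 * of_real y)))"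
    by (rule set_integral_mult_right)
  finally show ?thesis .
qed

section \<open>Rotation of both variables of the double integral\<close>

definition bil :: "real \<Rightarrow> real \<Rightarrow> real \<Rightarrow> real \<Rightarrow> complex \<Rightarrow> complex \<Rightarrow> complex" where
  "bil a b c d X Y = of_real a + of_real b * X + of_real c * Y + of_real d * X * Y"

lemma Re_of_real_mult: "Re (of_real r * z) = r * Re z"
  by simp

text \<open>A bilinear form with positive coefficients stays in the half-plane that contains the four vertices
\<open>e\<close>, \<open>e * X\<close>, \<open>e * Y\<close>, \<open>e * X * Y\<close>.\<close>

lemma bil_half_plane:
  fixes e X Y :: complex
  assumes k: "0 \<le> k" "k \<le> a" "k \<le> b" "k \<le> c" "k \<le> d"
    and m: "0 \<le> m" "m \<le> Re e" "m \<le> Re (e * X)" "m \<le> Re (e * Y)" "m \<le> Re (e * X * Y)"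
    and xy: "0 \<le> x" "0 \<le> y"
  shows "k * m * ((1 + x) * (1 + y)) \<le> Re (e * bil a b c d (X * of_real x) (Y * of_real y))"
proof -
  have "e * bil a b c d (X * of_real x) (Y * of_real y)
      = of_real a * e + of_real (b * x) * (e * X) + of_real (c * y) * (e * Y) + of_real (d * (x * y)) * (e * X * Y)"
    by (simp add: bil_def algebra_simps)
  then have "Re (e * bil a b c d (X * of_real x) (Y * of_real y))
      = a * Re e + (b * x) * Re (e * X) + (c * y) * Re (e * Y) + (d * (x * y)) * Re (e * X * Y)"
    by (simp only: plus_complex.sel Re_of_real_mult)
  moreover have "k * m \<le> a * Re e" "(k * x) * m \<le> (b * x) * Re (e * X)" "(k * y) * m \<le> (c * y) * Re (e * Y)"
    "(k * (x * y)) * m \<le> (d * (x * y)) * Re (e * X * Y)"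
    using assms by (auto intro!: mult_mono)
  moreover have "k * m * ((1 + x) * (1 + y)) = k * m + (k * x) * m + (k * y) * m + (k * (x * y)) * m"
    by (simp add: algebra_simps)
  ultimately show ?thesis by linarith
qed

lemma integrable_product_weight:
  fixes f :: "real \<Rightarrow> real \<Rightarrow> 'a::{banach, second_countable_topology}" and w :: "real \<Rightarrow> real"
  assumes w: "integrable lborel w"
    and f: "(\<lambda>(x, y). f x y) \<in> borel_measurable (lborel \<Otimes>\<^sub>M lborel)"
    and bound: "\<And>x y. norm (f x y) \<le> C * (w x * w y)"
  shows "integrable (lborel \<Otimes>\<^sub>M lborel) (\<lambda>(x, y). f x y)"
proof (rule Bochner_Integration.integrable_bound)
  have [measurable]: "w \<in> borel_measurable borel" using borel_measurable_integrable[OF w] by simp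
  show "integrable (lborel \<Otimes>\<^sub>M lborel) (\<lambda>z. C * (w (fst z) * w (snd z)))"
  proof (rule lborel_pair.Fubini_integrable)
    show "integrable lborel (\<lambda>x. \<integral>y. norm (C * (w (fst (x, y)) * w (snd (x, y)))) \<partial>lborel)"
      using w by (simp add: abs_mult mult.assoc)
    show "AE x in lborel. integrable lborel (\<lambda>y. C * (w (fst (x, y)) * w (snd (x, y))))"
      using w by simp
  qed simp
  show "AE z in lborel \<Otimes>\<^sub>M lborel. norm (case z of (x, y) \<Rightarrow> f x y) \<le> norm (C * (w (fst z) * w (snd z)))"
  proof (intro AE_I2)
    fix z
    show "norm (case z of (x, y) \<Rightarrow> f x y) \<le> norm (C * (w (fst z) * w (snd z)))"
      using bound[of "fst z" "snd z"] abs_ge_self[of "C * (w (fst z) * w (snd z))"]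
      by (simp add: case_prod_unfold)
  qed
qed (rule f)

definition line_weight :: "real \<Rightarrow> real" where
  "line_weight x = indicator {0<..} x * (1 / (sqrt x * (1 + x)))"

lemma line_weight_measurable [measurable]: "line_weight \<in> borel_measurable borel"
  by (simp add: line_weight_def[abs_def])

lemma integrable_line_weight: "integrable lborel line_weight"
  using set_integrable_arcsine_line unfolding set_integrable_def line_weight_def[abs_def] by simp

text \<open>\<open>Q (u1\<^sup>2) (u2\<^sup>2)\<close> is the integral of the quadrant type with the variables moved to the rays through
\<open>u1\<^sup>2\<close> and \<open>u2\<^sup>2\<close>. The direction \<open>e\<close> serves for all intermediate positions of the contours. The
coefficients \<open>c3\<close> and \<open>c4\<close> are exchanged in comparison with \<open>borchardt_integral\<close>, since this is the order
in which they come out of the Euler integral.\<close>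

locale rotated_forms =
  fixes c1 c2 c3 c4 :: real and e u1 u2 :: complex
  assumes c: "c1 > 0" "c2 > 0" "c3 > 0" "c4 > 0"
    and u: "Re u1 > 0" "Re u2 > 0"
    and e: "Re e > 0" "Re (e * u1\<^sup>2) > 0" "Re (e * u2\<^sup>2) > 0" "Re (e * u1\<^sup>2 * u2\<^sup>2) > 0"
begin

definition \<phi> :: "complex \<Rightarrow> complex \<Rightarrow> real \<Rightarrow> real \<Rightarrow> complex" where
  "\<phi> X Y x y = 1 / (of_real (sqrt x) * of_real (sqrt y) *
      csqrt (bil c2 c4 c1 c3 (X * of_real x) (Y * of_real y)) * csqrt (bil c3 c1 c4 c2 (X * of_real x) (Y * of_real y)))"

definition Q :: "complex \<Rightarrow> complex \<Rightarrow> complex" where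
  "Q X Y = (LINT x:{0<..}|lborel. (LINT y:{0<..}|lborel. \<phi> X Y x y))"

lemma \<phi>_measurable [measurable]: "(\<lambda>(x, y). \<phi> X Y x y) \<in> borel_measurable (borel \<Otimes>\<^sub>M borel)"
  unfolding \<phi>_def bil_def by measurable

lemma bil_norm_bound:
  assumes XY: "Re (e * X) > 0" "Re (e * Y) > 0" "Re (e * X * Y) > 0"
  obtains \<delta> where "\<delta> > 0"
    "\<And>x y. x \<ge> 0 \<Longrightarrow> y \<ge> 0 \<Longrightarrow> \<delta> * ((1 + x) * (1 + y)) \<le> norm (bil c2 c4 c1 c3 (X * of_real x) (Y * of_real y))"
    "\<And>x y. x \<ge> 0 \<Longrightarrow> y \<ge> 0 \<Longrightarrow> \<delta> * ((1 + x) * (1 + y)) \<le> norm (bil c3 c1 c4 c2 (X * of_real x) (Y * of_real y))"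
proof -
  define k where "k = min (min c1 c2) (min c3 c4)"
  have k: "k > 0" "k \<le> c1" "k \<le> c2" "k \<le> c3" "k \<le> c4" using c by (auto simp: k_def)
  define m where "m = min (min (Re e) (Re (e * X))) (min (Re (e * Y)) (Re (e * X * Y)))"
  have m: "m > 0" using e XY unfolding m_def by (simp only: min_less_iff_conj)
  have m': "m \<le> Re e" "m \<le> Re (e * X)" "m \<le> Re (e * Y)" "m \<le> Re (e * X * Y)"
    unfolding m_def by (simp_all only: min_le_iff_disj order_refl simp_thms)
  have e0: "e \<noteq> 0" using e by auto
  show ?thesis
  proof (rule that)
    show "k * m / norm e > 0" using k m e0 by simp
    fix x y :: real assume "x \<ge> 0" "y \<ge> 0"
    then have "k * m * ((1 + x) * (1 + y)) \<le> Re (e * bil c2 c4 c1 c3 (X * of_real x) (Y * of_real y))"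
      "k * m * ((1 + x) * (1 + y)) \<le> Re (e * bil c3 c1 c4 c2 (X * of_real x) (Y * of_real y))"
      using k m m' by (intro bil_half_plane; simp)+
    from this[THEN half_plane_norm[OF _ e0]]
    show "k * m / norm e * ((1 + x) * (1 + y)) \<le> norm (bil c2 c4 c1 c3 (X * of_real x) (Y * of_real y))"
      "k * m / norm e * ((1 + x) * (1 + y)) \<le> norm (bil c3 c1 c4 c2 (X * of_real x) (Y * of_real y))"
      by simp_all
  qed
qed

lemma \<phi>_integrable:
  assumes XY: "Re (e * X) > 0" "Re (e * Y) > 0" "Re (e * X * Y) > 0"
  shows "integrable (lborel \<Otimes>\<^sub>M lborel) (\<lambda>(x, y). indicat_real {0<..} x *\<^sub>R (indicat_real {0<..} y *\<^sub>R \<phi> X Y x y))"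
proof -
  obtain \<delta> where d: "\<delta> > 0"
    "\<And>x y. x \<ge> 0 \<Longrightarrow> y \<ge> 0 \<Longrightarrow> \<delta> * ((1 + x) * (1 + y)) \<le> norm (bil c2 c4 c1 c3 (X * of_real x) (Y * of_real y))"
    "\<And>x y. x \<ge> 0 \<Longrightarrow> y \<ge> 0 \<Longrightarrow> \<delta> * ((1 + x) * (1 + y)) \<le> norm (bil c3 c1 c4 c2 (X * of_real x) (Y * of_real y))"
    using bil_norm_bound[OF assms] by blast
  show ?thesis
  proof (rule integrable_product_weight[OF integrable_line_weight])
    show "(\<lambda>(x, y). indicat_real {0<..} x *\<^sub>R (indicat_real {0<..} y *\<^sub>R \<phi> X Y x y)) \<in> borel_measurable (lborel \<Otimes>\<^sub>M lborel)"
      by measurable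
    fix x y :: real
    show "norm (indicat_real {0<..} x *\<^sub>R (indicat_real {0<..} y *\<^sub>R \<phi> X Y x y)) \<le> 1 / \<delta> * (line_weight x * line_weight y)"
    proof (cases "x > 0 \<and> y > 0")
      case True
      then have xy: "x > 0" "y > 0" by auto
      let ?t = "\<delta> * ((1 + x) * (1 + y))"
      have "norm (\<phi> X Y x y) = 1 / (sqrt x * sqrt y) * norm (1 / (csqrt 1 *
          csqrt (bil c2 c4 c1 c3 (X * of_real x) (Y * of_real y)) * csqrt (bil c3 c1 c4 c2 (X * of_real x) (Y * of_real y))))"
        unfolding \<phi>_def using xy by (simp add: norm_mult norm_divide del: csqrt.simps)
      also have "\<dots> \<le> 1 / (sqrt x * sqrt y) * (1 / (sqrt 1 * sqrt ?t * sqrt ?t))"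
        using xy d by (intro mult_left_mono norm_csqrt_product_le) auto
      also have "\<dots> = 1 / \<delta> * (line_weight x * line_weight y)"
        using xy d(1) by (simp add: line_weight_def)
      finally show ?thesis using xy by simp
    qed (auto simp: line_weight_def)
  qed
qed

lemma Q_swap:
  assumes "Re (e * X) > 0" "Re (e * Y) > 0" "Re (e * X * Y) > 0"
  shows "Q X Y = (LINT y:{0<..}|lborel. (LINT x:{0<..}|lborel. \<phi> X Y x y))"
proof -
  have "Q X Y = (\<integral>x. (\<integral>y. indicat_real {0<..} x *\<^sub>R (indicat_real {0<..} y *\<^sub>R \<phi> X Y x y) \<partial>lborel) \<partial>lborel)"
    by (simp only: Q_def set_lebesgue_integral_def integral_scaleR_right)
  also have "\<dots> = (\<integral>y. (\<integral>x. indicat_real {0<..} x *\<^sub>R (indicat_real {0<..} y *\<^sub>R \<phi> X Y x y) \<partial>lborel) \<partial>lborel)"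
    using lborel_pair.Fubini_integral[OF \<phi>_integrable[OF assms]] by simp
  also have "\<dots> = (\<integral>y. (\<integral>x. indicat_real {0<..} y *\<^sub>R (indicat_real {0<..} x *\<^sub>R \<phi> X Y x y) \<partial>lborel) \<partial>lborel)"
    by (subst scaleR_left_commute) (rule refl)
  also have "\<dots> = (LINT y:{0<..}|lborel. (LINT x:{0<..}|lborel. \<phi> X Y x y))"
    by (simp only: set_lebesgue_integral_def integral_scaleR_right)
  finally show ?thesis .
qed

text \<open>First \<open>x\<close> is rotated for fixed positive \<open>y\<close>, then \<open>y\<close> for fixed \<open>x\<close> on the positive half-line, with the
first contour already in its new position; Fubini's theorem brings the variable to be rotated inside.\<close>

theorem Q_rotation: "Q 1 1 = u1 * u2 * Q (u1\<^sup>2) (u2\<^sup>2)"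
proof -
  have step1: "(LINT x:{0<..}|lborel. \<phi> 1 1 x y) = u1 * (LINT x:{0<..}|lborel. \<phi> (u1\<^sup>2) 1 x y)" if y: "y > 0" for y
  proof -
    let ?A = "of_real (c2 + c1 * y)" and ?B = "of_real (c4 + c3 * y)" and ?C = "of_real (c3 + c4 * y)" and ?D = "of_real (c1 + c2 * y)"
    have *: "\<phi> X 1 x y = 1 / of_real (sqrt y) * (1 / (of_real (sqrt x) * csqrt (?A + ?B * X * of_real x) * csqrt (?C + ?D * X * of_real x)))" for X x
      unfolding \<phi>_def bil_def by (simp add: algebra_simps del: csqrt.simps)
    have pos: "0 < c2 + c1 * y" "0 < c4 + c3 * y" "0 < c3 + c4 * y" "0 < c1 + c2 * y"
      using y c by (auto intro!: add_pos_pos)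
    have Re: "Re (e * of_real r) = r * Re e" "Re (e * of_real r * u1\<^sup>2) = r * Re (e * u1\<^sup>2)" for r :: real
      by (simp_all add: algebra_simps)
    have "(LINT x:{0<..}|lborel. 1 / (of_real (sqrt x) * csqrt (?A + ?B * of_real x) * csqrt (?C + ?D * of_real x)))
       = u1 * (LINT x:{0<..}|lborel. 1 / (of_real (sqrt x) * csqrt (?A + ?B * u1\<^sup>2 * of_real x) * csqrt (?C + ?D * u1\<^sup>2 * of_real x)))"
      by (rule ray_rotation_quadratic[OF e(1) u(1)]; unfold Re; intro mult_pos_pos pos e)
    moreover have "(LINT x:{0<..}|lborel. \<phi> X 1 x y) = 1 / of_real (sqrt y) *
      (LINT x:{0<..}|lborel. 1 / (of_real (sqrt x) * csqrt (?A + ?B * X * of_real x) * csqrt (?C + ?D * X * of_real x)))" for X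
      unfolding * by (rule set_integral_mult_right)
    ultimately show ?thesis by (simp only: mult_1_right mult.left_commute)
  qed
  have step2: "(LINT y:{0<..}|lborel. \<phi> (u1\<^sup>2) 1 x y) = u2 * (LINT y:{0<..}|lborel. \<phi> (u1\<^sup>2) (u2\<^sup>2) x y)" if x: "x > 0" for x
  proof -
    let ?A = "of_real c2 + of_real (c4 * x) * u1\<^sup>2" and ?B = "of_real c1 + of_real (c3 * x) * u1\<^sup>2"
      and ?C = "of_real c3 + of_real (c1 * x) * u1\<^sup>2" and ?D = "of_real c4 + of_real (c2 * x) * u1\<^sup>2"
    have *: "\<phi> (u1\<^sup>2) Y x y = 1 / of_real (sqrt x) * (1 / (of_real (sqrt y) * csqrt (?A + ?B * Y * of_real y) * csqrt (?C + ?D * Y * of_real y)))" for Y y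
      unfolding \<phi>_def bil_def by (simp add: algebra_simps del: csqrt.simps)
    have Re: "Re (e * (of_real a + of_real b * u1\<^sup>2)) = a * Re e + b * Re (e * u1\<^sup>2)"
      "Re (e * (of_real a + of_real b * u1\<^sup>2) * u2\<^sup>2) = a * Re (e * u2\<^sup>2) + b * Re (e * u1\<^sup>2 * u2\<^sup>2)" for a b :: real
      by (simp_all add: algebra_simps)
    have "(LINT y:{0<..}|lborel. 1 / (of_real (sqrt y) * csqrt (?A + ?B * of_real y) * csqrt (?C + ?D * of_real y)))
       = u2 * (LINT y:{0<..}|lborel. 1 / (of_real (sqrt y) * csqrt (?A + ?B * u2\<^sup>2 * of_real y) * csqrt (?C + ?D * u2\<^sup>2 * of_real y)))"
      by (rule ray_rotation_quadratic[OF e(1) u(2)]; unfold Re; intro add_pos_pos mult_pos_pos c x e)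
    moreover have "(LINT y:{0<..}|lborel. \<phi> (u1\<^sup>2) Y x y) = 1 / of_real (sqrt x) *
      (LINT y:{0<..}|lborel. 1 / (of_real (sqrt y) * csqrt (?A + ?B * Y * of_real y) * csqrt (?C + ?D * Y * of_real y)))" for Y
      unfolding * by (rule set_integral_mult_right)
    ultimately show ?thesis by (simp only: mult_1_right mult.left_commute)
  qed
  have "Q 1 1 = (LINT y:{0<..}|lborel. (LINT x:{0<..}|lborel. \<phi> 1 1 x y))"
    using e by (intro Q_swap) simp_all
  also have "\<dots> = (LINT y:{0<..}|lborel. u1 * (LINT x:{0<..}|lborel. \<phi> (u1\<^sup>2) 1 x y))"
    by (intro set_lebesgue_integral_cong) (auto simp: step1)
  also have "\<dots> = u1 * Q (u1\<^sup>2) 1"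
    using e by (subst Q_swap) (simp_all del: times_complex.sel)
  also have "Q (u1\<^sup>2) 1 = (LINT x:{0<..}|lborel. u2 * (LINT y:{0<..}|lborel. \<phi> (u1\<^sup>2) (u2\<^sup>2) x y))"
    unfolding Q_def by (intro set_lebesgue_integral_cong) (auto simp: step2)
  also have "\<dots> = u2 * Q (u1\<^sup>2) (u2\<^sup>2)" by (simp add: Q_def)
  finally show ?thesis by (simp add: mult.assoc)
qed

lemma Q_real:
  assumes v: "v \<ge> 0" and J: "borchardt_integral c1 c2 c4 c3 = ennreal v"
  shows "Q 1 1 = of_real v"
proof -
  define r where "r = (\<lambda>x y. 1 / sqrt (x * y * (c2 + c4 * x + c1 * y + c3 * x * y) * (c3 + c1 * x + c4 * y + c2 * x * y)))"
  define R where "R = (\<lambda>x y. indicat_real {0<..} x * (indicat_real {0<..} y * r x y))"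
  have \<phi>_r: "\<phi> 1 1 x y = of_real (r x y)" if "x > 0" "y > 0" for x y
  proof -
    let ?a = "c2 + c4 * x + c1 * y + c3 * x * y" and ?b = "c3 + c1 * x + c4 * y + c2 * x * y"
    have p: "?a > 0" "?b > 0" using that c by (auto intro!: add_pos_pos mult_pos_pos)
    have "bil c2 c4 c1 c3 (1 * of_real x) (1 * of_real y) = of_real ?a" "bil c3 c1 c4 c2 (1 * of_real x) (1 * of_real y) = of_real ?b"
      by (simp_all add: bil_def)
    then show ?thesis unfolding \<phi>_def r_def using p that
      by (simp add: real_sqrt_mult csqrt_of_real_nonneg del: csqrt.simps)
  qed
  have \<phi>_R: "indicat_real {0<..} x *\<^sub>R (indicat_real {0<..} y *\<^sub>R \<phi> 1 1 x y) = of_real (R x y)" for x y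
    by (auto simp: R_def \<phi>_r indicator_def scaleR_conv_of_real)
  have r0: "R x y \<ge> 0" for x y
    using c by (auto simp: R_def r_def indicator_def intro!: add_nonneg_nonneg mult_nonneg_nonneg)
  have int: "integrable (lborel \<Otimes>\<^sub>M lborel) (\<lambda>(x, y). complex_of_real (R x y))"
    using \<phi>_integrable[of 1 1] e(1) unfolding \<phi>_R by simp
  then have intR: "integrable (lborel \<Otimes>\<^sub>M lborel) (\<lambda>(x, y). R x y)"
    using integrable_Re[OF int] by (simp add: case_prod_unfold)
  have [measurable]: "(\<lambda>(x, y). R x y) \<in> borel_measurable (borel \<Otimes>\<^sub>M borel)"
    unfolding R_def r_def by measurable
  have "Q 1 1 = (\<integral>x. (\<integral>y. complex_of_real (R x y) \<partial>lborel) \<partial>lborel)"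
    by (simp only: Q_def set_lebesgue_integral_def \<phi>_R[symmetric] integral_scaleR_right)
  also have "\<dots> = of_real (\<integral>x. (\<integral>y. R x y \<partial>lborel) \<partial>lborel)" by simp
  also have "(\<integral>x. (\<integral>y. R x y \<partial>lborel) \<partial>lborel) = (\<integral>z. (case z of (x, y) \<Rightarrow> R x y) \<partial>(lborel \<Otimes>\<^sub>M lborel))"
    using lborel_pair.integral_fst[OF intR] by simp
  also have "\<dots> = enn2real (\<integral>\<^sup>+z. ennreal (case z of (x, y) \<Rightarrow> R x y) \<partial>(lborel \<Otimes>\<^sub>M lborel))"
    using r0 by (intro integral_eq_nn_integral) auto
  also have "(\<integral>\<^sup>+z. ennreal (case z of (x, y) \<Rightarrow> R x y) \<partial>(lborel \<Otimes>\<^sub>M lborel))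
     = (\<integral>\<^sup>+x. (\<integral>\<^sup>+y. ennreal (R x y) \<partial>lborel) \<partial>lborel)"
    by (subst lborel.nn_integral_fst[symmetric]) auto
  also have "\<dots> = borchardt_integral c1 c2 c4 c3"
    unfolding borchardt_integral_def
  proof (intro nn_integral_cong)
    fix x :: real
    have "(\<integral>\<^sup>+y. ennreal (R x y) \<partial>lborel) = (\<integral>\<^sup>+y\<in>{0<..}. ennreal (r x y) \<partial>lborel)" if "x > 0"
      using that by (intro nn_integral_cong) (auto simp: R_def indicator_def)
    moreover have "(\<integral>\<^sup>+y. ennreal (R x y) \<partial>lborel) = 0" if "\<not> x > 0"
      using that by (simp add: R_def)
    ultimately show "(\<integral>\<^sup>+y. ennreal (R x y) \<partial>lborel) = (\<integral>\<^sup>+y\<in>{0<..}. ennreal (1 / sqrt (x * y * (c2 + c4 * x + c1 * y + c3 * x * y) *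
        (c3 + c1 * x + c4 * y + c2 * x * y))) \<partial>lborel) * indicator {0<..} x"
      unfolding r_def by (cases "x > 0") simp_all
  qed
  also have "enn2real \<dots> = v" using v by (simp add: J)
  finally show ?thesis .
qed

end

section \<open>The Euler integral with principal roots\<close>

text \<open>The two arguments differ by a continuous function with values in the multiples of \<open>2 * pi\<close> on a connected
square, and they agree at the origin.\<close>

lemma lin_factor_arg_eq:
  assumes slit: "\<And>s. s \<in> unit_square \<Longrightarrow> lin_factor a b s \<notin> \<real>\<^sub>\<le>\<^sub>0" and s: "s \<in> unit_square"
  shows "lin_factor_arg a b s = Arg (lin_factor a b s)"
proof -
  let ?P = "\<lambda>\<theta>. continuous_on unit_square \<theta> \<and> \<theta> (0, 0) = 0 \<and>
     (\<forall>s\<in>unit_square. lin_factor a b s = of_real (cmod (lin_factor a b s)) * cis (\<theta> s))"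
  have cont: "continuous_on unit_square (lin_factor a b)"
    unfolding lin_factor_def by (intro continuous_intros)
  have "?P (\<lambda>s. Arg (lin_factor a b s))"
  proof (intro conjI ballI)
    show "continuous_on unit_square (\<lambda>s. Arg (lin_factor a b s))"
      unfolding continuous_on_eq_continuous_within
    proof
      fix x assume x: "x \<in> unit_square"
      have "continuous (at x within unit_square) (lin_factor a b)"
        using cont x by (simp add: continuous_on_eq_continuous_within)
      then show "continuous (at x within unit_square) (\<lambda>s. Arg (lin_factor a b s))"
        by (rule continuous_within_compose3[rotated]) (rule continuous_at_Arg[OF slit[OF x]])
    qed
    show "Arg (lin_factor a b (0, 0)) = 0" by (simp add: lin_factor_def)
    show "lin_factor a b s = of_real (cmod (lin_factor a b s)) * cis (Arg (lin_factor a b s))" for s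
      using rcis_cmod_Arg[of "lin_factor a b s"] by (simp add: rcis_def)
  qed
  then have P: "?P (lin_factor_arg a b)" and Q: "?P (\<lambda>s. Arg (lin_factor a b s))"
    unfolding lin_factor_arg_def by (rule someI[of ?P], assumption)
  define d where "d = (\<lambda>s. (lin_factor_arg a b s - Arg (lin_factor a b s)) / (2 * pi))"
  have dint: "d s \<in> \<int>" if s: "s \<in> unit_square" for s
  proof -
    have "lin_factor a b s \<noteq> 0" using slit[OF s] by auto
    then have "cis (lin_factor_arg a b s) = cis (Arg (lin_factor a b s))"
      using P Q s by (metis mult_left_cancel norm_eq_zero of_real_eq_0_iff)
    then have "exp (\<i> * of_real (lin_factor_arg a b s)) = exp (\<i> * of_real (Arg (lin_factor a b s)))"
      by (simp add: cis_conv_exp)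
    then obtain n :: int where "\<i> * of_real (lin_factor_arg a b s) = \<i> * of_real (Arg (lin_factor a b s)) + (of_int (2 * n) * pi) * \<i>"
      unfolding exp_eq by blast
    then have "lin_factor_arg a b s = Arg (lin_factor a b s) + of_int (2 * n) * pi"
      by (auto simp: complex_eq_iff)
    then have "d s = of_int n" by (simp add: d_def)
    then show ?thesis by simp
  qed
  have "d constant_on unit_square"
  proof (rule continuous_discrete_range_constant)
    have "connected ({0..1} \<times> {0..1} :: (real \<times> real) set)"
      by (intro convex_connected convex_Times) auto
    then show "connected unit_square" by (simp add: unit_square_def)
    show "continuous_on unit_square d"
      unfolding d_def using P[THEN conjunct1] Q[THEN conjunct1]
      by (intro continuous_on_divide continuous_on_diff continuous_on_const) simp_all
    fix x assume x: "x \<in> unit_square"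
    have "1 \<le> norm (d y - d x)" if y: "y \<in> unit_square" "d y \<noteq> d x" for y
    proof -
      obtain m n :: int where "d y = of_int m" "d x = of_int n" using dint x y by (metis Ints_cases)
      then show ?thesis using y(2) by (simp flip: of_int_diff of_int_abs)
    qed
    then show "\<exists>e>0. \<forall>y. y \<in> unit_square \<and> d y \<noteq> d x \<longrightarrow> e \<le> norm (d y - d x)"
      by (intro exI[of _ 1]) auto
  qed
  then obtain k where k: "\<And>s. s \<in> unit_square \<Longrightarrow> d s = k" by (auto simp: constant_on_def)
  have "d (0, 0) = 0" using P Q by (simp add: d_def)
  then have "d s = 0" using k[OF s] k[of "(0, 0)"] by (simp add: unit_square_def)
  then show ?thesis by (simp add: d_def)
qed

lemma csqrt_eq_cis:
  assumes "z \<notin> \<real>\<^sub>\<le>\<^sub>0"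
  shows "csqrt z = of_real (sqrt (cmod z)) * cis (Arg z / 2)"
proof (rule csqrt_unique)
  have "(cis (Arg z / 2))\<^sup>2 = cis (Arg z)" by (simp add: power2_eq_square cis_mult)
  then have "(of_real (sqrt (cmod z)) * cis (Arg z / 2))\<^sup>2 = of_real (cmod z) * cis (Arg z)"
    by (simp add: power_mult_distrib flip: of_real_power)
  then show "(of_real (sqrt (cmod z)) * cis (Arg z / 2))\<^sup>2 = z"
    using rcis_cmod_Arg[of z] by (simp add: rcis_def)
  have "z \<noteq> 0" using assms by auto
  moreover have "Arg z < pi" "- pi < Arg z"
    using assms Arg_bounded[of z] Arg_eq_pi[of z] by (auto simp: complex_nonpos_Reals_iff less_le)
  then have "cos (Arg z / 2) > 0" by (intro cos_gt_zero_pi) auto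
  ultimately show "0 < Re (complex_of_real (sqrt (cmod z)) * cis (Arg z / 2)) \<or>
      Re (complex_of_real (sqrt (cmod z)) * cis (Arg z / 2)) = 0 \<and> 0 \<le> Im (complex_of_real (sqrt (cmod z)) * cis (Arg z / 2))"
    by simp
qed

lemma lin_factor_sqrt_eq:
  assumes "\<And>s. s \<in> unit_square \<Longrightarrow> lin_factor a b s \<notin> \<real>\<^sub>\<le>\<^sub>0" and "s \<in> unit_square"
  shows "lin_factor_sqrt a b s = csqrt (lin_factor a b s)"
  using csqrt_eq_cis[OF assms(1)[OF assms(2)]] lin_factor_arg_eq[OF assms]
  by (simp add: lin_factor_sqrt_def del: csqrt.simps)

definition arcsine :: "real \<Rightarrow> real" where
  "arcsine s = indicator {0<..<1} s * (1 / sqrt (s * (1 - s)))"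

lemma arcsine_measurable [measurable]: "arcsine \<in> borel_measurable borel"
  by (simp add: arcsine_def[abs_def])

text \<open>The map \<open>x \<mapsto> x / (1 + x)\<close> takes the weight \<open>line_weight\<close> on the half-line to the arcsine weight on the unit
interval.\<close>

lemma arcsine_line:
  shows "arcsine s \<ge> 0"
    and "f \<in> borel_measurable borel \<Longrightarrow>
      (\<integral>s. arcsine s *\<^sub>R f s \<partial>lborel) = (\<integral>x. line_weight x *\<^sub>R (f (x / (1 + x)) :: 'a::{banach, second_countable_topology}) \<partial>lborel)"
    and "integrable lborel arcsine"
proof -
  show "arcsine s \<ge> 0" by (simp add: arcsine_def indicator_def)
  have bij: "bij_betw (\<lambda>x::real. x / (1 + x)) {0<..} {0<..<1}"
    by (rule bij_betwI[where g = "\<lambda>s. s / (1 - s)"]) (auto simp: field_simps)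
  then have im: "(\<lambda>x::real. x / (1 + x)) ` {0<..} = {0<..<1}" and inj: "inj_on (\<lambda>x::real. x / (1 + x)) {0<..}"
    by (auto simp: bij_betw_def)
  have *: "distr (density lborel (\<lambda>x. ennreal \<bar>1 / (1 + x)\<^sup>2\<bar> * indicator {0<..} x)) borel (\<lambda>x. x / (1 + x))
      = density lborel (indicator ((\<lambda>x. x / (1 + x)) ` {0<..}))"
  proof (rule distr_density_change_of_variables)
    fix x :: real assume "x \<in> {0<..}"
    then show "((\<lambda>x. x / (1 + x)) has_real_derivative 1 / (1 + x)\<^sup>2) (at x)"
      by (auto intro!: derivative_eq_intros simp: power2_eq_square)
  qed (auto simp: im inj)
  have meas: "density lborel (\<lambda>s. ennreal (indicat_real {0<..<1} s))
      = distr (density lborel (\<lambda>x. ennreal (1 / (1 + x)\<^sup>2 * indicator {0<..} x))) borel (\<lambda>x. x / (1 + x))"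
  proof -
    have e1: "(\<lambda>x::real. ennreal \<bar>1 / (1 + x)\<^sup>2\<bar> * indicator {0<..} x) = (\<lambda>x. ennreal (1 / (1 + x)\<^sup>2 * indicator {0<..} x))"
      by (auto simp: indicator_def)
    have e2: "(indicator {0<..<1} :: real \<Rightarrow> ennreal) = (\<lambda>s. ennreal (indicat_real {0<..<1} s))"
      by (auto simp: indicator_def)
    show ?thesis using * unfolding im e1 e2 by (rule sym)
  qed
  have sub: "1 / (1 + x)\<^sup>2 * indicator {0<..} x * (1 / sqrt (x / (1 + x) * (1 - x / (1 + x)))) = line_weight x" for x :: real
  proof (cases "x > 0")
    case True
    then have "x / (1 + x) * (1 - x / (1 + x)) = x / (1 + x)\<^sup>2"
      by (simp add: field_simps power2_eq_square)
    then show ?thesis using True by (simp add: line_weight_def real_sqrt_divide power2_eq_square)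
  qed (simp add: line_weight_def)
  {
    fix f :: "real \<Rightarrow> 'b::{banach, second_countable_topology}" assume f [measurable]: "f \<in> borel_measurable borel"
    have "(\<integral>s. arcsine s *\<^sub>R f s \<partial>lborel)
        = (\<integral>s. (1 / sqrt (s * (1 - s))) *\<^sub>R f s \<partial>density lborel (\<lambda>s. ennreal (indicat_real {0<..<1} s)))"
      by (subst integral_density) (auto simp: arcsine_def)
    also have "\<dots> = (\<integral>x. (1 / sqrt (x / (1 + x) * (1 - x / (1 + x)))) *\<^sub>R f (x / (1 + x))
        \<partial>density lborel (\<lambda>x. ennreal (1 / (1 + x)\<^sup>2 * indicator {0<..} x)))"
      unfolding meas by (subst integral_distr) auto
    also have "\<dots> = (\<integral>x. (1 / (1 + x)\<^sup>2 * indicator {0<..} x * (1 / sqrt (x / (1 + x) * (1 - x / (1 + x))))) *\<^sub>R f (x / (1 + x)) \<partial>lborel)"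
      by (subst integral_density) auto
    finally show "(\<integral>s. arcsine s *\<^sub>R f s \<partial>lborel) = (\<integral>x. line_weight x *\<^sub>R f (x / (1 + x)) \<partial>lborel)"
      unfolding sub .
  }
  have "integrable (density lborel (\<lambda>s. ennreal (indicat_real {0<..<1} s))) (\<lambda>s. 1 / sqrt (s * (1 - s)))
     \<longleftrightarrow> integrable lborel arcsine"
    by (subst integrable_density) (auto simp: arcsine_def[abs_def])
  moreover have "integrable (density lborel (\<lambda>s. ennreal (indicat_real {0<..<1} s))) (\<lambda>s. 1 / sqrt (s * (1 - s)))
     \<longleftrightarrow> integrable lborel line_weight"
    unfolding meas by (subst integrable_distr_eq, simp, simp, subst integrable_density, simp, simp, simp, simp only: real_scaleR_def sub)
  ultimately show "integrable lborel arcsine" using integrable_line_weight by simp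
qed

lemma integrable_arcsine_product:
  fixes k :: "real \<Rightarrow> real \<Rightarrow> complex"
  assumes k [measurable]: "(\<lambda>(s, t). k s t) \<in> borel_measurable (borel \<Otimes>\<^sub>M borel)"
    and bound: "\<And>s t. s \<in> {0<..<1} \<Longrightarrow> t \<in> {0<..<1} \<Longrightarrow> norm (k s t) \<le> C"
  shows "integrable (lborel \<Otimes>\<^sub>M lborel) (\<lambda>(s, t). (arcsine s * arcsine t) *\<^sub>R k s t)"
    and "(\<integral>s. (\<integral>t. (arcsine s * arcsine t) *\<^sub>R k s t \<partial>lborel) \<partial>lborel)
       = (\<integral>z. (case z of (s, t) \<Rightarrow> (arcsine s * arcsine t) *\<^sub>R k s t) \<partial>(lborel \<Otimes>\<^sub>M lborel))"
proof -
  show int: "integrable (lborel \<Otimes>\<^sub>M lborel) (\<lambda>(s, t). (arcsine s * arcsine t) *\<^sub>R k s t)"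
  proof (rule integrable_product_weight[OF arcsine_line(3), where C = C])
    fix s t
    show "norm ((arcsine s * arcsine t) *\<^sub>R k s t) \<le> C * (arcsine s * arcsine t)"
    proof (cases "s \<in> {0<..<1} \<and> t \<in> {0<..<1}")
      case True
      then show ?thesis
        using mult_left_mono[OF bound, of s t "arcsine s * arcsine t"] arcsine_line(1) by (simp add: mult.commute)
    qed (auto simp: arcsine_def)
  qed measurable
  show "(\<integral>s. (\<integral>t. (arcsine s * arcsine t) *\<^sub>R k s t \<partial>lborel) \<partial>lborel)
       = (\<integral>z. (case z of (s, t) \<Rightarrow> (arcsine s * arcsine t) *\<^sub>R k s t) \<partial>(lborel \<Otimes>\<^sub>M lborel))"
    using lborel_pair.integral_fst[OF int] by simp
qed

text \<open>The indicator functions contained in \<open>arcsine\<close> confine this iterated integral over the plane to the open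
unit square.\<close>

definition FS_euler :: "complex \<Rightarrow> complex \<Rightarrow> complex \<Rightarrow> complex \<Rightarrow> complex" where
  "FS_euler z1 z2 z3 z4 = 1 / of_real (pi\<^sup>2) * (\<integral>s. (\<integral>t. (arcsine s * arcsine t) *\<^sub>R
     (1 / (csqrt (lin_factor z1 z2 (s, t)) * csqrt (lin_factor z3 z4 (s, t)))) \<partial>lborel) \<partial>lborel)"

lemma FS_integral_eq_euler:
  assumes slit: "\<And>s. s \<in> unit_square \<Longrightarrow> lin_factor z1 z2 s \<notin> \<real>\<^sub>\<le>\<^sub>0" "\<And>s. s \<in> unit_square \<Longrightarrow> lin_factor z3 z4 s \<notin> \<real>\<^sub>\<le>\<^sub>0"
    and \<delta>: "\<delta> > 0" "\<And>s. s \<in> unit_square \<Longrightarrow> \<delta> \<le> cmod (lin_factor z1 z2 s)" "\<And>s. s \<in> unit_square \<Longrightarrow> \<delta> \<le> cmod (lin_factor z3 z4 s)"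
  shows "FS_integral z1 z2 z3 z4 = FS_euler z1 z2 z3 z4"
proof -
  define k where "k = (\<lambda>s t. 1 / (csqrt (lin_factor z1 z2 (s, t)) * csqrt (lin_factor z3 z4 (s, t))))"
  have km: "(\<lambda>(s, t). k s t) \<in> borel_measurable (borel \<Otimes>\<^sub>M borel)"
    unfolding k_def lin_factor_def by measurable
  have kb: "norm (k s t) \<le> 1 / \<delta>" if "s \<in> {0<..<1}" "t \<in> {0<..<1}" for s t
    unfolding k_def using that by (intro norm_csqrt_pair_le \<delta>) (auto simp: unit_square_def)
  have "(\<integral>s. (\<integral>t. (arcsine s * arcsine t) *\<^sub>R k s t \<partial>lborel) \<partial>lborel) = (\<integral>z. (case z of (s, t) \<Rightarrow> (arcsine s * arcsine t) *\<^sub>R k s t) \<partial>(lborel \<Otimes>\<^sub>M lborel))"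
    by (rule integrable_arcsine_product(2)[OF km kb])
  also have "\<dots> = (\<integral>s. (case s of (s, t) \<Rightarrow> (arcsine s * arcsine t) *\<^sub>R k s t) \<partial>lborel)"
    by (simp add: lborel_prod)
  also have "\<dots> = (LINT s:unit_square|lborel. 1 / (of_real (sqrt (fst s * (1 - fst s) * snd s * (1 - snd s))) *
             lin_factor_sqrt z1 z2 s * lin_factor_sqrt z3 z4 s))"
    unfolding set_lebesgue_integral_def
  proof (intro Bochner_Integration.integral_cong refl)
    fix z :: "real \<times> real"
    obtain s t where z: "z = (s, t)" by fastforce
    show "(case z of (s, t) \<Rightarrow> (arcsine s * arcsine t) *\<^sub>R k s t) = indicat_real unit_square z *\<^sub>R (1 / (of_real (sqrt (fst z * (1 - fst z) * snd z * (1 - snd z))) *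
             lin_factor_sqrt z1 z2 z * lin_factor_sqrt z3 z4 z))"
    proof (cases "z \<in> unit_square")
      case True
      show ?thesis
      proof (cases "s = 0 \<or> s = 1 \<or> t = 0 \<or> t = 1")
        case False
        then have st: "s \<in> {0<..<1}" "t \<in> {0<..<1}" using True by (auto simp: z unit_square_def)
        have "sqrt (s * (1 - s) * t * (1 - t)) = sqrt (s * (1 - s)) * sqrt (t * (1 - t))"
          by (simp add: real_sqrt_mult)
        then show ?thesis
          using True st lin_factor_sqrt_eq[of z1 z2 z] lin_factor_sqrt_eq[of z3 z4 z] slit
          by (simp add: z k_def arcsine_def scaleR_conv_of_real del: csqrt.simps)
      qed (auto simp: z arcsine_def)
    qed (auto simp: z unit_square_def arcsine_def indicator_def)
  qed
  finally show ?thesis unfolding FS_integral_def FS_euler_def k_def by simp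
qed

section \<open>From the unit square to the quadrant\<close>

text \<open>A factor \<open>lin_factor\<close> is affine in \<open>(s, t)\<close>, hence the bilinear interpolation of its values at the corners of
the square. The relations \<open>id1\<close> and \<open>id2\<close> state that the value at the corner \<open>(1, 1)\<close> is
\<open>c3 / c2 * u1\<^sup>2 * u2\<^sup>2\<close> for the first factor and \<open>c2 / c3 * u1\<^sup>2 * u2\<^sup>2\<close> for the second, so that all four
corner values are positive multiples of \<open>1, u1\<^sup>2, u2\<^sup>2, u1\<^sup>2 * u2\<^sup>2\<close>.\<close>

locale borchardt_forms = rotated_forms +
  assumes id1: "of_real c4 * u1\<^sup>2 + of_real c1 * u2\<^sup>2 - of_real c2 = of_real c3 * u1\<^sup>2 * u2\<^sup>2"
    and id2: "of_real c1 * u1\<^sup>2 + of_real c4 * u2\<^sup>2 - of_real c3 = of_real c2 * u1\<^sup>2 * u2\<^sup>2"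
begin

definition "z1 = 1 - of_real (c4 / c2) * u1\<^sup>2"
definition "z2 = 1 - of_real (c1 / c2) * u2\<^sup>2"
definition "z3 = 1 - of_real (c1 / c3) * u1\<^sup>2"
definition "z4 = 1 - of_real (c4 / c3) * u2\<^sup>2"

lemma lin_factor_bilinear:
  "of_real c2 * lin_factor z1 z2 (s, t) = of_real (c2 * ((1 - s) * (1 - t))) + of_real (c4 * (s * (1 - t))) * u1\<^sup>2
      + of_real (c1 * ((1 - s) * t)) * u2\<^sup>2 + of_real (c3 * (s * t)) * (u1\<^sup>2 * u2\<^sup>2)"
  "of_real c3 * lin_factor z3 z4 (s, t) = of_real (c3 * ((1 - s) * (1 - t))) + of_real (c1 * (s * (1 - t))) * u1\<^sup>2
      + of_real (c4 * ((1 - s) * t)) * u2\<^sup>2 + of_real (c2 * (s * t)) * (u1\<^sup>2 * u2\<^sup>2)"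
proof -
  have "of_real c2 * lin_factor z1 z2 (s, t) = of_real c2 * (1 - of_real s - of_real t) + of_real c4 * u1\<^sup>2 * of_real s + of_real c1 * u2\<^sup>2 * of_real t"
    using c by (simp add: lin_factor_def z1_def z2_def field_simps)
  also have "\<dots> = of_real (c2 * ((1 - s) * (1 - t))) + of_real (c4 * (s * (1 - t))) * u1\<^sup>2
      + of_real (c1 * ((1 - s) * t)) * u2\<^sup>2 + of_real (s * t) * (of_real c4 * u1\<^sup>2 + of_real c1 * u2\<^sup>2 - of_real c2)"
    by (simp add: algebra_simps)
  finally show "of_real c2 * lin_factor z1 z2 (s, t) = of_real (c2 * ((1 - s) * (1 - t))) + of_real (c4 * (s * (1 - t))) * u1\<^sup>2
      + of_real (c1 * ((1 - s) * t)) * u2\<^sup>2 + of_real (c3 * (s * t)) * (u1\<^sup>2 * u2\<^sup>2)"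
    unfolding id1 by (simp add: mult_ac)
  have "of_real c3 * lin_factor z3 z4 (s, t) = of_real c3 * (1 - of_real s - of_real t) + of_real c1 * u1\<^sup>2 * of_real s + of_real c4 * u2\<^sup>2 * of_real t"
    using c by (simp add: lin_factor_def z3_def z4_def field_simps)
  also have "\<dots> = of_real (c3 * ((1 - s) * (1 - t))) + of_real (c1 * (s * (1 - t))) * u1\<^sup>2
      + of_real (c4 * ((1 - s) * t)) * u2\<^sup>2 + of_real (s * t) * (of_real c1 * u1\<^sup>2 + of_real c4 * u2\<^sup>2 - of_real c3)"
    by (simp add: algebra_simps)
  finally show "of_real c3 * lin_factor z3 z4 (s, t) = of_real (c3 * ((1 - s) * (1 - t))) + of_real (c1 * (s * (1 - t))) * u1\<^sup>2
      + of_real (c4 * ((1 - s) * t)) * u2\<^sup>2 + of_real (c2 * (s * t)) * (u1\<^sup>2 * u2\<^sup>2)"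
    unfolding id2 by (simp add: mult_ac)
qed

text \<open>For \<open>s = x / (1 + x)\<close> and \<open>t = y / (1 + y)\<close> the four interpolation weights are \<open>1, x, y, x * y\<close> over
\<open>(1 + x) * (1 + y)\<close>.\<close>

lemma lin_factor_quadrant:
  assumes "x > 0" "y > 0"
  shows "lin_factor z1 z2 (x / (1 + x), y / (1 + y))
      = of_real (1 / (c2 * ((1 + x) * (1 + y)))) * bil c2 c4 c1 c3 (u1\<^sup>2 * of_real x) (u2\<^sup>2 * of_real y)"
    "lin_factor z3 z4 (x / (1 + x), y / (1 + y))
      = of_real (1 / (c3 * ((1 + x) * (1 + y)))) * bil c3 c1 c4 c2 (u1\<^sup>2 * of_real x) (u2\<^sup>2 * of_real y)"
proof -
  let ?s = "x / (1 + x)" and ?t = "y / (1 + y)" and ?w = "1 / ((1 + x) * (1 + y))"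
  have "1 - ?s = 1 / (1 + x)" "1 - ?t = 1 / (1 + y)" using assms by (simp_all add: field_simps)
  then have w: "(1 - ?s) * (1 - ?t) = ?w" "?s * (1 - ?t) = x * ?w" "(1 - ?s) * ?t = y * ?w" "?s * ?t = (x * y) * ?w"
    by simp_all
  have conv: "of_real (a * ?w) + of_real (b * (x * ?w)) * U + of_real (d * (y * ?w)) * V + of_real (f * (x * y * ?w)) * (U * V)
      = of_real ?w * bil a b d f (U * of_real x) (V * of_real y)" for a b d f :: real and U V :: complex
    by (simp only: bil_def of_real_mult) (simp only: algebra_simps)
  have div: "L = of_real (1 / (r * ((1 + x) * (1 + y)))) * B" if "of_real r * L = of_real ?w * B" "r > 0" for r and L B :: complex
  proof -
    have "L = of_real r * L / of_real r" using that(2) by simp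
    also have "\<dots> = of_real ?w * B / of_real r" by (simp only: that(1))
    also have "\<dots> = of_real (?w / r) * B" by (simp only: of_real_divide times_divide_eq_left)
    also have "?w / r = 1 / (r * ((1 + x) * (1 + y)))" by (simp only: divide_divide_eq_left mult.commute)
    finally show ?thesis .
  qed
  have "of_real c2 * lin_factor z1 z2 (?s, ?t) = of_real ?w * bil c2 c4 c1 c3 (u1\<^sup>2 * of_real x) (u2\<^sup>2 * of_real y)"
    unfolding lin_factor_bilinear w by (rule conv)
  then show "lin_factor z1 z2 (?s, ?t)
      = of_real (1 / (c2 * ((1 + x) * (1 + y)))) * bil c2 c4 c1 c3 (u1\<^sup>2 * of_real x) (u2\<^sup>2 * of_real y)"
    using c(2) by (rule div)
  have "of_real c3 * lin_factor z3 z4 (?s, ?t) = of_real ?w * bil c3 c1 c4 c2 (u1\<^sup>2 * of_real x) (u2\<^sup>2 * of_real y)"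
    unfolding lin_factor_bilinear w by (rule conv)
  then show "lin_factor z3 z4 (?s, ?t)
      = of_real (1 / (c3 * ((1 + x) * (1 + y)))) * bil c3 c1 c4 c2 (u1\<^sup>2 * of_real x) (u2\<^sup>2 * of_real y)"
    using c(3) by (rule div)
qed

lemma lin_factor_half_plane:
  obtains \<delta> where "\<delta> > 0"
    "\<And>s. s \<in> unit_square \<Longrightarrow> \<delta> \<le> Re (e * lin_factor z1 z2 s)" "\<And>s. s \<in> unit_square \<Longrightarrow> \<delta> \<le> Re (e * lin_factor z3 z4 s)"
proof -
  define k where "k = min (min c1 c2) (min c3 c4)"
  have k: "k > 0" "k \<le> c1" "k \<le> c2" "k \<le> c3" "k \<le> c4" using c by (auto simp: k_def)
  define m where "m = min (min (Re e) (Re (e * u1\<^sup>2))) (min (Re (e * u2\<^sup>2)) (Re (e * u1\<^sup>2 * u2\<^sup>2)))"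
  have m: "m > 0" using e unfolding m_def by (simp only: min_less_iff_conj)
  have m': "m \<le> Re e" "m \<le> Re (e * u1\<^sup>2)" "m \<le> Re (e * u2\<^sup>2)" "m \<le> Re (e * u1\<^sup>2 * u2\<^sup>2)"
    unfolding m_def by (simp_all only: min_le_iff_disj order_refl simp_thms)
  have gen: "k * m \<le> Re (e * (of_real (a * ((1 - s) * (1 - t))) + of_real (b * (s * (1 - t))) * u1\<^sup>2
      + of_real (d * ((1 - s) * t)) * u2\<^sup>2 + of_real (f * (s * t)) * (u1\<^sup>2 * u2\<^sup>2)))"
    if "k \<le> a" "k \<le> b" "k \<le> d" "k \<le> f" "0 \<le> s" "s \<le> 1" "0 \<le> t" "t \<le> 1" for a b d f s t
  proof -
    have "e * (of_real (a * ((1 - s) * (1 - t))) + of_real (b * (s * (1 - t))) * u1\<^sup>2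
        + of_real (d * ((1 - s) * t)) * u2\<^sup>2 + of_real (f * (s * t)) * (u1\<^sup>2 * u2\<^sup>2))
      = of_real (a * ((1 - s) * (1 - t))) * e + of_real (b * (s * (1 - t))) * (e * u1\<^sup>2)
        + of_real (d * ((1 - s) * t)) * (e * u2\<^sup>2) + of_real (f * (s * t)) * (e * u1\<^sup>2 * u2\<^sup>2)"
      by (simp only: algebra_simps)
    then have "Re (e * (of_real (a * ((1 - s) * (1 - t))) + of_real (b * (s * (1 - t))) * u1\<^sup>2
        + of_real (d * ((1 - s) * t)) * u2\<^sup>2 + of_real (f * (s * t)) * (u1\<^sup>2 * u2\<^sup>2)))
      = a * ((1 - s) * (1 - t)) * Re e + b * (s * (1 - t)) * Re (e * u1\<^sup>2)
        + d * ((1 - s) * t) * Re (e * u2\<^sup>2) + f * (s * t) * Re (e * u1\<^sup>2 * u2\<^sup>2)"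
      by (simp only: plus_complex.sel Re_of_real_mult)
    moreover have "k * ((1 - s) * (1 - t)) * m \<le> a * ((1 - s) * (1 - t)) * Re e"
      "k * (s * (1 - t)) * m \<le> b * (s * (1 - t)) * Re (e * u1\<^sup>2)"
      "k * ((1 - s) * t) * m \<le> d * ((1 - s) * t) * Re (e * u2\<^sup>2)"
      "k * (s * t) * m \<le> f * (s * t) * Re (e * u1\<^sup>2 * u2\<^sup>2)"
      using that k(1) m m' by (intro mult_mono mult_nonneg_nonneg; linarith)+
    moreover have "k * m = k * ((1 - s) * (1 - t)) * m + k * (s * (1 - t)) * m + k * ((1 - s) * t) * m + k * (s * t) * m"
      by (simp add: algebra_simps)
    ultimately show ?thesis by linarith
  qed
  show ?thesis
  proof (rule that)
    show "k * m / max c2 c3 > 0" using k m c by simp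
    have Re: "Re (e * (of_real r * z)) = r * Re (e * z)" for r z
      using Re_of_real_mult[of r "e * z"] by (simp only: mult.left_commute)
    have fin: "k * m / max c2 c3 \<le> v" if "k * m \<le> r * v" "r \<le> max c2 c3" "r > 0" for v r
    proof -
      have "0 < k * m" using k m by simp
      with that have "v > 0" by (metis less_le_trans zero_less_mult_pos)
      then have "r * v \<le> max c2 c3 * v" using that by (intro mult_right_mono) auto
      then have "k * m \<le> max c2 c3 * v" using that by linarith
      then show ?thesis using c by (simp add: pos_divide_le_eq mult.commute)
    qed
    fix s assume "s \<in> unit_square"
    then obtain a b where s: "s = (a, b)" "0 \<le> a" "a \<le> 1" "0 \<le> b" "b \<le> 1" by (auto simp: unit_square_def)
    have "k * m \<le> c2 * Re (e * lin_factor z1 z2 s)" "k * m \<le> c3 * Re (e * lin_factor z3 z4 s)"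
      unfolding Re[symmetric] s(1) lin_factor_bilinear using k s by (intro gen; simp)+
    then show "k * m / max c2 c3 \<le> Re (e * lin_factor z1 z2 s)" "k * m / max c2 c3 \<le> Re (e * lin_factor z3 z4 s)"
      using c by (auto intro!: fin)
  qed
qed

text \<open>Each of the two square roots contributes \<open>sqrt ((1 + x) * (1 + y))\<close>; together they cancel the denominators
of the two weights \<open>line_weight\<close>.\<close>

lemma FS_euler_eq_Q: "FS_euler z1 z2 z3 z4 = of_real (sqrt (c2 * c3) / pi\<^sup>2) * Q (u1\<^sup>2) (u2\<^sup>2)"
proof -
  define k where "k = (\<lambda>s t. 1 / (csqrt (lin_factor z1 z2 (s, t)) * csqrt (lin_factor z3 z4 (s, t))))"
  have [measurable]: "(\<lambda>(s, t). k s t) \<in> borel_measurable (borel \<Otimes>\<^sub>M borel)" "k s \<in> borel_measurable borel" for s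
    unfolding k_def lin_factor_def fst_conv snd_conv by measurable
  have "(\<integral>s. (\<integral>t. (arcsine s * arcsine t) *\<^sub>R k s t \<partial>lborel) \<partial>lborel)
      = (\<integral>s. arcsine s *\<^sub>R (\<integral>t. arcsine t *\<^sub>R k s t \<partial>lborel) \<partial>lborel)"
    by (simp only: integral_scaleR_right scaleR_scaleR[symmetric])
  also have "\<dots> = (\<integral>s. arcsine s *\<^sub>R (\<integral>y. line_weight y *\<^sub>R k s (y / (1 + y)) \<partial>lborel) \<partial>lborel)"
    by (subst arcsine_line(2)) simp_all
  also have "\<dots> = (\<integral>x. line_weight x *\<^sub>R (\<integral>y. line_weight y *\<^sub>R k (x / (1 + x)) (y / (1 + y)) \<partial>lborel) \<partial>lborel)"
    by (rule arcsine_line(2)) measurable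
  also have "\<dots> = (\<integral>x. (\<integral>y. line_weight x *\<^sub>R (line_weight y *\<^sub>R k (x / (1 + x)) (y / (1 + y))) \<partial>lborel) \<partial>lborel)"
    by (simp only: integral_scaleR_right)
  also have "\<dots> = (\<integral>x. (\<integral>y. of_real (sqrt (c2 * c3)) * (indicat_real {0<..} x *\<^sub>R (indicat_real {0<..} y *\<^sub>R \<phi> (u1\<^sup>2) (u2\<^sup>2) x y)) \<partial>lborel) \<partial>lborel)"
  proof (intro Bochner_Integration.integral_cong refl)
    fix x y :: real
    show "line_weight x *\<^sub>R (line_weight y *\<^sub>R k (x / (1 + x)) (y / (1 + y)))
      = of_real (sqrt (c2 * c3)) * (indicat_real {0<..} x *\<^sub>R (indicat_real {0<..} y *\<^sub>R \<phi> (u1\<^sup>2) (u2\<^sup>2) x y))"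
    proof (cases "x > 0 \<and> y > 0")
      case True
      then have xy: "x > 0" "y > 0" by auto
      let ?p = "csqrt (bil c2 c4 c1 c3 (u1\<^sup>2 * of_real x) (u2\<^sup>2 * of_real y))"
      let ?q = "csqrt (bil c3 c1 c4 c2 (u1\<^sup>2 * of_real x) (u2\<^sup>2 * of_real y))"
      let ?t = "(1 + x) * (1 + y)"
      have roots: "csqrt (lin_factor z1 z2 (x / (1 + x), y / (1 + y))) = of_real (sqrt (1 / (c2 * ?t))) * ?p"
        "csqrt (lin_factor z3 z4 (x / (1 + x), y / (1 + y))) = of_real (sqrt (1 / (c3 * ?t))) * ?q"
        unfolding lin_factor_quadrant[OF xy] using c xy by (intro csqrt_scale; simp)+
      have "sqrt (1 / (c2 * ?t)) * sqrt (1 / (c3 * ?t)) = 1 / (sqrt (c2 * c3) * ?t)"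
      proof -
        have "sqrt (1 / (c2 * ?t)) * sqrt (1 / (c3 * ?t)) = sqrt ((1 / ?t)\<^sup>2 * (1 / (c2 * c3)))"
          by (simp add: real_sqrt_mult[symmetric] power2_eq_square mult_ac)
        also have "\<dots> = 1 / ?t * sqrt (1 / (c2 * c3))" using xy by (intro sqrt_power2_mult) simp
        finally show ?thesis by (simp add: real_sqrt_divide)
      qed
      then have den: "complex_of_real (sqrt (1 / (c2 * ?t))) * of_real (sqrt (1 / (c3 * ?t))) = of_real (1 / (sqrt (c2 * c3) * ?t))"
        by (simp only: of_real_mult[symmetric])
      have "k (x / (1 + x)) (y / (1 + y)) = 1 / (of_real (sqrt (1 / (c2 * ?t))) * of_real (sqrt (1 / (c3 * ?t))) * (?p * ?q))"
        unfolding k_def roots by (simp only: mult_ac)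
      also have "\<dots> = of_real (sqrt (c2 * c3)) * of_real ?t / (?p * ?q)"
        unfolding den by (simp del: csqrt.simps)
      finally have "k (x / (1 + x)) (y / (1 + y)) = of_real (sqrt (c2 * c3)) * of_real ?t / (?p * ?q)" .
      moreover have "complex_of_real (1 + x) \<noteq> 0" "complex_of_real (1 + y) \<noteq> 0"
        using xy by (simp_all only: of_real_eq_0_iff)
      ultimately show ?thesis
        using xy by (simp add: line_weight_def \<phi>_def scaleR_conv_of_real del: csqrt.simps)
    qed (auto simp: line_weight_def)
  qed
  also have "\<dots> = of_real (sqrt (c2 * c3)) * Q (u1\<^sup>2) (u2\<^sup>2)"
    by (simp only: Q_def set_lebesgue_integral_def integral_scaleR_right integral_mult_right_zero)
  finally show ?thesis unfolding FS_euler_def k_def by simp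
qed

end

section \<open>Comparison of the hypergeometric series with the Euler integral\<close>

text \<open>The coefficients of \<open>(1 - w) powr (- 1 / 2)\<close>, and also, up to the factor \<open>pi\<close>, the moments of the arcsine
weight; see \<open>inverse_csqrt_sums\<close> and \<open>arcsine_moment\<close>. Both facts together produce the coefficients of the
hypergeometric series.\<close>

definition half_binomial :: "nat \<Rightarrow> real" where
  "half_binomial n = pochhammer (1/2) n / fact n"

text \<open>The coefficients of \<open>(1 - X - Y) powr (- 1 / 2)\<close> as a power series in two variables.\<close>

definition half_trinomial :: "nat \<times> nat \<Rightarrow> real" where
  "half_trinomial p = pochhammer (1/2) (fst p + snd p) / (fact (fst p) * fact (snd p))"

lemma half_binomial_nonneg: "half_binomial n \<ge> 0"
  by (simp add: half_binomial_def pochhammer_nonneg)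

lemma half_trinomial_eq: "half_trinomial (i, j) = half_binomial (i + j) * real (i + j choose i)"
  by (simp add: half_trinomial_def half_binomial_def binomial_fact)

lemma inverse_csqrt_sums:
  fixes w :: complex
  assumes "norm w < 1"
  shows "(\<lambda>n. of_real (half_binomial n) * w ^ n) sums (1 / csqrt (1 - w))"
proof -
  have "(\<lambda>n. ((- (1/2)) gchoose n) * (- w) ^ n) sums (1 + - w) powr (- (1/2))"
    using assms by (intro gen_binomial_complex) simp
  moreover have "((- (1/2)) gchoose n) * (- w) ^ n = of_real (half_binomial n) * w ^ n" for n
  proof -
    have "of_real (pochhammer (1/2) n) = (pochhammer (1/2) n :: complex)"
      using pochhammer_of_real[of "1/2" n, where 'a = complex] by simp
    moreover have "(- 1) ^ n * (- w) ^ n = w ^ n" by (simp flip: power_mult_distrib)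
    ultimately show ?thesis
      by (simp add: gbinomial_pochhammer half_binomial_def)
  qed
  moreover have "(1 + - w) powr (- (1/2)) = 1 / csqrt (1 - w)"
    by (simp add: csqrt_conv_powr powr_minus inverse_eq_divide)
  ultimately show ?thesis by simp
qed

lemma half_binomial_summable:
  assumes "0 \<le> r" "r < 1"
  shows "summable (\<lambda>n. half_binomial n * r ^ n)"
proof -
  have "summable (\<lambda>n. complex_of_real (half_binomial n) * of_real r ^ n)"
    using inverse_csqrt_sums[of "of_real r"] assms by (intro sums_summable) auto
  then have "summable (\<lambda>n. complex_of_real (half_binomial n * r ^ n))" by simp
  then show ?thesis by (subst (asm) summable_complex_of_real)
qed

text \<open>Expand in powers of \<open>X + Y\<close> and then use the binomial theorem. The double series converges absolutely
because the same computation with norms gives \<open>(1 - norm X - norm Y) powr (- 1 / 2)\<close>.\<close>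

lemma inverse_csqrt_double_series:
  fixes X Y :: complex
  assumes XY: "norm X + norm Y < 1"
  shows "(\<lambda>p. norm (of_real (half_trinomial p) * X ^ fst p * Y ^ snd p)) summable_on UNIV"
    and "((\<lambda>p. of_real (half_trinomial p) * X ^ fst p * Y ^ snd p) has_sum (1 / csqrt (1 - X - Y))) UNIV"
proof -
  define h where "h = (\<lambda>(k, i). complex_of_real (half_binomial k * real (k choose i)) * X ^ i * Y ^ (k - i))"
  let ?S = "SIGMA k:UNIV. {..k}"
  have bij: "bij_betw (\<lambda>p::nat \<times> nat. (fst p + snd p, fst p)) UNIV ?S"
    by (rule bij_betwI[where g = "\<lambda>(k, i). (i, k - i)"]) auto
  have hg: "h (fst p + snd p, fst p) = of_real (half_trinomial p) * X ^ fst p * Y ^ snd p" for p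
    by (cases p) (simp add: h_def half_trinomial_eq)
  have inner_norm: "(\<Sum>i\<le>k. norm (h (k, i))) = half_binomial k * (norm X + norm Y) ^ k" for k
    unfolding binomial_ring sum_distrib_left
    by (intro sum.cong) (simp_all add: h_def norm_mult norm_power half_binomial_nonneg abs_mult)
  have inner: "(\<Sum>i\<le>k. h (k, i)) = of_real (half_binomial k) * (X + Y) ^ k" for k
    unfolding binomial_ring sum_distrib_left by (intro sum.cong) (simp_all add: h_def)
  have abs: "(\<lambda>x. norm (h x)) summable_on ?S"
    unfolding Infinite_Sum.abs_summable_on_Sigma_iff
  proof (intro conjI ballI)
    show "(\<lambda>i. norm (h (k, i))) summable_on {..k}" for k by simp
    have "summable (\<lambda>k. half_binomial k * (norm X + norm Y) ^ k)"
      using XY by (intro half_binomial_summable) auto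
    then have "summable (\<lambda>k. norm (half_binomial k * (norm X + norm Y) ^ k))"
      by (simp add: half_binomial_nonneg)
    then have "summable (\<lambda>k. norm (norm (half_binomial k * (norm X + norm Y) ^ k)))" by simp
    then have "(\<lambda>k. norm (half_binomial k * (norm X + norm Y) ^ k)) summable_on UNIV"
      by (rule norm_summable_imp_summable_on)
    then show "(\<lambda>k. norm (\<Sum>\<^sub>\<infinity>i\<in>{..k}. norm (h (k, i)))) summable_on UNIV"
      by (simp add: inner_norm)
  qed
  then show "(\<lambda>p. norm (of_real (half_trinomial p) * X ^ fst p * Y ^ snd p)) summable_on UNIV"
    using summable_on_reindex_bij_betw[OF bij, of "\<lambda>x. norm (h x)"] by (simp add: hg)
  have "norm (X + Y) < 1" using norm_triangle_ineq[of X Y] XY by linarith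
  then have s: "(\<lambda>k. of_real (half_binomial k) * (X + Y) ^ k) sums (1 / csqrt (1 - (X + Y)))"
    by (rule inverse_csqrt_sums)
  have "(h has_sum (1 / csqrt (1 - (X + Y)))) ?S"
  proof (rule has_sum_SigmaI)
    show "((\<lambda>i. h (k, i)) has_sum (of_real (half_binomial k) * (X + Y) ^ k)) {..k}" for k
      unfolding inner[symmetric] by (rule has_sum_finite) simp
    show "((\<lambda>k. of_real (half_binomial k) * (X + Y) ^ k) has_sum (1 / csqrt (1 - (X + Y)))) UNIV"
    proof (rule norm_summable_imp_has_sum[OF _ s])
      have "summable (\<lambda>k. half_binomial k * norm (X + Y) ^ k)"
        using \<open>norm (X + Y) < 1\<close> by (intro half_binomial_summable) auto
      then show "summable (\<lambda>k. norm (of_real (half_binomial k) * (X + Y) ^ k))"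
        by (simp add: norm_mult norm_power half_binomial_nonneg)
    qed
    show "h summable_on ?S" using abs by (rule abs_summable_summable)
  qed
  then show "((\<lambda>p. of_real (half_trinomial p) * X ^ fst p * Y ^ snd p) has_sum (1 / csqrt (1 - X - Y))) UNIV"
    using has_sum_reindex_bij_betw[OF bij, of h] by (simp add: hg diff_diff_eq del: csqrt.simps)
qed

lemma product_has_sum:
  fixes f :: "'a \<Rightarrow> complex" and g :: "'b \<Rightarrow> complex"
  assumes f: "(\<lambda>x. norm (f x)) summable_on UNIV" "(f has_sum S) UNIV" and g: "(\<lambda>x. norm (g x)) summable_on UNIV" "(g has_sum T) UNIV"
  shows "(\<lambda>x. norm (f (fst x) * g (snd x))) summable_on UNIV" "((\<lambda>x. f (fst x) * g (snd x)) has_sum (S * T)) UNIV"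
proof -
  have U: "UNIV = (SIGMA p:(UNIV::'a set). (UNIV::'b set))" by auto
  have abs: "(\<lambda>x. norm (f (fst x) * g (snd x))) summable_on (SIGMA p:(UNIV::'a set). (UNIV::'b set))"
    unfolding Infinite_Sum.abs_summable_on_Sigma_iff
  proof (intro conjI ballI)
    show "(\<lambda>y. norm (f (fst (x, y)) * g (snd (x, y)))) summable_on UNIV" for x
      unfolding fst_conv snd_conv norm_mult by (rule summable_on_cmult_right[OF g(1)])
    have "(\<lambda>x. norm (f x) * (\<Sum>\<^sub>\<infinity>y. norm (g y))) summable_on UNIV"
      by (rule summable_on_cmult_left[OF f(1)])
    then have "(\<lambda>x. \<Sum>\<^sub>\<infinity>y. norm (f (fst (x, y)) * g (snd (x, y)))) summable_on UNIV"
      by (simp add: norm_mult infsum_cmult_right[OF g(1)])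
    then show "(\<lambda>x. norm (\<Sum>\<^sub>\<infinity>y. norm (f (fst (x, y)) * g (snd (x, y))))) summable_on UNIV"
      by (simp add: infsum_nonneg)
  qed
  then show "(\<lambda>x. norm (f (fst x) * g (snd x))) summable_on UNIV" by simp
  show "((\<lambda>x. f (fst x) * g (snd x)) has_sum (S * T)) UNIV"
    unfolding U
  proof (rule has_sum_SigmaI)
    show "((\<lambda>y. f (fst (x, y)) * g (snd (x, y))) has_sum (f x * T)) UNIV" for x
      using has_sum_cmult_right[OF g(2)] by simp
    show "((\<lambda>x. f x * T) has_sum (S * T)) UNIV"
      by (rule has_sum_cmult_left[OF f(2)])
  qed (rule abs_summable_summable[OF abs])
qed

text \<open>The moment is the value of the Beta function at \<open>n + 1 / 2\<close> and \<open>1 / 2\<close>.\<close>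

lemma arcsine_moment:
  shows "(\<integral>s. arcsine s * s ^ n \<partial>lborel) = pi * half_binomial n"
proof -
  have eq: "(if t \<in> {0<..<1} then t powr (real n + 1/2 - 1) * (1 - t) powr (1/2 - 1) else 0) = arcsine t * t ^ n" for t :: real
  proof (cases "t \<in> {0<..<1}")
    case True
    then have t: "t > 0" "1 - t > 0" by auto
    have "t powr (real n + 1/2 - 1) = t powr (real n - 1/2)" by simp
    also have "\<dots> = t ^ n / sqrt t" using t by (simp add: powr_diff powr_realpow powr_half_sqrt)
    finally have "t powr (real n + 1/2 - 1) = t ^ n / sqrt t" .
    moreover have "(1 - t) powr (1/2 - 1) = 1 / sqrt (1 - t)"
      using t powr_minus[of "1 - t" "1/2"] by (simp add: powr_half_sqrt inverse_eq_divide)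
    ultimately show ?thesis using True by (simp add: arcsine_def real_sqrt_mult)
  qed (simp add: arcsine_def)
  have "((\<lambda>t. t powr (real n + 1/2 - 1) * (1 - t) powr (1/2 - 1)) has_integral Beta (real n + 1/2) (1/2)) {0<..<1}"
    using has_integral_Beta_real[of "real n + 1/2" "1/2"] by (simp add: has_integral_Icc_iff_Ioo)
  then have "((\<lambda>t. if t \<in> {0<..<1} then t powr (real n + 1/2 - 1) * (1 - t) powr (1/2 - 1) else 0) has_integral Beta (real n + 1/2) (1/2)) UNIV"
    by (rule has_integral_restrict_UNIV[THEN iffD2])
  then have hi: "((\<lambda>t. arcsine t * t ^ n) has_integral Beta (real n + 1/2) (1/2)) UNIV"
    unfolding eq .
  have nn: "0 \<le> arcsine t * t ^ n" for t by (simp add: arcsine_def indicator_def)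
  have "(\<integral>\<^sup>+t. ennreal (arcsine t * t ^ n) \<partial>lborel) = ennreal (Beta (real n + 1/2) (1/2))"
    by (rule nn_integral_has_integral_lborel[OF _ _ hi]) (use nn in auto)
  then have "(\<integral>t. arcsine t * t ^ n \<partial>lborel) = enn2real (ennreal (Beta (real n + 1/2) (1/2)))"
    using nn by (subst integral_eq_nn_integral) auto
  also have "\<dots> = Beta (real n + 1/2) (1/2)"
    using has_integral_nonneg[OF hi] nn by simp
  also have "\<dots> = pi * half_binomial n"
  proof -
    have "(1/2::real) \<notin> \<int>\<^sub>\<le>\<^sub>0" using nonpos_Ints_nonpos[of "1/2::real"] by auto
    then have "Gamma (1/2 + real n) = pochhammer (1/2) n * sqrt pi"
      using pochhammer_Gamma[of "1/2::real" n] by (simp add: Gamma_one_half_real)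
    moreover have "Gamma (1 + real n) = fact n" by (rule Gamma_fact)
    ultimately show ?thesis by (simp add: Beta_def Gamma_one_half_real half_binomial_def add_ac)
  qed
  finally show ?thesis .
qed

text \<open>Both inverse roots are expanded in double power series, and the product is integrated term by term
against the arcsine weights. A term with the exponents \<open>n1 + n3\<close> of \<open>s\<close> and \<open>n2 + n4\<close> of \<open>t\<close> contributes
a product of two arcsine moments.\<close>

theorem FS_series_eq_euler:
  assumes z12: "cmod z1 + cmod z2 < 1" and z34: "cmod z3 + cmod z4 < 1"
  shows "FS_series z1 z2 z3 z4 = FS_euler z1 z2 z3 z4"
proof -
  define c where "c = (\<lambda>x::(nat \<times> nat) \<times> (nat \<times> nat).
    (of_real (half_trinomial (fst x)) * z1 ^ fst (fst x) * z2 ^ snd (fst x)) *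
    (of_real (half_trinomial (snd x)) * z3 ^ fst (snd x) * z4 ^ snd (snd x)))"
  define a1 a2 where "a1 = (\<lambda>x::(nat \<times> nat) \<times> (nat \<times> nat). fst (fst x) + fst (snd x))"
    and "a2 = (\<lambda>x::(nat \<times> nat) \<times> (nat \<times> nat). snd (fst x) + snd (snd x))"
  define T where "T = (\<lambda>x s t. c x * of_real (s ^ a1 x * t ^ a2 x))"
  define k where "k = (\<lambda>s t. 1 / (csqrt (lin_factor z1 z2 (s, t)) * csqrt (lin_factor z3 z4 (s, t))))"
  have csum: "(\<lambda>x. norm (c x)) summable_on UNIV"
    unfolding c_def by (rule product_has_sum(1)[OF inverse_csqrt_double_series[OF z12] inverse_csqrt_double_series[OF z34]])
  have Tbound: "norm (T x s t) \<le> norm (c x)" if "s \<in> {0<..<1}" "t \<in> {0<..<1}" for x s t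
  proof -
    have "norm (T x s t) = norm (c x) * (s ^ a1 x * t ^ a2 x)"
      using that by (simp add: T_def norm_mult norm_power)
    also have "\<dots> \<le> norm (c x) * 1"
      using that by (intro mult_left_mono mult_le_one power_le_one) auto
    finally show ?thesis by simp
  qed
  have Tsum: "((\<lambda>x. T x s t) has_sum k s t) UNIV" if st: "s \<in> {0<..<1}" "t \<in> {0<..<1}" for s t
  proof -
    have small: "norm (u * of_real s) + norm (w * of_real t) < 1" if "norm u + norm w < 1" for u w :: complex
    proof -
      have "norm u * s \<le> norm u * 1" "norm w * t \<le> norm w * 1" using st by (intro mult_left_mono; simp)+
      then show ?thesis using that st by (simp add: norm_mult)
    qed
    have "((\<lambda>x. (of_real (half_trinomial (fst x)) * (z1 * of_real s) ^ fst (fst x) * (z2 * of_real t) ^ snd (fst x)) *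
        (of_real (half_trinomial (snd x)) * (z3 * of_real s) ^ fst (snd x) * (z4 * of_real t) ^ snd (snd x)))
        has_sum (1 / csqrt (1 - z1 * of_real s - z2 * of_real t) * (1 / csqrt (1 - z3 * of_real s - z4 * of_real t)))) UNIV"
      by (rule product_has_sum(2)[OF inverse_csqrt_double_series[OF small[OF z12]] inverse_csqrt_double_series[OF small[OF z34]]])
    moreover have "(of_real (half_trinomial (fst x)) * (z1 * of_real s) ^ fst (fst x) * (z2 * of_real t) ^ snd (fst x)) *
        (of_real (half_trinomial (snd x)) * (z3 * of_real s) ^ fst (snd x) * (z4 * of_real t) ^ snd (snd x)) = T x s t" for x
      by (simp add: T_def c_def a1_def a2_def power_mult_distrib power_add)
    ultimately show ?thesis by (simp add: k_def lin_factor_def del: csqrt.simps)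
  qed
  \<comment> \<open>An enumeration of the exponents, since integration term by term is a statement about sequences of functions.\<close>
  define b where "b = from_nat_into (UNIV :: ((nat \<times> nat) \<times> (nat \<times> nat)) set)"
  have "infinite (UNIV :: ((nat \<times> nat) \<times> (nat \<times> nat)) set)" by (simp add: finite_prod)
  then have bij: "bij_betw b UNIV UNIV" unfolding b_def by (intro bij_betw_from_nat_into) auto
  have cb: "summable (\<lambda>n. norm (c (b n)))"
    using summable_on_reindex_bij_betw[OF bij, of "\<lambda>x. norm (c x)"] csum by (simp add: summable_on_imp_summable)
  define F where "F = (\<lambda>x (s, t). (arcsine s * arcsine t) *\<^sub>R T x s t)"
  have Tmeas [measurable]: "(\<lambda>(s, t). T x s t) \<in> borel_measurable (borel \<Otimes>\<^sub>M borel)" for x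
    unfolding T_def by measurable
  note TF = integrable_arcsine_product[OF Tmeas Tbound]
  have Fint: "integrable (lborel \<Otimes>\<^sub>M lborel) (F x)" for x
    unfolding F_def by (rule TF(1))
  have one: "(\<integral>z. (case z of (s, t) \<Rightarrow> arcsine s * arcsine t) \<partial>(lborel \<Otimes>\<^sub>M lborel)) = pi\<^sup>2"
    "integrable (lborel \<Otimes>\<^sub>M lborel) (\<lambda>(s, t). arcsine s * arcsine t)"
  proof -
    show i: "integrable (lborel \<Otimes>\<^sub>M lborel) (\<lambda>(s, t). arcsine s * arcsine t)"
      by (rule integrable_product_weight[OF arcsine_line(3), where C = 1]) (auto simp: arcsine_line(1))
    show "(\<integral>z. (case z of (s, t) \<Rightarrow> arcsine s * arcsine t) \<partial>(lborel \<Otimes>\<^sub>M lborel)) = pi\<^sup>2"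
      using lborel_pair.integral_fst[OF i] arcsine_moment[of 0] by (simp add: half_binomial_def power2_eq_square)
  qed
  have Fnorm: "norm (F x z) \<le> norm (c x) * (case z of (s, t) \<Rightarrow> arcsine s * arcsine t)" for x z
  proof -
    obtain s t where z: "z = (s, t)" by fastforce
    show ?thesis
    proof (cases "s \<in> {0<..<1} \<and> t \<in> {0<..<1}")
      case True
      then show ?thesis
        using mult_left_mono[OF Tbound, of s t "arcsine s * arcsine t" x] arcsine_line(1)
        by (simp add: z F_def mult.commute)
    qed (auto simp: z F_def arcsine_def)
  qed
  have Fnorm_int: "(\<integral>z. norm (F x z) \<partial>(lborel \<Otimes>\<^sub>M lborel)) \<le> norm (c x) * pi\<^sup>2" for x
  proof -
    have "(\<integral>z. norm (F x z) \<partial>(lborel \<Otimes>\<^sub>M lborel)) \<le> (\<integral>z. norm (c x) * (case z of (s, t) \<Rightarrow> arcsine s * arcsine t) \<partial>(lborel \<Otimes>\<^sub>M lborel))"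
      using Fnorm by (intro integral_mono integrable_norm Fint integrable_mult_right one(2)) auto
    also have "\<dots> = norm (c x) * pi\<^sup>2" by (simp add: one(1))
    finally show ?thesis .
  qed
  have S1: "AE z in lborel \<Otimes>\<^sub>M lborel. summable (\<lambda>n. norm (F (b n) z))"
    by (intro AE_I2 summable_comparison_test'[OF summable_mult2[OF cb]]) (use Fnorm in simp)
  have S2: "summable (\<lambda>n. (\<integral>z. norm (F (b n) z) \<partial>(lborel \<Otimes>\<^sub>M lborel)))"
    by (rule summable_comparison_test'[OF summable_mult2[OF cb, of "pi\<^sup>2"]])
       (use Fnorm_int in \<open>simp add: integral_nonneg\<close>)
  have "(\<lambda>n. \<integral>z. F (b n) z \<partial>(lborel \<Otimes>\<^sub>M lborel)) sums (\<integral>z. (\<Sum>n. F (b n) z) \<partial>(lborel \<Otimes>\<^sub>M lborel))"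
    by (rule sums_integral[OF Fint S1 S2])
  also have "(\<integral>z. (\<Sum>n. F (b n) z) \<partial>(lborel \<Otimes>\<^sub>M lborel))
      = (\<integral>z. (case z of (s, t) \<Rightarrow> (arcsine s * arcsine t) *\<^sub>R k s t) \<partial>(lborel \<Otimes>\<^sub>M lborel))"
  proof (intro Bochner_Integration.integral_cong refl)
    fix z :: "real \<times> real"
    obtain s t where z: "z = (s, t)" by fastforce
    show "(\<Sum>n. F (b n) z) = (case z of (s, t) \<Rightarrow> (arcsine s * arcsine t) *\<^sub>R k s t)"
    proof (cases "s \<in> {0<..<1} \<and> t \<in> {0<..<1}")
      case True
      then have "((\<lambda>n. T (b n) s t) has_sum k s t) UNIV"
        using has_sum_reindex_bij_betw[OF bij, of "\<lambda>x. T x s t"] Tsum by simp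
      then have "(\<lambda>n. T (b n) s t) sums k s t" by (rule has_sum_imp_sums)
      then have "(\<lambda>n. (arcsine s * arcsine t) *\<^sub>R T (b n) s t) sums ((arcsine s * arcsine t) *\<^sub>R k s t)"
        by (rule sums_scaleR_right)
      then show ?thesis by (simp add: z F_def sums_unique[symmetric])
    qed (auto simp: z F_def arcsine_def)
  qed
  also have "\<dots> = of_real (pi\<^sup>2) * FS_euler z1 z2 z3 z4"
  proof -
    define \<delta> where "\<delta> = min (1 - cmod z1 - cmod z2) (1 - cmod z3 - cmod z4)"
    have \<delta>: "\<delta> > 0" "\<delta> \<le> 1 - cmod z1 - cmod z2" "\<delta> \<le> 1 - cmod z3 - cmod z4" using z12 z34 by (auto simp: \<delta>_def)
    have lo: "\<delta> \<le> norm (lin_factor u w (s, t))" if "s \<in> {0<..<1}" "t \<in> {0<..<1}" "\<delta> \<le> 1 - cmod u - cmod w" for s t u w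
    proof -
      have "norm u * s \<le> norm u * 1" "norm w * t \<le> norm w * 1" using that by (intro mult_left_mono; simp)+
      then have "norm (u * of_real s + w * of_real t) \<le> norm u + norm w"
        using norm_triangle_ineq[of "u * of_real s" "w * of_real t"] that by (simp add: norm_mult)
      moreover have "norm (1::complex) \<le> norm (lin_factor u w (s, t)) + norm (u * of_real s + w * of_real t)"
        using norm_triangle_ineq[of "lin_factor u w (s, t)" "u * of_real s + w * of_real t"] by (simp add: lin_factor_def)
      ultimately show ?thesis using that(3) by simp
    qed
    have kb: "norm (k s t) \<le> 1 / \<delta>" if st: "s \<in> {0<..<1}" "t \<in> {0<..<1}" for s t
      unfolding k_def using \<delta> by (intro norm_csqrt_pair_le lo st) simp_all
    have km: "(\<lambda>(s, t). k s t) \<in> borel_measurable (borel \<Otimes>\<^sub>M borel)"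
      unfolding k_def lin_factor_def by measurable
    have "of_real (pi\<^sup>2) * FS_euler z1 z2 z3 z4 = (\<integral>s. (\<integral>t. (arcsine s * arcsine t) *\<^sub>R k s t \<partial>lborel) \<partial>lborel)"
      by (simp add: FS_euler_def k_def del: csqrt.simps)
    then show ?thesis using integrable_arcsine_product(2)[OF km kb] by simp
  qed
  finally have sums: "(\<lambda>n. \<integral>z. F (b n) z \<partial>(lborel \<Otimes>\<^sub>M lborel)) sums (of_real (pi\<^sup>2) * FS_euler z1 z2 z3 z4)" .
  have "summable (\<lambda>n. norm (\<integral>z. F (b n) z \<partial>(lborel \<Otimes>\<^sub>M lborel)))"
    by (rule summable_comparison_test'[OF S2]) (use integral_norm_bound in simp)
  then have "((\<lambda>n. \<integral>z. F (b n) z \<partial>(lborel \<Otimes>\<^sub>M lborel)) has_sum (of_real (pi\<^sup>2) * FS_euler z1 z2 z3 z4)) UNIV"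
    using sums by (rule norm_summable_imp_has_sum)
  then have "((\<lambda>x. \<integral>z. F x z \<partial>(lborel \<Otimes>\<^sub>M lborel)) has_sum (of_real (pi\<^sup>2) * FS_euler z1 z2 z3 z4)) UNIV"
    using has_sum_reindex_bij_betw[OF bij, of "\<lambda>x. \<integral>z. F x z \<partial>(lborel \<Otimes>\<^sub>M lborel)"] by simp
  moreover have "(\<integral>z. F x z \<partial>(lborel \<Otimes>\<^sub>M lborel)) = c x * of_real (pi * half_binomial (a1 x)) * of_real (pi * half_binomial (a2 x))" for x
  proof -
    have "(\<integral>z. F x z \<partial>(lborel \<Otimes>\<^sub>M lborel)) = (\<integral>s. (\<integral>t. (arcsine s * arcsine t) *\<^sub>R T x s t \<partial>lborel) \<partial>lborel)"
      unfolding F_def by (rule TF(2)[symmetric])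
    also have "\<dots> = (\<integral>s. (\<integral>t. c x * (of_real (arcsine s * s ^ a1 x) * of_real (arcsine t * t ^ a2 x)) \<partial>lborel) \<partial>lborel)"
      by (intro Bochner_Integration.integral_cong refl) (simp add: T_def scaleR_conv_of_real)
    also have "\<dots> = (\<integral>s. c x * (of_real (arcsine s * s ^ a1 x) * of_real (\<integral>t. arcsine t * t ^ a2 x \<partial>lborel)) \<partial>lborel)"
      by (simp only: integral_mult_right_zero integral_complex_of_real)
    also have "\<dots> = c x * (of_real (\<integral>s. arcsine s * s ^ a1 x \<partial>lborel) * of_real (\<integral>t. arcsine t * t ^ a2 x \<partial>lborel))"
      by (simp only: integral_mult_right_zero integral_mult_left_zero integral_complex_of_real)
    finally show ?thesis by (simp only: arcsine_moment mult.assoc)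
  qed
  ultimately have "((\<lambda>x. c x * of_real (pi * half_binomial (a1 x)) * of_real (pi * half_binomial (a2 x)))
      has_sum (of_real (pi\<^sup>2) * FS_euler z1 z2 z3 z4)) UNIV" by simp
  from has_sum_cmult_right[OF this, of "1 / of_real (pi\<^sup>2)"]
  have main: "((\<lambda>x. c x * of_real (half_binomial (a1 x)) * of_real (half_binomial (a2 x))) has_sum FS_euler z1 z2 z3 z4) UNIV"
    by (simp add: power2_eq_square mult_ac)
  let ?j = "\<lambda>x::(nat \<times> nat) \<times> (nat \<times> nat). (fst (fst x), snd (fst x), fst (snd x), snd (snd x))"
  let ?term = "\<lambda>(n1, n2, n3, n4). pochhammer (1/2) (n1 + n3) * pochhammer (1/2) (n2 + n4) *
        pochhammer (1/2) (n1 + n2) * pochhammer (1/2) (n3 + n4) /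
        (pochhammer 1 (n1 + n3) * pochhammer 1 (n2 + n4) *
         fact n1 * fact n2 * fact n3 * fact n4) *
        z1 ^ n1 * z2 ^ n2 * z3 ^ n3 * z4 ^ n4 :: complex"
  have bj: "bij_betw ?j UNIV UNIV"
    by (rule bij_betwI[where g = "\<lambda>(n1, n2, n3, n4). ((n1, n2), (n3, n4))"]) auto
  have half: "complex_of_real (pochhammer (1/2) n) = pochhammer (1/2) n" for n
    using pochhammer_of_real[of "1/2" n, where 'a = complex] by simp
  have "?term (?j x) = c x * of_real (half_binomial (a1 x)) * of_real (half_binomial (a2 x))" for x
    by (simp add: c_def a1_def a2_def half_binomial_def half_trinomial_def half pochhammer_fact[symmetric] case_prod_beta mult_ac)
  then have "(?term has_sum FS_euler z1 z2 z3 z4) UNIV"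
    using has_sum_reindex_bij_betw[OF bj, of ?term] main by simp
  then show ?thesis unfolding FS_series_def by (rule infsumI)
qed

section \<open>The hypergeometric function and the mean\<close>

text \<open>Whether the series or the integral defines the function, its value is the Euler integral with principal
roots: the values of the linear factors on the square, turned by \<open>e\<close>, stay in the right half-plane away from
\<open>0\<close>, so that the continuous branches of the roots are the principal ones.\<close>

lemma (in borchardt_forms) FS_value:
  assumes L: "L > 0" and J: "borchardt_integral c1 c2 c3 c4 = ennreal (pi\<^sup>2 / L)"
  shows "FS z1 z2 z3 z4 = of_real (sqrt (c2 * c3) / L) / (u1 * u2)"
proof -
  obtain \<delta> where \<delta>: "\<delta> > 0"
    "\<And>s. s \<in> unit_square \<Longrightarrow> \<delta> \<le> Re (e * lin_factor z1 z2 s)" "\<And>s. s \<in> unit_square \<Longrightarrow> \<delta> \<le> Re (e * lin_factor z3 z4 s)"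
    using lin_factor_half_plane by blast
  have slit: "lin_factor z1 z2 s \<notin> \<real>\<^sub>\<le>\<^sub>0" "lin_factor z3 z4 s \<notin> \<real>\<^sub>\<le>\<^sub>0" if "s \<in> unit_square" for s
    using half_plane_not_nonpos[OF e(1)] \<delta>(2)[OF that] \<delta>(3)[OF that] \<delta>(1) by (meson less_le_trans)+
  have e0: "e \<noteq> 0" using e by auto
  have euler: "FS z1 z2 z3 z4 = FS_euler z1 z2 z3 z4"
  proof (cases "cmod z1 + cmod z2 < 1 \<and> cmod z3 + cmod z4 < 1")
    case True
    then show ?thesis by (simp add: FS_def FS_series_eq_euler)
  next
    case False
    have "\<forall>s\<in>unit_square. lin_factor z1 z2 s \<noteq> 0 \<and> lin_factor z3 z4 s \<noteq> 0"
      using slit nonpos_Reals_of_real_iff[of 0, where 'a = complex] by (metis of_real_0 order_refl)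
    moreover have "FS_integral z1 z2 z3 z4 = FS_euler z1 z2 z3 z4"
      by (rule FS_integral_eq_euler[OF slit, of "\<delta> / norm e"]) (use \<delta> e0 half_plane_norm[OF _ e0] in auto)
    ultimately show ?thesis unfolding FS_def if_not_P[OF False] by (simp only: if_P)
  qed
  have u0: "u1 \<noteq> 0" "u2 \<noteq> 0" using u by auto
  have "borchardt_integral c1 c2 c4 c3 = ennreal (pi\<^sup>2 / L)"
    using J c by (simp add: borchardt_integral_swap_34)
  then have "u1 * u2 * Q (u1\<^sup>2) (u2\<^sup>2) = of_real (pi\<^sup>2 / L)"
    using Q_real[of "pi\<^sup>2 / L"] L Q_rotation by simp
  then have "Q (u1\<^sup>2) (u2\<^sup>2) = of_real (pi\<^sup>2 / L) / (u1 * u2)"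
    using u0 by (metis mult_eq_0_iff nonzero_mult_div_cancel_left)
  then show ?thesis unfolding euler FS_euler_eq_Q by simp
qed

text \<open>The numerator \<open>N\<close> and the denominator \<open>M\<close> of each fraction have a positive product \<open>4 * X\<close>, so the fraction
is the square of \<open>u = N / (2 * sqrt X)\<close>, and the product \<open>u1 * u2\<close> in \<open>FS_value\<close> supplies the denominator
of the formula. The sign \<open>s\<close> selects one of the two formulas.\<close>

lemma borchardt_mean_FS:
  fixes c1 c2 c3 c4 d1 d2 d3 d4 L :: real and s r12 r13 r24 r34 :: complex
  assumes c: "c1 > c2" "c2 > c3" "c3 > c4" "c4 > 0"
    and d: "d1 = c1 + c2 + c3 + c4" "d2 = c1 + c2 - c3 - c4" "d3 = c1 - c2 + c3 - c4" "d4 = c1 - c2 - c3 + c4"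
    and r: "r12 = csqrt (of_real (d1 * d2))" "r13 = csqrt (of_real (d1 * d3))"
      "r24 = csqrt (of_real (d2 * d4))" "r34 = csqrt (of_real (d3 * d4))"
    and s: "s = 1 \<or> s = - 1"
    and L: "L > 0" and J: "borchardt_integral c1 c2 c3 c4 = ennreal (pi\<^sup>2 / L)"
  defines "q1 \<equiv> (r13 + s * r24) / (r13 - s * r24)" and "q2 \<equiv> (r12 + s * r34) / (r12 - s * r34)"
  shows "of_real L = of_real (4 * sqrt (c2 * c3 * (c1 * c2 - c3 * c4) * (c1 * c3 - c2 * c4))) /
      ((r12 + s * r34) * (r13 + s * r24)) * (1 / FS (1 - of_real (c4 / c2) * q1) (1 - of_real (c1 / c2) * q2)
        (1 - of_real (c1 / c3) * q1) (1 - of_real (c4 / c3) * q2))"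
proof -
  have dpos: "d1 > 0" "d2 > 0" "d3 > 0" and d14: "d1 + d4 = 2 * (c1 + c4)" "d1 - d4 = 2 * (c2 + c3)"
    using c d by auto
  define X12 X13 where "X12 = c1 * c2 - c3 * c4" and "X13 = c1 * c3 - c2 * c4"
  have X: "X12 > 0" "X13 > 0"
    using c mult_strict_mono[of c3 c1 c4 c2] mult_strict_mono[of c2 c1 c4 c3] by (auto simp: X12_def X13_def)
  have dX: "d1 * d3 - d2 * d4 = 4 * X13" "d1 * d2 - d3 * d4 = 4 * X12"
    by (simp_all add: d X12_def X13_def algebra_simps)
  have s2: "s\<^sup>2 = 1" using s by auto
  define N1 N2 M1 M2 where "N1 = r13 + s * r24" and "N2 = r12 + s * r34" and "M1 = r13 - s * r24" and "M2 = r12 - s * r34"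
  have rsq: "r12\<^sup>2 = of_real (d1 * d2)" "r13\<^sup>2 = of_real (d1 * d3)" "r24\<^sup>2 = of_real (d2 * d4)" "r34\<^sup>2 = of_real (d3 * d4)"
    unfolding r by (simp_all only: power2_csqrt)
  have NM: "N1 * M1 = of_real (4 * X13)" "N2 * M2 = of_real (4 * X12)"
  proof -
    have "N1 * M1 = r13\<^sup>2 - s\<^sup>2 * r24\<^sup>2" "N2 * M2 = r12\<^sup>2 - s\<^sup>2 * r34\<^sup>2"
      by (simp_all add: N1_def M1_def N2_def M2_def algebra_simps power2_eq_square)
    then show "N1 * M1 = of_real (4 * X13)" "N2 * M2 = of_real (4 * X12)"
      unfolding rsq s2 dX[symmetric] by simp_all
  qed
  have nz: "N1 \<noteq> 0" "M1 \<noteq> 0" "N2 \<noteq> 0" "M2 \<noteq> 0" using NM X by auto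
  define \<rho> where "\<rho> = sqrt (d2 * d3)"
  have \<rho>: "\<rho> > 0" using dpos by (simp add: \<rho>_def)
  have real_roots: "r12 = of_real (sqrt (d1 * d2))" "r13 = of_real (sqrt (d1 * d3))"
    using dpos by (simp_all add: r csqrt_of_real_nonneg del: csqrt.simps)
  \<comment> \<open>For either sign of \<open>d4\<close>, the four products of roots are real multiples of \<open>\<rho>\<close> and of one further number \<open>\<tau>\<close>, a root of \<open>d1 * d4\<close>.\<close>
  have signed: "\<exists>\<tau>. r13 * r12 = of_real (d1 * \<rho>) \<and> r24 * r34 = of_real (d4 * \<rho>) \<and> r13 * r34 = of_real d3 * \<tau> \<and> r24 * r12 = of_real d2 * \<tau>"
    and half: "Re N1 > 0" "Re N2 > 0" "Re (N1 * N2) > 0" "Re (N1 * cnj N2) > 0"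
  proof -
    have roots: "sqrt (d1 * d3) * sqrt (d1 * d2) = d1 * \<rho>" "sqrt (d2 * a) * sqrt (d3 * a) = a * \<rho>"
      "sqrt (d1 * d3) * sqrt (d3 * a) = d3 * sqrt (d1 * a)" "sqrt (d2 * a) * sqrt (d1 * d2) = d2 * sqrt (d1 * a)" if "a \<ge> 0" for a
      using dpos that by (simp_all add: \<rho>_def real_sqrt_mult)
    have main: "(\<exists>\<tau>. r13 * r12 = of_real (d1 * \<rho>) \<and> r24 * r34 = of_real (d4 * \<rho>) \<and> r13 * r34 = of_real d3 * \<tau> \<and> r24 * r12 = of_real d2 * \<tau>)
      \<and> Re N1 > 0 \<and> Re N2 > 0 \<and> Re (N1 * N2) > 0 \<and> Re (N1 * cnj N2) > 0"
    proof (cases "d4 \<ge> 0")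
      case True
      have R: "r24 = of_real (sqrt (d2 * d4))" "r34 = of_real (sqrt (d3 * d4))"
        using dpos True by (simp_all add: r csqrt_of_real_nonneg del: csqrt.simps)
      have "d2 * d4 < d1 * d3" "d3 * d4 < d1 * d2" using dX X by linarith+
      then have lt: "sqrt (d2 * d4) < sqrt (d1 * d3)" "sqrt (d3 * d4) < sqrt (d1 * d2)" by simp_all
      have ge: "0 \<le> sqrt (d2 * d4)" "0 \<le> sqrt (d3 * d4)" using dpos True by simp_all
      obtain \<sigma> :: real where \<sigma>: "s = of_real \<sigma>" "\<sigma> = 1 \<or> \<sigma> = - 1" using s by (metis of_real_1 of_real_minus)
      have "x + \<sigma> * y > 0" if "y < x" "0 \<le> y" for x y :: real using \<sigma>(2) that by auto
      from this[OF lt(1) ge(1)] this[OF lt(2) ge(2)]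
      have p: "sqrt (d1 * d3) + \<sigma> * sqrt (d2 * d4) > 0" "sqrt (d1 * d2) + \<sigma> * sqrt (d3 * d4) > 0" .
      have NN: "N1 = of_real (sqrt (d1 * d3) + \<sigma> * sqrt (d2 * d4))" "N2 = of_real (sqrt (d1 * d2) + \<sigma> * sqrt (d3 * d4))"
        by (simp_all add: N1_def N2_def real_roots R \<sigma>(1))
      show ?thesis
      proof (intro conjI exI[of _ "of_real (sqrt (d1 * d4))"])
        show "Re (N1 * N2) > 0" "Re (N1 * cnj N2) > 0" "Re N1 > 0" "Re N2 > 0"
          unfolding NN using p by (simp_all only: complex_cnj_complex_of_real of_real_mult[symmetric] Re_complex_of_real mult_pos_pos)
      qed (simp_all only: real_roots R of_real_mult[symmetric] roots[OF True])
    next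
      case False
      define a where "a = - d4"
      have a: "a > 0" "d4 = - a" using False by (auto simp: a_def)
      have R: "r24 = \<i> * of_real (sqrt (d2 * a))" "r34 = \<i> * of_real (sqrt (d3 * a))"
      proof -
        have "csqrt (of_real (- y)) = \<i> * of_real (sqrt y)" if "y > 0" for y
          using csqrt_minus[of "of_real y"] that by (simp del: csqrt.simps csqrt_minus)
        then show "r24 = \<i> * of_real (sqrt (d2 * a))" "r34 = \<i> * of_real (sqrt (d3 * a))"
          using dpos a by (simp_all only: r mult_minus_right mult_pos_pos)
      qed
      obtain \<sigma> :: real where \<sigma>: "s = of_real \<sigma>" "\<sigma> = 1 \<or> \<sigma> = - 1" using s by (metis of_real_1 of_real_minus)
      define x y z w where "x = sqrt (d1 * d3)" and "y = sqrt (d1 * d2)" and "z = sqrt (d2 * a)" and "w = sqrt (d3 * a)"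
      have N: "N1 = Complex x (\<sigma> * z)" "N2 = Complex y (\<sigma> * w)"
        by (simp_all add: N1_def N2_def real_roots R \<sigma>(1) complex_eq_iff x_def y_def z_def w_def)
      have prods: "x * y = d1 * \<rho>" "z * w = a * \<rho>" "x > 0" "y > 0" and ss: "\<sigma> * \<sigma> = 1"
        using roots[of a] a dpos \<sigma>(2) by (auto simp: x_def y_def z_def w_def)
      have "Re (N1 * N2) = x * y - (\<sigma> * \<sigma>) * (z * w)" "Re (N1 * cnj N2) = x * y + (\<sigma> * \<sigma>) * (z * w)"
        by (simp_all add: N algebra_simps)
      \<comment> \<open>Here \<open>s\<^sup>2 = 1\<close> makes both signs give the same real parts.\<close>
      then have "Re (N1 * N2) = (d1 + d4) * \<rho>" "Re (N1 * cnj N2) = (d1 - d4) * \<rho>"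
        unfolding ss prods by (simp_all add: a algebra_simps)
      then have "Re (N1 * N2) > 0" "Re (N1 * cnj N2) > 0" unfolding d14 using \<rho> c by simp_all
      moreover have "Re N1 > 0" "Re N2 > 0" using prods by (simp_all add: N)
      moreover have "r13 * r12 = of_real (d1 * \<rho>)"
        unfolding real_roots of_real_mult[symmetric] roots(1)[OF order_refl] ..
      moreover have "r24 * r34 = of_real (d4 * \<rho>)"
      proof -
        have "r24 * r34 = (\<i> * \<i>) * of_real (sqrt (d2 * a) * sqrt (d3 * a))" by (simp only: R of_real_mult mult_ac)
        also have "\<dots> = of_real (d4 * \<rho>)" unfolding roots(2)[OF less_imp_le[OF a(1)]] by (simp add: a(2))
        finally show ?thesis .
      qed
      moreover have "r13 * r34 = of_real d3 * (\<i> * of_real (sqrt (d1 * a)))"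
      proof -
        have "r13 * r34 = \<i> * of_real (sqrt (d1 * d3) * sqrt (d3 * a))" by (simp only: R real_roots of_real_mult mult_ac)
        then show ?thesis unfolding roots(3)[OF less_imp_le[OF a(1)]] by (simp only: of_real_mult mult_ac)
      qed
      moreover have "r24 * r12 = of_real d2 * (\<i> * of_real (sqrt (d1 * a)))"
      proof -
        have "r24 * r12 = \<i> * of_real (sqrt (d2 * a) * sqrt (d1 * d2))" by (simp only: R real_roots of_real_mult mult_ac)
        then show ?thesis unfolding roots(4)[OF less_imp_le[OF a(1)]] by (simp only: of_real_mult mult_ac)
      qed
      ultimately show ?thesis by blast
    qed
    then show "\<exists>\<tau>. r13 * r12 = of_real (d1 * \<rho>) \<and> r24 * r34 = of_real (d4 * \<rho>) \<and> r13 * r34 = of_real d3 * \<tau> \<and> r24 * r12 = of_real d2 * \<tau>"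
      "Re N1 > 0" "Re N2 > 0" "Re (N1 * N2) > 0" "Re (N1 * cnj N2) > 0" by blast+
  qed
  obtain \<tau> where \<tau>: "r13 * r12 = of_real (d1 * \<rho>)" "r24 * r34 = of_real (d4 * \<rho>)" "r13 * r34 = of_real d3 * \<tau>" "r24 * r12 = of_real d2 * \<tau>"
    using signed by blast
  have ss: "s * s = 1" using s by auto
  have prods: "N1 * M2 = of_real ((d1 - d4) * \<rho>) - s * (of_real (d3 - d2) * \<tau>)"
    "N2 * M1 = of_real ((d1 - d4) * \<rho>) + s * (of_real (d3 - d2) * \<tau>)"
    "M1 * M2 = of_real ((d1 + d4) * \<rho>) - s * (of_real (d3 + d2) * \<tau>)"
    "N1 * N2 = of_real ((d1 + d4) * \<rho>) + s * (of_real (d3 + d2) * \<tau>)"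
  proof -
    have "N1 * M2 = r13 * r12 - s * (r13 * r34) + s * (r24 * r12) - (s * s) * (r24 * r34)"
      "N2 * M1 = r13 * r12 + s * (r13 * r34) - s * (r24 * r12) - (s * s) * (r24 * r34)"
      "M1 * M2 = r13 * r12 - s * (r13 * r34) - s * (r24 * r12) + (s * s) * (r24 * r34)"
      "N1 * N2 = r13 * r12 + s * (r13 * r34) + s * (r24 * r12) + (s * s) * (r24 * r34)"
      by (simp_all add: N1_def N2_def M1_def M2_def algebra_simps)
    then show "N1 * M2 = of_real ((d1 - d4) * \<rho>) - s * (of_real (d3 - d2) * \<tau>)"
      "N2 * M1 = of_real ((d1 - d4) * \<rho>) + s * (of_real (d3 - d2) * \<tau>)"
      "M1 * M2 = of_real ((d1 + d4) * \<rho>) - s * (of_real (d3 + d2) * \<tau>)"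
      "N1 * N2 = of_real ((d1 + d4) * \<rho>) + s * (of_real (d3 + d2) * \<tau>)"
      unfolding \<tau> ss by (simp_all add: algebra_simps)
  qed
  \<comment> \<open>The relations \<open>id1\<close> and \<open>id2\<close>, multiplied by \<open>M1 * M2\<close>; they are linear in \<open>\<rho>\<close> and \<open>\<tau>\<close>.\<close>
  have lin: "of_real c4 * (N1 * M2) + of_real c1 * (N2 * M1) - of_real c2 * (M1 * M2) = of_real c3 * (N1 * N2)"
    "of_real c1 * (N1 * M2) + of_real c4 * (N2 * M1) - of_real c3 * (M1 * M2) = of_real c2 * (N1 * N2)"
    unfolding prods d by (simp_all add: algebra_simps)
  define u1 u2 where "u1 = N1 / of_real (2 * sqrt X13)" and "u2 = N2 / of_real (2 * sqrt X12)"
  have usq: "u1\<^sup>2 = N1 / M1" "u2\<^sup>2 = N2 / M2"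
  proof -
    have "(complex_of_real (2 * sqrt X13))\<^sup>2 = N1 * M1" "(complex_of_real (2 * sqrt X12))\<^sup>2 = N2 * M2"
      unfolding NM of_real_power[symmetric] using X by (simp_all add: power_mult_distrib)
    then show "u1\<^sup>2 = N1 / M1" "u2\<^sup>2 = N2 / M2"
      using nz by (simp_all add: u1_def u2_def power_divide power2_eq_square)
  qed
  define k where "k = 1 / (2 * sqrt X13)"
  define l where "l = 1 / (2 * sqrt X12)"
  have kl: "k > 0" "l > 0" using X by (simp_all add: k_def l_def)
  have uk: "u1 = of_real k * N1" "u2 = of_real l * N2" by (simp_all add: u1_def u2_def k_def l_def)
  have pos: "Re (u1 * u2) > 0" "Re (u1 * cnj u2) > 0" "Re u1 > 0" "Re u2 > 0"
  proof -
    have "u1 * u2 = of_real (k * l) * (N1 * N2)" "u1 * cnj u2 = of_real (k * l) * (N1 * cnj N2)"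
      unfolding uk by (simp_all add: mult_ac)
    then show "Re (u1 * u2) > 0" "Re (u1 * cnj u2) > 0"
      using half kl by (simp_all only: Re_of_real_mult mult_pos_pos)
    show "Re u1 > 0" "Re u2 > 0" unfolding uk using half kl by (simp_all only: Re_of_real_mult mult_pos_pos)
  qed
  \<comment> \<open>Up to positive factors \<open>e\<close>, \<open>e * u1\<^sup>2\<close>, \<open>e * u2\<^sup>2\<close>, \<open>e * u1\<^sup>2 * u2\<^sup>2\<close> are \<open>cnj (u1 * u2)\<close>, \<open>u1 * cnj u2\<close>, \<open>cnj u1 * u2\<close>, \<open>u1 * u2\<close>.\<close>
  define e where "e = cnj (u1 * u2)"
  interpret borchardt_forms c1 c2 c3 c4 e u1 u2
  proof
    show "c1 > 0" "c2 > 0" "c3 > 0" "c4 > 0" using c by auto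
    have n: "norm u1 > 0" "norm u2 > 0" using pos by auto
    have E: "e * u1\<^sup>2 = of_real ((norm u1)\<^sup>2) * (u1 * cnj u2)" "e * u2\<^sup>2 = of_real ((norm u2)\<^sup>2) * cnj (u1 * cnj u2)"
      "e * u1\<^sup>2 * u2\<^sup>2 = of_real ((norm u1)\<^sup>2 * (norm u2)\<^sup>2) * (u1 * u2)"
      unfolding e_def of_real_mult complex_norm_square by (simp_all add: power2_eq_square mult_ac)
    show "Re e > 0" using pos by (simp add: e_def)
    show "Re (e * u1\<^sup>2) > 0" "Re (e * u2\<^sup>2) > 0" "Re (e * u1\<^sup>2 * u2\<^sup>2) > 0"
      unfolding E(3) unfolding E(1,2) Re_of_real_mult cnj.sel using pos n by (simp_all only: mult_pos_pos zero_less_power)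
    show "Re u1 > 0" "Re u2 > 0" by fact+
    show "of_real c4 * u1\<^sup>2 + of_real c1 * u2\<^sup>2 - of_real c2 = of_real c3 * u1\<^sup>2 * u2\<^sup>2"
      "of_real c1 * u1\<^sup>2 + of_real c4 * u2\<^sup>2 - of_real c3 = of_real c2 * u1\<^sup>2 * u2\<^sup>2"
    proof -
      have "(of_real c4 * (N1 * M2) + of_real c1 * (N2 * M1) - of_real c2 * (M1 * M2)) / (M1 * M2) = of_real c3 * (N1 * N2) / (M1 * M2)"
        "(of_real c1 * (N1 * M2) + of_real c4 * (N2 * M1) - of_real c3 * (M1 * M2)) / (M1 * M2) = of_real c2 * (N1 * N2) / (M1 * M2)"
        unfolding lin by (rule refl)+
      then show "of_real c4 * u1\<^sup>2 + of_real c1 * u2\<^sup>2 - of_real c2 = of_real c3 * u1\<^sup>2 * u2\<^sup>2"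
        "of_real c1 * u1\<^sup>2 + of_real c4 * u2\<^sup>2 - of_real c3 = of_real c2 * u1\<^sup>2 * u2\<^sup>2"
        unfolding usq using nz by (simp_all add: add_divide_distrib diff_divide_distrib)
    qed
  qed
  have q: "q1 = u1\<^sup>2" "q2 = u2\<^sup>2" unfolding usq q1_def q2_def N1_def N2_def M1_def M2_def by (rule refl)+
  have FS: "FS (1 - of_real (c4 / c2) * q1) (1 - of_real (c1 / c2) * q2) (1 - of_real (c1 / c3) * q1) (1 - of_real (c4 / c3) * q2)
      = of_real (sqrt (c2 * c3) / L) / (u1 * u2)"
    using FS_value[OF L J] unfolding z1_def z2_def z3_def z4_def q .
  have "4 * sqrt (c2 * c3 * (c1 * c2 - c3 * c4) * (c1 * c3 - c2 * c4)) = sqrt (c2 * c3) * (2 * sqrt X13) * (2 * sqrt X12)"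
    unfolding X12_def[symmetric] X13_def[symmetric] by (simp add: real_sqrt_mult)
  then have K: "complex_of_real (4 * sqrt (c2 * c3 * (c1 * c2 - c3 * c4) * (c1 * c3 - c2 * c4)))
      = of_real (sqrt (c2 * c3)) * of_real (2 * sqrt X13) * of_real (2 * sqrt X12)"
    by (simp only: of_real_mult)
  have nz': "complex_of_real (2 * sqrt X13) \<noteq> 0" "complex_of_real (2 * sqrt X12) \<noteq> 0" "complex_of_real (sqrt (c2 * c3)) \<noteq> 0"
    using X c by auto
  have "a * b * d / (N2 * N1) * (1 / ((a / of_real L) / ((N1 / b) * (N2 / d)))) = of_real L" if "a \<noteq> 0" "b \<noteq> 0" "d \<noteq> 0" for a b d :: complex
    using that nz L by (simp add: field_simps)
  from this[OF nz'(3,1,2)] show ?thesis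
    unfolding FS K u1_def u2_def N1_def[symmetric] N2_def[symmetric] of_real_divide[of "sqrt (c2 * c3)"] by simp
qed

theorem theorem4:
  fixes c1 c2 c3 c4 d1 d2 d3 d4 :: real
    and r12 r13 r24 r34 K z1 z2 z3 z4 w1 w2 w3 w4 :: complex
  assumes "c1 > c2" and "c2 > c3" and "c3 > c4" and "c4 > 0"
    and "d1 = c1 + c2 + c3 + c4"
    and "d2 = c1 + c2 - c3 - c4"
    and "d3 = c1 - c2 + c3 - c4"
    and "d4 = c1 - c2 - c3 + c4"
    and "r12 = csqrt (of_real (d1 * d2))"
    and "r13 = csqrt (of_real (d1 * d3))"
    and "r24 = csqrt (of_real (d2 * d4))"
    and "r34 = csqrt (of_real (d3 * d4))"
    and "K = of_real (4 * sqrt (c2 * c3 * (c1 * c2 - c3 * c4) * (c1 * c3 - c2 * c4)))"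
    and "z1 = 1 - of_real (c4 / c2) * ((r13 - r24) / (r13 + r24))"
    and "z2 = 1 - of_real (c1 / c2) * ((r12 - r34) / (r12 + r34))"
    and "z3 = 1 - of_real (c1 / c3) * ((r13 - r24) / (r13 + r24))"
    and "z4 = 1 - of_real (c4 / c3) * ((r12 - r34) / (r12 + r34))"
    and "w1 = 1 - of_real (c4 / c2) * ((r13 + r24) / (r13 - r24))"
    and "w2 = 1 - of_real (c1 / c2) * ((r12 + r34) / (r12 - r34))"
    and "w3 = 1 - of_real (c1 / c3) * ((r13 + r24) / (r13 - r24))"
    and "w4 = 1 - of_real (c4 / c3) * ((r12 + r34) / (r12 - r34))"
  shows "(\<forall>i. (\<lambda>n. (borchardt ^^ n) (vector [c1, c2, c3, c4]) $ i)
              \<longlonglongrightarrow> borchardt_mean (vector [c1, c2, c3, c4]))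
    \<and> of_real (borchardt_mean (vector [c1, c2, c3, c4]))
        = K / ((r12 - r34) * (r13 - r24)) * (1 / FS z1 z2 z3 z4)
    \<and> of_real (borchardt_mean (vector [c1, c2, c3, c4]))
        = K / ((r12 + r34) * (r13 + r24)) * (1 / FS w1 w2 w3 w4)"
proof -
  have "strictly_decreasing4 (vector [c1, c2, c3, c4])"
    using assms(1-4) by (simp add: strictly_decreasing4_def vector_4)
  from borchardt_limit[OF this, unfolded vector_4]
  obtain L where L: "L > 0" "\<And>i. (\<lambda>n. (borchardt ^^ n) (vector [c1, c2, c3, c4]) $ i) \<longlonglongrightarrow> L"
    and J: "borchardt_integral c1 c2 c3 c4 = ennreal (pi\<^sup>2 / L)"
    by blast
  have mean: "borchardt_mean (vector [c1, c2, c3, c4]) = L" by (rule borchardt_mean_eq[OF L(2)])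
  note FS = borchardt_mean_FS[OF assms(1-12) _ L(1) J]
  show ?thesis
    unfolding mean using L(2) FS[of "- 1"] FS[of 1] by (simp add: assms(13-21))
qed

end
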